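(* Let $\mathcal{A}(c)=\mathbb{C}[L^{c,c^{-1}}]$, with its structure of a (complexified) cluster algebra with principal coefficients at the initial seed with cluster $\mathbf{x}=(x_{\omega_i;c}:i\in I)$, coefficient tuple $(y_{i;c}:i\in I)$ and exchange matrix $B(c)$, where $I=\{1,\dots,n\}$ and $c=s_1\cdots s_n$. Let $z=x_{\gamma;c}$ for some $\gamma\in\Pi(c)$. Then the $F$-polynomial $F_{z;\mathbf{x}}$ is given by $$F_{z;\mathbf{x}}(t_1,\dots,t_n)=\Delta_{\gamma,\gamma}\big(x_{\bar1}(1)\cdots x_{\bar n}(1)\,x_n(t_n)\cdots x_1(t_1)\big).$$
   Context: Root data. $G$ is a simply connected semisimple complex group with Cartan matrix $A=(a_{i,j})_{i,j\in I}$, $I=\{1,\dots,n\}$, simple roots $\alpha_i$, simple coroots $\alpha_i^\vee$, $a_{i,j}=\alpha_j(\alpha_i^\vee)$, fundamental weights $\omega_i$ ($\alpha_j=\sum_i a_{i,j}\omega_i$), and Weyl group $W$ generated by simple reflections $s_i$, with longest element $w_\circ$; $\omega_{i^\star}=-w_\circ\omega_i$. The index set is numbered so that the fixed Coxeter element is $c=s_1\cdots s_n$. Write $i\prec_c j$ if $a_{i,j}\ne0$ and $i<j$. $B(c)=(b_{i,j})$: $b_{i,j}=-a_{i,j}$ if $i\prec_c j$, $b_{i,j}=a_{i,j}$ if $j\prec_c i$, $b_{i,j}=0$ otherwise. Order weights by $\gamma\ge\delta$ iff $\gamma-\delta$ is a nonnegative integer combination of simple roots; $h(i;c)$ is the (unique)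 positive integer with $\omega_i>c\omega_i>\cdots>c^{h(i;c)}\omega_i=-\omega_{i^\star}$; $\Pi(c)=\{c^m\omega_i:i\in I,\,0\le m\le h(i;c)\}$. Group. Let $\varphi_i:SL_2\to G$ be the canonical embedding for $\alpha_i$, $x_i(t)=\varphi_i\begin{pmatrix}1&t\\0&1\end{pmatrix}$, $x_{\bar i}(t)=\varphi_i\begin{pmatrix}1&0\\t&1\end{pmatrix}$, $\overline{s_i}=\varphi_i\begin{pmatrix}0&-1\\1&0\end{pmatrix}$. $N$ (resp. $N_-$) is generated by all $x_i(t)$ (resp. $x_{\bar i}(t)$), $H$ is the maximal torus, $B_-=HN_-$. $\overline{w}=\overline{s_{i_1}}\cdots\overline{s_{i_\ell}}$ for any reduced word of $w\in W$. Each $x\in N_-HN$ is uniquely $[x]_-[x]_0[x]_+$ with factors in $N_-,H,N$; a weight $\gamma$ is a character $a\mapsto a^\gamma$ of $H$. The generalized minor $\Delta_{u\omega_i,v\omega_i}$ ($u,v\in W$) is the regular function on $G$ restricting to $x\mapsto([\overline{u}^{-1}x\overline{v}]_0)^{\omega_i}$ on $\overline{u}N_-HN\overline{v}^{-1}$; it depends only on $u\omega_i,v\omega_i$. $L^{c,c^{-1}}=N\overline{c}N\cap B_-c^{-1}B_-$. $x_{\gamma;c}$ is the restriction of $\Delta_{\gamma,\gamma}$ to $L^{c,c^{-1}}$; each $\Delta_{\omega_i,c\omega_i}$ vanishes nowhere on $L^{c,c^{-1}}$, and $y_{j;c}$ is the restriction of $\Delta_{\omega_j,c\omega_j}\prod_{i\prec_c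 j}\Delta_{\omega_i,c\omega_i}^{a_{i,j}}$. Cluster algebras. $\mathrm{Trop}(u_j:j\in J)$ is the free abelian multiplicative group on the $u_j$ with $\prod u_j^{a_j}\oplus\prod u_j^{b_j}=\prod u_j^{\min(a_j,b_j)}$. Here the coefficient semifield is $\mathbb{P}=\mathrm{Trop}(y_{i;c}:i\in I)$ (principal coefficients) and the ambient field is the fraction field of $\mathbb{C}[L^{c,c^{-1}}]$, generated over $\mathbb{C}$ by the algebraically independent elements $x_{\omega_i;c},y_{i;c}$. A seed is $(\mathbf{x},\mathbf{y},B)$ with cluster $\mathbf{x}$, coefficient tuple $\mathbf{y}$ in $\mathbb{P}$, and exchange matrix $B$. With $[b]_+=\max(b,0)$, the mutation $\mu_k$ gives $(\mathbf{x}',\mathbf{y}',B')$: $b'_{i,j}=-b_{i,j}$ if $i=k$ or $j=k$, otherwise $b'_{i,j}=b_{i,j}+[b_{i,k}]_+[b_{k,j}]_+-[-b_{i,k}]_+[-b_{k,j}]_+$; $y'_k=y_k^{-1}$, $y'_j=y_jy_k^{[b_{k,j}]_+}(y_k\oplus1)^{-b_{k,j}}$ for $j\ne k$; $x'_j=x_j$ for $j\ne k$, $x_kx'_k=\dfrac{y_k\prod_i x_i^{[b_{i,k}]_+}+\prod_i x_i^{[-b_{i,k}]_+}}{y_k\oplus1}$. Cluster variables are all elements of clusters of seeds obtained from the initial seed by sequences of mutations; they are exactly the $x_{\gamma;c}$ with $\gamma\in\Pi(c)$. $F$-polynomials. Write the initial seed as $(x_1,\dots,x_n)$, $(y_1,\dots,y_n)$,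 $B(c)=(b_{i,j})$ and set $\widehat y_j=y_j\prod_{i=1}^n x_i^{b_{i,j}}$. Every cluster variable $z$ can be uniquely written as $z=x_1^{g_1}\cdots x_n^{g_n}F_{z;\mathbf{x}}(\widehat y_1,\dots,\widehat y_n)$ with $(g_1,\dots,g_n)\in\mathbb{Z}^n$ and $F_{z;\mathbf{x}}\in\mathbb{Z}[u_1,\dots,u_n]$ a polynomial not divisible by any $u_i$; $F_{z;\mathbf{x}}$ is the $F$-polynomial of $z$. *)

theory Defs
  imports
    "HOL-Analysis.Analysis"
    "HOL-Algebra.Solvable_Groups"
    "HOL-Computational_Algebra.Polynomial"
    "HOL-Library.Poly_Mapping"
begin

section \<open>Complex linear algebraic groups\<close>

type_synonym 'm cmat = "complex ^ 'm ^ 'm"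

inductive matrix_poly :: "('m::finite cmat \<Rightarrow> complex) \<Rightarrow> bool" where
  const: "matrix_poly (\<lambda>_. a)"
| entry: "matrix_poly (\<lambda>g. g $ r $ s)"
| add: "matrix_poly P \<Longrightarrow> matrix_poly Q \<Longrightarrow> matrix_poly (\<lambda>g. P g + Q g)"
| mult: "matrix_poly P \<Longrightarrow> matrix_poly Q \<Longrightarrow> matrix_poly (\<lambda>g. P g * Q g)"

text \<open>Regular functions on a locally closed set of matrices: locally, quotients of polynomials
  in the matrix entries.\<close>

definition regular_on :: "'m::finite cmat set \<Rightarrow> ('m cmat \<Rightarrow> complex) \<Rightarrow> bool" where
  "regular_on S f \<longleftrightarrow>
     (\<forall>p\<in>S. \<exists>P Q. matrix_poly P \<and> matrix_poly Q \<and> Q p \<noteq> 0 \<and>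
        (\<forall>g\<in>S. Q g \<noteq> 0 \<longrightarrow> f g = P g / Q g))"

definition coordinate_ring :: "'m::finite cmat set \<Rightarrow> ('m cmat \<Rightarrow> complex) set" where
  "coordinate_ring S = {f \<in> extensional S. regular_on S f}"

definition matrix_group :: "'m::finite cmat set \<Rightarrow> 'm cmat monoid" where
  "matrix_group G = \<lparr>carrier = G, mult = (**), one = mat 1\<rparr>"

definition linear_algebraic_group :: "'m::finite cmat set \<Rightarrow> bool" where
  "linear_algebraic_group G \<longleftrightarrow>
     subgroup G (matrix_group {g. invertible g}) \<and>
     (\<exists>E. (\<forall>P\<in>E. matrix_poly P) \<and> G = {g. invertible g \<and> (\<forall>P\<in>E. P g = 0)})"

text \<open>For complex algebraic groups, connectedness in the Zariski topology and in the
  classical topology (used here) coincide.\<close>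

definition semisimple_group :: "'m::finite cmat set \<Rightarrow> bool" where
  "semisimple_group G \<longleftrightarrow>
     linear_algebraic_group G \<and> connected G \<and>
     (\<forall>R. linear_algebraic_group R \<and> connected R \<and> R \<lhd> matrix_group G \<and>
          solvable (matrix_group R) \<longrightarrow> R = {mat 1})"

definition algebraic_torus :: "'m::finite cmat set \<Rightarrow> bool" where
  "algebraic_torus T \<longleftrightarrow>
     linear_algebraic_group T \<and> connected T \<and>
     (\<exists>P :: 'm cmat. invertible P \<and> (\<forall>h\<in>T. \<forall>r s. r \<noteq> s \<longrightarrow> (P ** h ** matrix_inv P) $ r $ s = 0))"

definition maximal_torus :: "'m::finite cmat set \<Rightarrow> 'm cmat set \<Rightarrow> bool" where
  "maximal_torus G H \<longleftrightarrow>
     algebraic_torus H \<and> H \<subseteq> G \<and>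
     (\<forall>T. algebraic_torus T \<and> T \<subseteq> G \<and> H \<subseteq> T \<longrightarrow> T = H)"

definition characters :: "'m::finite cmat set \<Rightarrow> ('m cmat \<Rightarrow> complex) set" where
  "characters H = {\<xi> \<in> coordinate_ring H.
     (\<forall>a\<in>H. \<xi> a \<noteq> 0) \<and> (\<forall>a\<in>H. \<forall>b\<in>H. \<xi> (a ** b) = \<xi> a * \<xi> b)}"

text \<open>\<open>u\<close> is a one-parameter additive subgroup of \<open>G\<close> normalized by \<open>H\<close> with weight \<open>\<beta>\<close>.
  The roots are the nontrivial characters which admit such a subgroup.\<close>

definition root_subgroup ::
  "'m::finite cmat set \<Rightarrow> 'm cmat set \<Rightarrow> ('m cmat \<Rightarrow> complex) \<Rightarrow> (complex \<Rightarrow> 'm cmat) \<Rightarrow> bool" where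
  "root_subgroup G H \<beta> u \<longleftrightarrow>
     inj u \<and> range u \<subseteq> G \<and> (\<forall>s t. u (s + t) = u s ** u t) \<and>
     (\<forall>r s. \<exists>p. \<forall>t. u t $ r $ s = poly p t) \<and>
     (\<forall>h\<in>H. \<forall>t. h ** u t ** matrix_inv h = u (\<beta> h * t))"

definition roots :: "'m::finite cmat set \<Rightarrow> 'm cmat set \<Rightarrow> ('m cmat \<Rightarrow> complex) set" where
  "roots G H = {\<beta> \<in> characters H. (\<exists>h\<in>H. \<beta> h \<noteq> 1) \<and> (\<exists>u. root_subgroup G H \<beta> u)}"

definition is_root_base ::
  "'m::finite cmat set \<Rightarrow> 'm cmat set \<Rightarrow> nat set \<Rightarrow> (nat \<Rightarrow> 'm cmat \<Rightarrow> complex) \<Rightarrow> bool" where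
  "is_root_base G H I \<alpha> \<longleftrightarrow>
     (\<forall>i\<in>I. \<alpha> i \<in> roots G H) \<and>
     (\<forall>m :: nat \<Rightarrow> int. (\<forall>h\<in>H. (\<Prod>i\<in>I. \<alpha> i h powi m i) = 1) \<longrightarrow> (\<forall>i\<in>I. m i = 0)) \<and>
     (\<forall>\<beta>\<in>roots G H. \<exists>m :: nat \<Rightarrow> int.
        ((\<forall>i\<in>I. 0 \<le> m i) \<or> (\<forall>i\<in>I. m i \<le> 0)) \<and> (\<forall>h\<in>H. \<beta> h = (\<Prod>i\<in>I. \<alpha> i h powi m i)))"

definition mat2 :: "complex \<Rightarrow> complex \<Rightarrow> complex \<Rightarrow> complex \<Rightarrow> complex ^ 2 ^ 2" where
  "mat2 a b c d = vector [vector [a, b], vector [c, d]]"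

definition SL2 :: "(complex ^ 2 ^ 2) set" where
  "SL2 = {g. det g = 1}"


section \<open>Simply connected semisimple groups with Cartan matrix\<close>

record ('m::finite) pinned_group =
  rk :: nat
  cartan :: "nat \<Rightarrow> nat \<Rightarrow> int"
  grp :: "'m cmat set"
  torus :: "'m cmat set"
  simple_root :: "nat \<Rightarrow> 'm cmat \<Rightarrow> complex"
  emb :: "nat \<Rightarrow> complex ^ 2 ^ 2 \<Rightarrow> 'm cmat"

abbreviation index_set :: "('m::finite) pinned_group \<Rightarrow> nat set" where
  "index_set D \<equiv> {1..rk D}"

definition x_pos :: "('m::finite) pinned_group \<Rightarrow> nat \<Rightarrow> complex \<Rightarrow> 'm cmat" where
  "x_pos D i t = emb D i (mat2 1 t 0 1)"

definition x_neg :: "('m::finite) pinned_group \<Rightarrow> nat \<Rightarrow> complex \<Rightarrow> 'm cmat" where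
  "x_neg D i t = emb D i (mat2 1 0 t 1)"

definition coroot :: "('m::finite) pinned_group \<Rightarrow> nat \<Rightarrow> complex \<Rightarrow> 'm cmat" where
  "coroot D i t = emb D i (mat2 t 0 0 (1 / t))"

definition s_bar :: "('m::finite) pinned_group \<Rightarrow> nat \<Rightarrow> 'm cmat" where
  "s_bar D i = emb D i (mat2 0 (- 1) 1 0)"

text \<open>The last clause is simple connectedness in the sense of algebraic groups: the character
  group of the maximal torus is the full weight lattice, i.e. pairing with the simple coroots
  identifies it with \<open>\<int>\<^sup>I\<close>.\<close>

definition simply_connected_semisimple :: "('m::finite) pinned_group \<Rightarrow> bool" where
  "simply_connected_semisimple D \<longleftrightarrow>
     semisimple_group (grp D) \<and> maximal_torus (grp D) (torus D) \<and>
     is_root_base (grp D) (torus D) (index_set D) (simple_root D) \<and>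
     (\<forall>i\<in>index_set D.
        (\<forall>r s. regular_on SL2 (\<lambda>g. emb D i g $ r $ s)) \<and>
        inj_on (emb D i) SL2 \<and>
        (\<forall>g\<in>SL2. \<forall>h\<in>SL2. emb D i (g ** h) = emb D i g ** emb D i h) \<and>
        emb D i ` SL2 \<subseteq> grp D \<and>
        (\<forall>t. t \<noteq> 0 \<longrightarrow> coroot D i t \<in> torus D) \<and>
        root_subgroup (grp D) (torus D) (simple_root D i) (x_pos D i) \<and>
        root_subgroup (grp D) (torus D) (\<lambda>h. inverse (simple_root D i h)) (x_neg D i)) \<and>
     (\<forall>i\<in>index_set D. \<forall>j\<in>index_set D. \<forall>t. t \<noteq> 0 \<longrightarrow>
        simple_root D j (coroot D i t) = t powi cartan D i j) \<and>
     (\<forall>\<gamma> :: nat \<Rightarrow> int. \<exists>!\<xi>. \<xi> \<in> characters (torus D) \<and>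
        (\<forall>i\<in>index_set D. \<forall>t. t \<noteq> 0 \<longrightarrow> \<xi> (coroot D i t) = t powi \<gamma> i))"

text \<open>A weight is represented by its coordinates in the basis of fundamental weights, so the
  \<open>i\<close>-th coordinate of \<open>\<gamma>\<close> is \<open>\<gamma>(\<alpha>\<^sub>i\<^sup>\<or>)\<close>.\<close>

type_synonym weight = "nat \<Rightarrow> int"

definition weight_char :: "('m::finite) pinned_group \<Rightarrow> weight \<Rightarrow> 'm cmat \<Rightarrow> complex" where
  "weight_char D \<gamma> = (THE \<xi>. \<xi> \<in> characters (torus D) \<and>
     (\<forall>i\<in>index_set D. \<forall>t. t \<noteq> 0 \<longrightarrow> \<xi> (coroot D i t) = t powi \<gamma> i))"

definition fund_weight :: "nat \<Rightarrow> weight" where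
  "fund_weight i = (\<lambda>k. if k = i then 1 else 0)"

definition root_weight :: "('m::finite) pinned_group \<Rightarrow> nat \<Rightarrow> weight" where
  "root_weight D j = (\<lambda>k. if k \<in> index_set D then cartan D k j else 0)"

definition weight_ge :: "('m::finite) pinned_group \<Rightarrow> weight \<Rightarrow> weight \<Rightarrow> bool" where
  "weight_ge D \<gamma> \<delta> \<longleftrightarrow>
     (\<exists>m :: nat \<Rightarrow> nat. \<forall>k. \<gamma> k - \<delta> k = (\<Sum>j\<in>index_set D. int (m j) * root_weight D j k))"

definition weight_gt :: "('m::finite) pinned_group \<Rightarrow> weight \<Rightarrow> weight \<Rightarrow> bool" where
  "weight_gt D \<gamma> \<delta> \<longleftrightarrow> weight_ge D \<gamma> \<delta> \<and> \<gamma> \<noteq> \<delta>"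


section \<open>Weyl group and Coxeter element\<close>

text \<open>Elements of the Weyl group are given by words in the simple reflections; two words
  represent the same element iff they act in the same way on weights.\<close>

definition reflection :: "('m::finite) pinned_group \<Rightarrow> nat \<Rightarrow> weight \<Rightarrow> weight" where
  "reflection D i \<gamma> = (\<lambda>k. \<gamma> k - \<gamma> i * root_weight D i k)"

definition word_act :: "('m::finite) pinned_group \<Rightarrow> nat list \<Rightarrow> weight \<Rightarrow> weight" where
  "word_act D ws = foldr (reflection D) ws"

definition reduced_word :: "('m::finite) pinned_group \<Rightarrow> nat list \<Rightarrow> bool" where
  "reduced_word D ws \<longleftrightarrow> set ws \<subseteq> index_set D \<and>
     (\<forall>vs. set vs \<subseteq> index_set D \<and> word_act D vs = word_act D ws \<longrightarrow> length ws \<le> length vs)"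

definition longest_word :: "('m::finite) pinned_group \<Rightarrow> nat list \<Rightarrow> bool" where
  "longest_word D ws \<longleftrightarrow> reduced_word D ws \<and>
     (\<forall>vs. reduced_word D vs \<longrightarrow> length vs \<le> length ws)"

definition i_star :: "('m::finite) pinned_group \<Rightarrow> nat \<Rightarrow> nat" where
  "i_star D i = (THE j. j \<in> index_set D \<and>
     (\<forall>ws. longest_word D ws \<longrightarrow> fund_weight j = - word_act D ws (fund_weight i)))"

definition cox_word :: "('m::finite) pinned_group \<Rightarrow> nat list" where
  "cox_word D = [1..<Suc (rk D)]"

definition cox_pow :: "('m::finite) pinned_group \<Rightarrow> nat \<Rightarrow> weight \<Rightarrow> weight" where
  "cox_pow D m = (word_act D (cox_word D) ^^ m)"

definition cox_height :: "('m::finite) pinned_group \<Rightarrow> nat \<Rightarrow> nat" where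
  "cox_height D i = (THE h. 0 < h \<and>
     (\<forall>m<h. weight_gt D (cox_pow D m (fund_weight i)) (cox_pow D (Suc m) (fund_weight i))) \<and>
     cox_pow D h (fund_weight i) = - fund_weight (i_star D i))"

definition Pi_set :: "('m::finite) pinned_group \<Rightarrow> weight set" where
  "Pi_set D = {cox_pow D m (fund_weight i) | i m. i \<in> index_set D \<and> m \<le> cox_height D i}"

definition prec :: "('m::finite) pinned_group \<Rightarrow> nat \<Rightarrow> nat \<Rightarrow> bool" where
  "prec D i j \<longleftrightarrow> cartan D i j \<noteq> 0 \<and> i < j"

definition B_cox :: "('m::finite) pinned_group \<Rightarrow> nat \<Rightarrow> nat \<Rightarrow> int" where
  "B_cox D i j = (if prec D i j then - cartan D i j
                  else if prec D j i then cartan D i j else 0)"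


section \<open>Generalized minors and the double cell\<close>

definition mat_prod :: "('m::finite cmat) list \<Rightarrow> 'm cmat" where
  "mat_prod gs = foldr (**) gs (mat 1)"

definition word_bar :: "('m::finite) pinned_group \<Rightarrow> nat list \<Rightarrow> 'm cmat" where
  "word_bar D ws = mat_prod (map (s_bar D) ws)"

definition N_pos :: "('m::finite) pinned_group \<Rightarrow> 'm cmat set" where
  "N_pos D = generate (matrix_group (grp D)) {x_pos D i t | i t. i \<in> index_set D}"

definition N_neg :: "('m::finite) pinned_group \<Rightarrow> 'm cmat set" where
  "N_neg D = generate (matrix_group (grp D)) {x_neg D i t | i t. i \<in> index_set D}"

definition B_neg :: "('m::finite) pinned_group \<Rightarrow> 'm cmat set" where
  "B_neg D = {h ** y | h y. h \<in> torus D \<and> y \<in> N_neg D}"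

definition gauss_cell :: "('m::finite) pinned_group \<Rightarrow> 'm cmat set" where
  "gauss_cell D = {y ** h ** x | y h x. y \<in> N_neg D \<and> h \<in> torus D \<and> x \<in> N_pos D}"

definition gauss_torus :: "('m::finite) pinned_group \<Rightarrow> 'm cmat \<Rightarrow> 'm cmat" where
  "gauss_torus D g = (THE h. h \<in> torus D \<and> (\<exists>y\<in>N_neg D. \<exists>x\<in>N_pos D. g = y ** h ** x))"

text \<open>\<open>\<Delta> (u \<omega>\<^sub>i) (v \<omega>\<^sub>i)\<close> is the regular function on the group which is given on the dense open
  set \<open>\<^bold>u N\<^sub>- H N \<^bold>v\<inverse>\<close> (bold letters: lifts along reduced words) by the torus part of
  the Gauss decomposition. It depends neither on \<open>u\<close>, \<open>v\<close> nor on the reduced words chosen.\<close>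

definition generalized_minors ::
  "('m::finite) pinned_group \<Rightarrow> (weight \<Rightarrow> weight \<Rightarrow> 'm cmat \<Rightarrow> complex) \<Rightarrow> bool" where
  "generalized_minors D \<Delta> \<longleftrightarrow>
     (\<forall>us vs i. reduced_word D us \<and> reduced_word D vs \<and> i \<in> index_set D \<longrightarrow>
        regular_on (grp D) (\<Delta> (word_act D us (fund_weight i)) (word_act D vs (fund_weight i))) \<and>
        (\<forall>g\<in>grp D. matrix_inv (word_bar D us) ** g ** word_bar D vs \<in> gauss_cell D \<longrightarrow>
           \<Delta> (word_act D us (fund_weight i)) (word_act D vs (fund_weight i)) g =
           weight_char D (fund_weight i)
             (gauss_torus D (matrix_inv (word_bar D us) ** g ** word_bar D vs))))"

definition L_cell :: "('m::finite) pinned_group \<Rightarrow> 'm cmat set" where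
  "L_cell D =
     {a ** word_bar D (cox_word D) ** b | a b. a \<in> N_pos D \<and> b \<in> N_pos D} \<inter>
     {a ** word_bar D (rev (cox_word D)) ** b | a b. a \<in> B_neg D \<and> b \<in> B_neg D}"

definition x_fun ::
  "('m::finite) pinned_group \<Rightarrow> (weight \<Rightarrow> weight \<Rightarrow> 'm cmat \<Rightarrow> complex) \<Rightarrow> weight \<Rightarrow> 'm cmat \<Rightarrow> complex" where
  "x_fun D \<Delta> \<gamma> = restrict (\<Delta> \<gamma> \<gamma>) (L_cell D)"

definition y_fun ::
  "('m::finite) pinned_group \<Rightarrow> (weight \<Rightarrow> weight \<Rightarrow> 'm cmat \<Rightarrow> complex) \<Rightarrow> nat \<Rightarrow> 'm cmat \<Rightarrow> complex" where
  "y_fun D \<Delta> j = restrict (\<lambda>g.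
     \<Delta> (fund_weight j) (cox_pow D 1 (fund_weight j)) g *
     (\<Prod>i\<in>{i\<in>index_set D. prec D i j}.
        \<Delta> (fund_weight i) (cox_pow D 1 (fund_weight i)) g powi cartan D i j)) (L_cell D)"

text \<open>\<open>\<iota>\<close> exhibits the field \<open>'k\<close> as the field of fractions of the coordinate ring of \<open>S\<close>.\<close>

definition fraction_field :: "'m::finite cmat set \<Rightarrow> (('m cmat \<Rightarrow> complex) \<Rightarrow> 'k::field) \<Rightarrow> bool" where
  "fraction_field S \<iota> \<longleftrightarrow>
     \<iota> (\<lambda>g\<in>S. 1) = 1 \<and>
     (\<forall>f\<in>coordinate_ring S. \<forall>g\<in>coordinate_ring S.
        \<iota> (\<lambda>x\<in>S. f x + g x) = \<iota> f + \<iota> g \<and> \<iota> (\<lambda>x\<in>S. f x * g x) = \<iota> f * \<iota> g) \<and>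
     inj_on \<iota> (coordinate_ring S) \<and>
     (\<forall>k. \<exists>f\<in>coordinate_ring S. \<exists>g\<in>coordinate_ring S. \<iota> g \<noteq> 0 \<and> k = \<iota> f / \<iota> g)"


section \<open>Cluster algebras of geometric type and \<open>F\<close>-polynomials\<close>

text \<open>Elements \<open>\<Prod>\<^sub>i u\<^sub>i\<^bsup>e i\<^esup>\<close> of the tropical semifield \<open>Trop(u\<^sub>1,\<dots>,u\<^sub>n)\<close> are represented by their
  exponent vectors \<open>e\<close>. Thus the product is pointwise addition and \<open>\<oplus>\<close> is pointwise minimum.
  The argument \<open>p\<close> of the functions below is the family of elements of the ambient field
  corresponding to the generators \<open>u\<^sub>i\<close>.\<close>

type_synonym trop = "nat \<Rightarrow> int"

definition trop_one :: trop where
  "trop_one = (\<lambda>_. 0)"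

definition trop_mult :: "trop \<Rightarrow> trop \<Rightarrow> trop" where
  "trop_mult e f = (\<lambda>i. e i + f i)"

definition trop_plus :: "trop \<Rightarrow> trop \<Rightarrow> trop" where
  "trop_plus e f = (\<lambda>i. min (e i) (f i))"

definition trop_powi :: "trop \<Rightarrow> int \<Rightarrow> trop" where
  "trop_powi e m = (\<lambda>i. m * e i)"

definition trop_gen :: "nat \<Rightarrow> trop" where
  "trop_gen j = (\<lambda>i. if i = j then 1 else 0)"

definition trop_val :: "nat \<Rightarrow> (nat \<Rightarrow> 'k::field) \<Rightarrow> trop \<Rightarrow> 'k" where
  "trop_val n p e = (\<Prod>i\<in>{1..n}. p i powi e i)"

record 'k seed =
  cluster :: "nat \<Rightarrow> 'k"
  coeffs :: "nat \<Rightarrow> trop"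
  exch :: "nat \<Rightarrow> nat \<Rightarrow> int"

definition pos_part :: "int \<Rightarrow> int" where
  "pos_part b = max b 0"

definition seed_mutation :: "nat \<Rightarrow> (nat \<Rightarrow> 'k::field) \<Rightarrow> nat \<Rightarrow> 'k seed \<Rightarrow> 'k seed" where
  "seed_mutation n p k \<Sigma> =
     (let x = cluster \<Sigma>; y = coeffs \<Sigma>; b = exch \<Sigma> in
      \<lparr>cluster = x(k :=
         (trop_val n p (y k) * (\<Prod>i\<in>{1..n}. x i powi pos_part (b i k))
            + (\<Prod>i\<in>{1..n}. x i powi pos_part (- b i k)))
         / (trop_val n p (trop_plus (y k) trop_one) * x k)),
       coeffs = (\<lambda>j. if j = k then trop_powi (y k) (- 1)
         else trop_mult (y j) (trop_mult (trop_powi (y k) (pos_part (b k j)))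
                (trop_powi (trop_plus (y k) trop_one) (- b k j)))),
       exch = (\<lambda>i j. if i = k \<or> j = k then - b i j
         else b i j + pos_part (b i k) * pos_part (b k j)
              - pos_part (- b i k) * pos_part (- b k j))\<rparr>)"

inductive_set mutation_class :: "nat \<Rightarrow> (nat \<Rightarrow> 'k::field) \<Rightarrow> 'k seed \<Rightarrow> 'k seed set"
  for n :: nat and p :: "nat \<Rightarrow> 'k" and \<Sigma>\<^sub>0 :: "'k seed" where
  initial: "\<Sigma>\<^sub>0 \<in> mutation_class n p \<Sigma>\<^sub>0"
| mutate: "\<Sigma> \<in> mutation_class n p \<Sigma>\<^sub>0 \<Longrightarrow> k \<in> {1..n} \<Longrightarrow>
    seed_mutation n p k \<Sigma> \<in> mutation_class n p \<Sigma>\<^sub>0"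

definition cluster_variables :: "nat \<Rightarrow> (nat \<Rightarrow> 'k::field) \<Rightarrow> 'k seed \<Rightarrow> 'k set" where
  "cluster_variables n p \<Sigma>\<^sub>0 = {cluster \<Sigma> i | \<Sigma> i. \<Sigma> \<in> mutation_class n p \<Sigma>\<^sub>0 \<and> i \<in> {1..n}}"

definition principal_seed :: "(nat \<Rightarrow> 'k::field) \<Rightarrow> (nat \<Rightarrow> nat \<Rightarrow> int) \<Rightarrow> 'k seed" where
  "principal_seed x b = \<lparr>cluster = x, coeffs = trop_gen, exch = b\<rparr>"

text \<open>Polynomials in variables \<open>u\<^sub>i\<close>: finitely supported maps from monomials to coefficients.\<close>

type_synonym int_mpoly = "(nat \<Rightarrow>\<^sub>0 nat) \<Rightarrow>\<^sub>0 int"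

definition mpoly_vars :: "int_mpoly \<Rightarrow> nat set" where
  "mpoly_vars F = (\<Union>m\<in>Poly_Mapping.keys F. Poly_Mapping.keys m)"

definition mpoly_var :: "nat \<Rightarrow> int_mpoly" where
  "mpoly_var i = Poly_Mapping.single (Poly_Mapping.single i 1) 1"

definition mpoly_eval :: "int_mpoly \<Rightarrow> (nat \<Rightarrow> 'a::comm_ring_1) \<Rightarrow> 'a" where
  "mpoly_eval F t = (\<Sum>m\<in>Poly_Mapping.keys F. of_int (Poly_Mapping.lookup F m) *
     (\<Prod>i\<in>Poly_Mapping.keys m. t i ^ Poly_Mapping.lookup m i))"

definition y_hat :: "nat \<Rightarrow> (nat \<Rightarrow> 'k::field) \<Rightarrow> 'k seed \<Rightarrow> nat \<Rightarrow> 'k" where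
  "y_hat n p \<Sigma> j = trop_val n p (coeffs \<Sigma> j) * (\<Prod>i\<in>{1..n}. cluster \<Sigma> i powi exch \<Sigma> i j)"

text \<open>\<open>F\<close> is the \<open>F\<close>-polynomial of the cluster variable \<open>z\<close> with respect to the seed \<open>\<Sigma>\<^sub>0\<close>.\<close>

definition F_polynomial ::
  "nat \<Rightarrow> (nat \<Rightarrow> 'k::field) \<Rightarrow> 'k seed \<Rightarrow> 'k \<Rightarrow> int_mpoly \<Rightarrow> bool" where
  "F_polynomial n p \<Sigma>\<^sub>0 z F \<longleftrightarrow>
     z \<in> cluster_variables n p \<Sigma>\<^sub>0 \<and>
     mpoly_vars F \<subseteq> {1..n} \<and>
     (\<forall>i\<in>{1..n}. \<not> mpoly_var i dvd F) \<and>
     (\<exists>g :: nat \<Rightarrow> int.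
        z = (\<Prod>i\<in>{1..n}. cluster \<Sigma>\<^sub>0 i powi g i) * mpoly_eval F (y_hat n p \<Sigma>\<^sub>0))"

end

theory Submission
  imports Defs
begin

text \<open>On the double cell, \<open>z = x\<^sup>g F(y\<^sub>1 x\<^sup>b, \<dots>)\<close> is an identity of functions. It is evaluated at
  the point \<open>g(t)\<close> given by the product of root subgroup elements in the theorem, with all
  \<open>t\<^sub>i \<noteq> 0\<close>: this point lies in the cell, it belongs to \<open>N\<^sub>- N\<close>, so that all \<open>x\<^sub>i\<close> are \<open>1\<close> there,
  and a Gauss decomposition of \<open>g(t)\<close> times the lift of \<open>c\<close> shows \<open>y\<^sub>j = t\<^sub>j\<close>. Hence
  \<open>F(t) = \<Delta>\<^bsub>\<gamma>, \<gamma>\<^esub>(g(t))\<close>, and the remaining \<open>t\<close> follow by continuity.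

  Two facts about root subgroups carry the argument. First, \<open>x\<^sub>i\<close> commutes with the opposite
  \<open>x\<^bsub>-j\<^esub>\<close> for \<open>i \<noteq> j\<close>, since otherwise \<open>\<alpha>\<^sub>i - \<alpha>\<^sub>j\<close> would be a root. Second, the lift of \<open>s\<^sub>j\<close>
  conjugates \<open>x\<^sub>i(b)\<close> into the group generated by \<open>x\<^sub>i\<close> and \<open>x\<^sub>j\<close>: it is a limit of elements of
  this group, and homogeneity with respect to the torus turns the limit into an equality.\<close>

section \<open>Polynomial curves of matrices\<close>

text \<open>The group is known only through its torus and its root subgroups, so tangent vectors and
  relations inside N have to be extracted from two facts: root subgroups are polynomial curves, and
  the torus acts on them by scaling the parameter. \<open>vanishes_to\<close> turns the first fact
  into a calculus of orders at 0, with leading coefficients in the place of tangent vectors. The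
  second fact makes this calculus finite: if a torus element h scales the parameter by a factor of
  modulus greater than 1, a homogeneous curve of high order is 0, since h has finitely many
  eigenvalues. The same comparison of eigenvalues yields nilpotency of commutators of tangent
  vectors and the unitriangularity that makes the torus part of a Gauss decomposition unique.

  The condition that all t_i are nonzero comes from the second half of the cell: x_i(t) is split in
  SL2 with 1/t as a parameter. The value y_j = t_j is a triangular cancellation: every torus factor
  split off in the decomposition rescales the later parameters by Cartan exponents, and the product
  in the definition of y_j undoes exactly this.\<close>

definition cscale :: "complex \<Rightarrow> 'm::finite cmat \<Rightarrow> 'm cmat" (infixr "*\<^sub>C" 75) where
  "c *\<^sub>C A = (\<chi> r s. c * A $ r $ s)"

lemma cscale_nth [simp]: "(c *\<^sub>C A) $ r $ s = c * A $ r $ s"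
  by (simp add: cscale_def)

lemma mat_add_mult: "(A + B) ** C = A ** C + B ** (C :: 'm::finite cmat)"
  by (simp add: matrix_matrix_mult_def vec_eq_iff sum.distrib ring_distribs)

lemma mat_mult_diff: "A ** (B - C) = A ** B - A ** (C :: 'm::finite cmat)"
  by (simp add: matrix_matrix_mult_def vec_eq_iff sum_subtractf ring_distribs)

lemma mat_diff_mult: "(A - B) ** C = A ** C - B ** (C :: 'm::finite cmat)"
  by (simp add: matrix_matrix_mult_def vec_eq_iff sum_subtractf ring_distribs)

lemma mat_zero_mult [simp]: "0 ** A = (0 :: 'm::finite cmat)" "A ** 0 = (0 :: 'm::finite cmat)"
  by (simp_all add: matrix_matrix_mult_def vec_eq_iff)

lemma cscale_mult: "(c *\<^sub>C A) ** B = c *\<^sub>C (A ** B)" "A ** (c *\<^sub>C B) = c *\<^sub>C (A ** B)"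
  by (simp_all add: matrix_matrix_mult_def vec_eq_iff sum_distrib_left mult_ac)

lemma cscale_simps [simp]:
  "0 *\<^sub>C A = 0" "1 *\<^sub>C A = A" "c *\<^sub>C 0 = 0" "c *\<^sub>C d *\<^sub>C A = (c * d) *\<^sub>C A"
  by (simp_all add: vec_eq_iff)

lemma cscale_distrib:
  "c *\<^sub>C (A + B) = c *\<^sub>C A + c *\<^sub>C B" "c *\<^sub>C (A - B) = c *\<^sub>C A - c *\<^sub>C B"
  "(c + d) *\<^sub>C A = c *\<^sub>C A + d *\<^sub>C A" "(c - d) *\<^sub>C A = c *\<^sub>C A - d *\<^sub>C A"
  by (simp_all add: vec_eq_iff ring_distribs)

lemmas mat_distribs = matrix_add_ldistrib mat_add_mult mat_mult_diff mat_diff_mult cscale_mult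

lemma mat_cancel_left: "A ** B = mat 1 \<Longrightarrow> A ** (B ** C) = (C :: 'm::finite cmat)"
  by (simp add: matrix_mul_assoc)

lemma mat_conj_eq_iff:
  fixes P :: "'m::finite cmat"
  assumes "P ** P' = mat 1" "P' ** P = mat 1"
  shows "P ** A ** P' = P ** B ** P' \<longleftrightarrow> A = B"
proof
  assume "P ** A ** P' = P ** B ** P'"
  then have "P' ** (P ** A ** P') ** P = P' ** (P ** B ** P') ** P" by simp
  then show "A = B"
    by (metis assms(2) matrix_mul_assoc matrix_mul_lid matrix_mul_rid)
qed simp

lemma conj_mult:
  fixes P :: "'m::finite cmat"
  assumes "P' ** P = mat 1"
  shows "P ** (A ** B) ** P' = (P ** A ** P') ** (P ** B ** P')"
  by (metis assms matrix_mul_assoc matrix_mul_lid)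

text \<open>An algebraic O(t^d): every entry is a polynomial divisible by t^d. Orders add under
  products and leading coefficients are well defined, so expansions at 0 can be handled by
  polynomial arithmetic.\<close>

definition vanishes_to :: "nat \<Rightarrow> (complex \<Rightarrow> 'm::finite cmat) \<Rightarrow> bool" where
  "vanishes_to d f \<longleftrightarrow> (\<forall>r s. \<exists>p. \<forall>t. f t $ r $ s = t ^ d * poly p t)"

abbreviation poly_curve :: "(complex \<Rightarrow> 'm::finite cmat) \<Rightarrow> bool" where
  "poly_curve \<equiv> vanishes_to 0"

lemma vanishes_to_const [simp]: "poly_curve (\<lambda>_. A)"
  unfolding vanishes_to_def by (metis mult_1 poly_pCons poly_0 mult_zero_right add.right_neutral power_0)

lemma vanishes_to_0 [simp]: "vanishes_to d (\<lambda>_. 0)"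
  unfolding vanishes_to_def by (auto intro: exI[of _ 0])

lemma vanishes_to_add:
  assumes "vanishes_to d f" "vanishes_to d g"
  shows "vanishes_to d (\<lambda>t. f t + g t)"
  unfolding vanishes_to_def
proof (intro allI)
  fix r s
  obtain p q where "\<forall>t. f t $ r $ s = t ^ d * poly p t" "\<forall>t. g t $ r $ s = t ^ d * poly q t"
    using assms unfolding vanishes_to_def by blast
  then show "\<exists>p. \<forall>t. (f t + g t) $ r $ s = t ^ d * poly p t"
    by (intro exI[of _ "p + q"]) (simp add: ring_distribs)
qed

lemma vanishes_to_cscale:
  assumes "vanishes_to d f"
  shows "vanishes_to d (\<lambda>t. c *\<^sub>C f t)"
  unfolding vanishes_to_def
proof (intro allI)
  fix r s
  obtain p where "\<forall>t. f t $ r $ s = t ^ d * poly p t"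
    using assms unfolding vanishes_to_def by blast
  then show "\<exists>p. \<forall>t. (c *\<^sub>C f t) $ r $ s = t ^ d * poly p t"
    by (intro exI[of _ "smult c p"]) simp
qed

lemma vanishes_to_diff:
  assumes "vanishes_to d f" "vanishes_to d g"
  shows "vanishes_to d (\<lambda>t. f t - g t)"
proof -
  have "vanishes_to d (\<lambda>t. f t + (-1) *\<^sub>C g t)"
    by (intro vanishes_to_add vanishes_to_cscale assms)
  moreover have "f t + (-1) *\<^sub>C g t = f t - g t" for t
    by (simp add: vec_eq_iff)
  ultimately show ?thesis by simp
qed

lemma vanishes_to_mono:
  assumes "vanishes_to d f" "e \<le> d"
  shows "vanishes_to e f"
  unfolding vanishes_to_def
proof (intro allI)
  fix r s
  obtain p where "\<forall>t. f t $ r $ s = t ^ d * poly p t"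
    using assms unfolding vanishes_to_def by blast
  with \<open>e \<le> d\<close> show "\<exists>p. \<forall>t. f t $ r $ s = t ^ e * poly p t"
    by (intro exI[of _ "monom 1 (d - e) * p"])
       (simp add: poly_monom mult.assoc[symmetric] power_add[symmetric])
qed

lemma vanishes_to_mult:
  assumes "vanishes_to d f" "vanishes_to e g"
  shows "vanishes_to (d + e) (\<lambda>t. f t ** g t)"
proof -
  obtain p where p: "\<And>r s t. f t $ r $ s = t ^ d * poly (p r s) t"
    using assms(1) unfolding vanishes_to_def by metis
  obtain q where q: "\<And>r s t. g t $ r $ s = t ^ e * poly (q r s) t"
    using assms(2) unfolding vanishes_to_def by metis
  have "(f t ** g t) $ r $ s = t ^ (d + e) * poly (\<Sum>u\<in>UNIV. p r u * q u s) t" for r s t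
    by (simp add: matrix_matrix_mult_def p q poly_sum sum_distrib_left power_add mult_ac)
  then show ?thesis unfolding vanishes_to_def by blast
qed

lemma poly_curve_mult:
  assumes "poly_curve f" "poly_curve g"
  shows "poly_curve (\<lambda>t. f t ** g t)"
  using vanishes_to_mult[OF assms] by simp

lemma vanishes_to_mult_left: "vanishes_to d f \<Longrightarrow> vanishes_to d (\<lambda>t. A ** f t)"
  using vanishes_to_mult[of 0 "\<lambda>_. A" d f] by simp

lemma vanishes_to_mult_right: "vanishes_to d f \<Longrightarrow> vanishes_to d (\<lambda>t. f t ** A)"
  using vanishes_to_mult[of d f 0 "\<lambda>_. A"] by simp

lemma vanishes_to_scale_arg:
  assumes "vanishes_to d f"
  shows "vanishes_to d (\<lambda>t. f (c * t))"
  unfolding vanishes_to_def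
proof (intro allI)
  fix r s
  obtain p where "\<forall>t. f t $ r $ s = t ^ d * poly p t"
    using assms unfolding vanishes_to_def by blast
  then show "\<exists>p. \<forall>t. f (c * t) $ r $ s = t ^ d * poly p t"
    by (intro exI[of _ "smult (c ^ d) (pcompose p [:0, c:])"])
       (simp add: poly_pcompose power_mult_distrib mult_ac)
qed

lemma vanishes_to_neg_arg: "vanishes_to d f \<Longrightarrow> vanishes_to d (\<lambda>t. f (- t))"
  using vanishes_to_scale_arg[of d f "-1"] by simp

lemma vanishes_to_power: "vanishes_to d (\<lambda>t. t ^ d *\<^sub>C A)"
  unfolding vanishes_to_def
proof (intro allI)
  fix r s
  show "\<exists>p. \<forall>t. (t ^ d *\<^sub>C A) $ r $ s = t ^ d * poly p t"
    by (intro exI[of _ "[:A $ r $ s:]"]) simp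
qed

lemma vanishes_to_leading:
  assumes "vanishes_to d f"
  obtains Z where "vanishes_to (Suc d) (\<lambda>t. f t - t ^ d *\<^sub>C Z)"
proof -
  obtain p where p: "\<And>r s t. f t $ r $ s = t ^ d * poly (p r s) t"
    using assms(1) unfolding vanishes_to_def by metis
  define Z :: "'a cmat" where "Z = (\<chi> r s. poly (p r s) 0)"
  have "\<exists>q. \<forall>t. (f t - t ^ d *\<^sub>C Z) $ r $ s = t ^ Suc d * poly q t" for r s
  proof (cases "p r s")
    case (pCons a q)
    then show ?thesis
      by (intro exI[of _ q]) (simp add: p Z_def ring_distribs)
  qed
  then show ?thesis using that unfolding vanishes_to_def by blast
qed

lemma vanishes_to_leading_unique:
  assumes "vanishes_to (Suc d) (\<lambda>t. t ^ d *\<^sub>C Z)"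
  shows "Z = 0"
proof -
  have "Z $ r $ s = 0" for r s
  proof -
    obtain p where p: "\<And>t. t ^ d * Z $ r $ s = t ^ Suc d * poly p t"
      using assms unfolding vanishes_to_def cscale_nth by blast
    have "poly (monom (Z $ r $ s) d) t = poly (monom 1 (Suc d) * p) t" for t
      using p[of t] by (simp add: poly_monom mult.commute)
    then have "monom (Z $ r $ s) d = monom 1 (Suc d) * p"
      using poly_eq_poly_eq_iff by blast
    then have "coeff (monom (Z $ r $ s) d) d = coeff (monom 1 (Suc d) * p) d" by simp
    then show ?thesis by (simp add: coeff_monom_mult)
  qed
  then show ?thesis by (simp add: vec_eq_iff)
qed

lemma vanishes_to_all:
  assumes "\<And>d. vanishes_to d f"
  shows "f t = 0"
proof -
  have "f t $ r $ s = 0" for r s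
  proof -
    obtain p where p: "\<And>t. f t $ r $ s = poly p t"
      using assms[of 0] unfolding vanishes_to_def power_0 mult_1 by blast
    have "coeff p k = 0" for k
    proof -
      obtain q where q: "\<And>t. f t $ r $ s = t ^ Suc k * poly q t"
        using assms[of "Suc k"] unfolding vanishes_to_def by blast
      have "p = monom 1 (Suc k) * q"
        using p q by (intro poly_eq_poly_eq_iff[THEN iffD1]) (auto simp: poly_monom fun_eq_iff)
      then show ?thesis by (simp add: coeff_monom_mult)
    qed
    then have "p = 0" by (simp add: poly_eq_iff)
    then show ?thesis using p by simp
  qed
  then show ?thesis by (simp add: vec_eq_iff)
qed

lemma vanishes_to_first:
  assumes "poly_curve f" "f 0 = mat 1"
  shows "vanishes_to 1 (\<lambda>t. f t - mat 1)"
proof -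
  obtain Z where Z: "vanishes_to (Suc 0) (\<lambda>t. f t - t ^ 0 *\<^sub>C Z)"
    using vanishes_to_leading[OF assms(1)] .
  then obtain p where "\<And>r s t. (f t - Z) $ r $ s = t * poly (p r s) t"
    unfolding vanishes_to_def power_Suc power_0 mult_1_right by (simp add: choice_iff) blast
  then have "(f 0 - Z) $ r $ s = 0" for r s by simp
  then have "Z = mat 1" using assms(2) by (simp add: vec_eq_iff)
  with Z show ?thesis by simp
qed

lemma continuous_poly_curve:
  assumes "poly_curve f"
  shows "isCont f t"
proof -
  obtain p where p: "\<And>r s t. f t $ r $ s = poly (p r s) t"
    using assms unfolding vanishes_to_def by auto metis
  have "f = (\<lambda>t. \<chi> r s. poly (p r s) t)" by (simp add: vec_eq_iff p fun_eq_iff)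
  then show ?thesis
    by (simp add: isCont_def tendsto_vec_lambda poly_isCont[unfolded isCont_def])
qed

text \<open>If conjugation by \<open>h\<close> rescales the parameter of a curve by \<open>\<mu>\<close>, then an entry with
  respect to an eigenbasis of \<open>h\<close> is a monomial whose degree is read off the eigenvalues.\<close>

lemma homogeneous_entry:
  fixes f :: "complex \<Rightarrow> 'm::finite cmat" and P :: "'m cmat"
  assumes f: "vanishes_to d f"
    and P: "P' ** P = mat 1"
    and diag: "\<And>r s. r \<noteq> s \<Longrightarrow> (P ** h ** P') $ r $ s = 0"
    and eq: "\<And>t. h ** f t = f (\<mu> * t) ** h"
  obtains p where "\<And>t. (P ** f t ** P') $ r $ s = t ^ d * poly p t"
    and "\<And>k. (P ** h ** P') $ r $ r * coeff p k = (P ** h ** P') $ s $ s * \<mu> ^ (d + k) * coeff p k"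
proof -
  define D where "D = P ** h ** P'"
  define F where "F t = P ** f t ** P'" for t
  have "vanishes_to d F"
    unfolding F_def using poly_curve_mult vanishes_to_mult[of 0 "\<lambda>_. P" d f] f
      vanishes_to_mult[of d "\<lambda>t. P ** f t" 0 "\<lambda>_. P'"] by simp
  then obtain p where p: "\<And>t. F t $ r $ s = t ^ d * poly p t"
    unfolding vanishes_to_def by blast
  have DF: "D ** F t = F (\<mu> * t) ** D" for t
    unfolding D_def F_def using eq[of t] conj_mult[OF P] by metis
  have diagD: "D $ u $ v = (if u = v then D $ u $ u else 0)" for u v
    using diag by (auto simp: D_def)
  have "D $ r $ r * F t $ r $ s = F (\<mu> * t) $ r $ s * D $ s $ s" for t
  proof -
    have "(D ** F t) $ r $ s = D $ r $ r * F t $ r $ s"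
      unfolding matrix_matrix_mult_def
      by (subst diagD) (simp add: if_distrib[where f="\<lambda>x. x * _"] cong: if_cong)
    moreover have "(F (\<mu> * t) ** D) $ r $ s = F (\<mu> * t) $ r $ s * D $ s $ s"
      unfolding matrix_matrix_mult_def
      by (subst diagD) (simp add: if_distrib cong: if_cong)
    ultimately show ?thesis using DF by simp
  qed
  then have "D $ r $ r * (t ^ d * poly p t) = (\<mu> * t) ^ d * poly p (\<mu> * t) * D $ s $ s" for t
    by (simp add: p)
  then have "poly (smult (D $ r $ r) (monom 1 d * p)) t =
      poly (smult (D $ s $ s * \<mu> ^ d) (monom 1 d * pcompose p [:0, \<mu>:])) t" for t
    by (simp only: poly_smult poly_mult poly_monom poly_pcompose poly_pCons poly_0
        power_mult_distrib mult_zero_right add_0_right add_0_left) (simp only: mult_ac)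
  then have eqp: "smult (D $ r $ r) (monom 1 d * p) =
      smult (D $ s $ s * \<mu> ^ d) (monom 1 d * pcompose p [:0, \<mu>:])"
    using poly_eq_poly_eq_iff by blast
  have "D $ r $ r * coeff p k = D $ s $ s * \<mu> ^ (d + k) * coeff p k" for k
    using arg_cong[OF eqp, of "\<lambda>q. coeff q (d + k)"]
    by (simp only: coeff_smult coeff_monom_mult coeff_pcompose_linear power_add) (simp add: mult_ac)
  then show ?thesis using that p unfolding D_def F_def by blast
qed

lemma diagonal_entry_nonzero:
  fixes P :: "'m::finite cmat"
  assumes P: "P ** P' = mat 1" "P' ** P = mat 1" and h: "h ** h' = mat 1"
    and diag: "\<And>r s. r \<noteq> s \<Longrightarrow> (P ** h ** P') $ r $ s = 0"
  shows "(P ** h ** P') $ r $ r \<noteq> 0"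
proof
  assume 0: "(P ** h ** P') $ r $ r = 0"
  have "(P ** h ** P') ** (P ** h' ** P') = mat 1"
    by (metis P h conj_mult matrix_mul_rid)
  then have "((P ** h ** P') ** (P ** h' ** P')) $ r $ r = 1" by (simp add: mat_def)
  moreover have "(P ** h ** P') $ r $ u = 0" for u using 0 diag by (cases "r = u") auto
  ultimately show False by (simp add: matrix_matrix_mult_def)
qed

text \<open>Powers of \<open>\<mu>\<close> eventually exceed in modulus each of the finitely many
  ratios \<open>a r / a s\<close>. The bound 2 <= d serves the later uses of d as an order of
  approximation and as a nilpotency degree.\<close>

lemma eigenvalue_ratio_bound:
  fixes a :: "'m::finite \<Rightarrow> complex"
  assumes "1 < cmod \<mu>" "\<And>r. a r \<noteq> 0"
  obtains d where "2 \<le> d" "\<And>r s k. d \<le> k \<Longrightarrow> a r \<noteq> a s * \<mu> ^ k"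
proof -
  define M where "M = (\<Sum>r\<in>UNIV. \<Sum>s\<in>UNIV. cmod (a r / a s))"
  have M: "cmod (a r / a s) \<le> M" for r s
  proof -
    have "cmod (a r / a s) \<le> (\<Sum>s\<in>UNIV. cmod (a r / a s))"
      by (rule member_le_sum) auto
    also have "\<dots> \<le> M" unfolding M_def
      by (rule member_le_sum[of r UNIV "\<lambda>r. \<Sum>s\<in>UNIV. cmod (a r / a s)"]) (auto intro: sum_nonneg)
    finally show ?thesis .
  qed
  obtain d0 where d0: "M < cmod \<mu> ^ d0"
    using real_arch_pow[OF assms(1)] by blast
  show ?thesis
  proof (rule that[of "max 2 d0"])
    fix r s k assume "max 2 d0 \<le> k"
    then have "cmod \<mu> ^ d0 \<le> cmod \<mu> ^ k" using assms(1) by (intro power_increasing) auto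
    then have "cmod (a r / a s) < cmod (\<mu> ^ k)"
      using d0 M[of r s] by (simp add: norm_power)
    then show "a r \<noteq> a s * \<mu> ^ k" using assms(2)[of s] by auto
  qed simp
qed

text \<open>In an eigenbasis of h, a monomial of degree k in the entry (r, s) forces a ratio of two
  eigenvalues to be \<open>\<mu> ^ k\<close>, which is impossible for large k. The threshold depends
  on h and \<open>\<mu>\<close> only, so it can be fixed before a curve is constructed.\<close>

lemma homogeneous_vanishes:
  fixes P :: "'m::finite cmat"
  assumes P: "P ** P' = mat 1" "P' ** P = mat 1" and h: "h ** h' = mat 1"
    and diag: "\<And>r s. r \<noteq> s \<Longrightarrow> (P ** h ** P') $ r $ s = 0"
    and \<mu>: "1 < cmod \<mu>"
  obtains d where "2 \<le> d"
    "\<And>f t. vanishes_to d f \<Longrightarrow> (\<And>t. h ** f t = f (\<mu> * t) ** h) \<Longrightarrow> f t = 0"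
proof -
  obtain d where d: "2 \<le> d" "\<And>r s k. d \<le> k \<Longrightarrow>
      (P ** h ** P') $ r $ r \<noteq> (P ** h ** P') $ s $ s * \<mu> ^ k"
    using eigenvalue_ratio_bound[of \<mu> "\<lambda>r. (P ** h ** P') $ r $ r", OF \<mu>]
      diagonal_entry_nonzero[of P P' h h', OF P h diag] by metis
  have "f t = 0" if f: "vanishes_to d f" and eq: "\<And>t. h ** f t = f (\<mu> * t) ** h" for f t
  proof -
    have "(P ** f t ** P') $ r $ s = (P ** 0 ** P') $ r $ s" for r s
    proof -
      obtain p where p: "\<And>t. (P ** f t ** P') $ r $ s = t ^ d * poly p t"
        and c: "\<And>k. (P ** h ** P') $ r $ r * coeff p k =
            (P ** h ** P') $ s $ s * \<mu> ^ (d + k) * coeff p k"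
        using homogeneous_entry[OF f P(2) diag eq] by metis
      have "coeff p k = 0" for k
        using c[of k] d(2)[of "d + k" r s] by auto
      then have "p = 0" by (simp add: poly_eq_iff)
      with p show ?thesis by simp
    qed
    then have "P ** f t ** P' = P ** 0 ** P'" by (simp add: vec_eq_iff)
    then show ?thesis using mat_conj_eq_iff[OF P] by blast
  qed
  with d(1) show ?thesis using that by blast
qed

text \<open>Homogeneous curves in N. The inverse curve is carried along because N is only known to
  be closed under products, while the correction of a curve divides by another one.\<close>

definition monoid_curve ::
  "'m::finite cmat set \<Rightarrow> 'm cmat \<Rightarrow> complex \<Rightarrow> (complex \<Rightarrow> 'm cmat) \<Rightarrow> (complex \<Rightarrow> 'm cmat) \<Rightarrow> bool" where
  "monoid_curve N h \<mu> m m' \<longleftrightarrow> poly_curve m \<and> poly_curve m' \<and>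
     (\<forall>b. m b \<in> N \<and> m' b \<in> N \<and> m b ** m' b = mat 1 \<and> m' b ** m b = mat 1 \<and>
          h ** m b = m (\<mu> * b) ** h \<and> h ** m' b = m' (\<mu> * b) ** h)"

lemma monoid_curve_sym: "monoid_curve N h \<mu> m m' \<Longrightarrow> monoid_curve N h \<mu> m' m"
  unfolding monoid_curve_def by blast

lemma monoid_curve_mult:
  assumes N: "\<And>a b. a \<in> N \<Longrightarrow> b \<in> N \<Longrightarrow> a ** b \<in> N"
    and m: "monoid_curve N h \<mu> m m'" and k: "monoid_curve N h \<mu> k k'"
  shows "monoid_curve N h \<mu> (\<lambda>b. m b ** k b) (\<lambda>b. k' b ** m' b)"
  unfolding monoid_curve_def
proof (intro conjI allI)
  show "poly_curve (\<lambda>b. m b ** k b)" "poly_curve (\<lambda>b. k' b ** m' b)"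
    using m k unfolding monoid_curve_def by (auto intro!: poly_curve_mult)
next
  fix b
  have mb: "m b ** m' b = mat 1" "m' b ** m b = mat 1" "k b ** k' b = mat 1" "k' b ** k b = mat 1"
    and hb: "h ** m b = m (\<mu> * b) ** h" "h ** m' b = m' (\<mu> * b) ** h"
      "h ** k b = k (\<mu> * b) ** h" "h ** k' b = k' (\<mu> * b) ** h"
    using m k unfolding monoid_curve_def by blast+
  show "m b ** k b \<in> N" "k' b ** m' b \<in> N" using m k N unfolding monoid_curve_def by auto
  show "m b ** k b ** (k' b ** m' b) = mat 1" by (metis mb(1,3) matrix_mul_assoc matrix_mul_rid)
  show "k' b ** m' b ** (m b ** k b) = mat 1" by (metis mb(2,4) matrix_mul_assoc matrix_mul_rid)
  show "h ** (m b ** k b) = m (\<mu> * b) ** k (\<mu> * b) ** h" by (metis hb(1,3) matrix_mul_assoc)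
  show "h ** (k' b ** m' b) = k' (\<mu> * b) ** m' (\<mu> * b) ** h" by (metis hb(2,4) matrix_mul_assoc)
qed

lemma monoid_curve_scale:
  assumes "monoid_curve N h \<mu> m m'"
  shows "monoid_curve N h \<mu> (\<lambda>b. m (c * b)) (\<lambda>b. m' (c * b))"
  using assms unfolding monoid_curve_def
  by (auto intro: vanishes_to_scale_arg simp: mult.left_commute)

text \<open>The left side is (2 - 2^d) u^d, and d >= 2 makes the factor nonzero. The value 1 lets
  the correcting curve below match the leading error term exactly.\<close>

lemma exists_power_defect:
  assumes "2 \<le> d"
  obtains u :: complex where "2 * u ^ d - (2 * u) ^ d = 1"
proof -
  have "(2::complex) ^ d \<noteq> 2"
  proof
    assume "(2::complex) ^ d = 2"
    then have "cmod ((2::complex) ^ d) = 2" by simp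
    then have "(2::real) ^ d = 2" by (simp add: norm_power)
    moreover have "(2::real) ^ 2 \<le> 2 ^ d" using assms by (intro power_increasing) auto
    ultimately show False by simp
  qed
  then have ne: "2 - (2::complex) ^ d \<noteq> 0" by simp
  obtain u where u: "1 / (2 - 2 ^ d) = (u::complex) ^ d"
    using exists_complex_root[of d "1 / (2 - 2 ^ d)"] assms by auto
  have "2 * u ^ d - (2 * u) ^ d = (2 - 2 ^ d) * u ^ d"
    by (simp add: power_mult_distrib algebra_simps)
  also have "\<dots> = 1" using u ne by (simp add: field_simps)
  finally show ?thesis using that by blast
qed

text \<open>A homogeneous curve in \<open>N\<close> approximating the one-parameter group \<open>w\<close> to order
  \<open>d \<ge> 2\<close> can be improved: the leading error term \<open>b\<^sup>d Z\<close> is not additive in \<open>b\<close>, so it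
  is also the leading term of \<open>m(ub) m(ub) m(2ub)\<inverse> \<in> N\<close> for a suitable scalar \<open>u\<close>.\<close>

lemma improve_approximation:
  fixes w :: "complex \<Rightarrow> 'm::finite cmat"
  assumes N: "\<And>a b. a \<in> N \<Longrightarrow> b \<in> N \<Longrightarrow> a ** b \<in> N"
    and w: "poly_curve w" "\<And>s t. w (s + t) = w s ** w t" "w 0 = mat 1"
    and m: "monoid_curve N h \<mu> m m'"
    and d: "2 \<le> d" "vanishes_to d (\<lambda>b. w (- b) ** m b - mat 1)"
  obtains k k' where "monoid_curve N h \<mu> k k'"
    "vanishes_to (Suc d) (\<lambda>b. w (- b) ** k b - mat 1)"
proof -
  have w_inv: "w b ** w (- b) = mat 1" "w (- b) ** w b = mat 1" for b
    using w(2)[of b "-b"] w(2)[of "-b" b] w(3) by auto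
  obtain u where u: "2 * u ^ d - (2 * u) ^ d = (1::complex)" using exists_power_defect[OF d(1)] .
  obtain Z where Z: "vanishes_to (Suc d) (\<lambda>b. w (- b) ** m b - mat 1 - b ^ d *\<^sub>C Z)"
    using vanishes_to_leading[OF d(2)] .
  have mpc: "poly_curve m" "poly_curve m'" and mm: "\<And>b. m b ** m' b = mat 1" "\<And>b. m' b ** m b = mat 1"
    using m unfolding monoid_curve_def by auto
  have w1: "vanishes_to 1 (\<lambda>b. w b - mat 1)" using vanishes_to_first w by blast
  define r where "r b = m b - w b - b ^ d *\<^sub>C Z" for b
  have r: "vanishes_to (Suc d) r"
  proof -
    have "vanishes_to (Suc d) (\<lambda>b. w b ** (w (- b) ** m b - mat 1 - b ^ d *\<^sub>C Z)
        + (w b - mat 1) ** (b ^ d *\<^sub>C Z))"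
      using vanishes_to_mult[OF w(1) Z] vanishes_to_mult[OF w1 vanishes_to_power[of d Z]]
      by (intro vanishes_to_add) simp_all
    moreover have "w b ** (w (- b) ** m b - mat 1 - b ^ d *\<^sub>C Z) + (w b - mat 1) ** (b ^ d *\<^sub>C Z) = r b" for b
      unfolding r_def by (simp add: mat_distribs mat_cancel_left[OF w_inv(1)] cscale_distrib)
    ultimately show ?thesis by simp
  qed
  define D where "D b = m b - w b" for b
  have D_eq: "D b = b ^ d *\<^sub>C Z + r b" for b by (simp add: D_def r_def)
  have D: "vanishes_to d D"
    unfolding D_eq[abs_def]
    by (intro vanishes_to_add vanishes_to_power vanishes_to_mono[OF r]) simp
  have m1: "vanishes_to 1 (\<lambda>b. m b - mat 1)"
  proof -
    have "vanishes_to 1 (\<lambda>b. D b + (w b - mat 1))"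
      using d(1) by (intro vanishes_to_add vanishes_to_mono[OF D] w1) simp
    then show ?thesis by (simp add: D_def)
  qed
  define q where "q b = m (u * b) ** m (u * b) ** m' (2 * u * b)" for b
  define q' where "q' b = m (2 * u * b) ** (m' (u * b) ** m' (u * b))" for b
  have q: "monoid_curve N h \<mu> q q'"
    unfolding q_def q'_def
    by (intro monoid_curve_mult N monoid_curve_scale m monoid_curve_sym[OF monoid_curve_scale[OF m]])
  \<comment> \<open>With m = w + D and w(2ub) = w(ub)^2, only 2 D(ub) - D(2ub) - b^d Z could survive
    modulo order d + 1. The leading term of 2 D(ub) - D(2ub) is (2 u^d - (2u)^d) b^d Z, so the
    choice of u cancels it.\<close>
  have "vanishes_to (Suc d) (\<lambda>b. m (u * b) ** m (u * b) - (mat 1 + b ^ d *\<^sub>C Z) ** m (2 * u * b))"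
  proof -
    have Du: "vanishes_to d (\<lambda>b. D (u * b))" "vanishes_to (Suc d) (\<lambda>b. r (u * b))"
      "vanishes_to (Suc d) (\<lambda>b. r (2 * u * b))" "vanishes_to 1 (\<lambda>b. w (u * b) - mat 1)"
      "vanishes_to 1 (\<lambda>b. m (2 * u * b) - mat 1)"
      using vanishes_to_scale_arg D r w1 m1 by blast+
    have "vanishes_to (Suc d) (\<lambda>b. (w (u * b) - mat 1) ** D (u * b))"
      "vanishes_to (Suc d) (\<lambda>b. D (u * b) ** (w (u * b) - mat 1))"
      "vanishes_to (Suc d) (\<lambda>b. D (u * b) ** D (u * b))"
      "vanishes_to (Suc d) (\<lambda>b. (b ^ d *\<^sub>C Z) ** (m (2 * u * b) - mat 1))"
      using vanishes_to_mult[OF Du(4,1)] vanishes_to_mult[OF Du(1,4)]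
        vanishes_to_mono[OF vanishes_to_mult[OF Du(1,1)], of "Suc d"]
        vanishes_to_mult[OF vanishes_to_power Du(5)] d(1) by simp_all
    then have "vanishes_to (Suc d) (\<lambda>b. (w (u * b) - mat 1) ** D (u * b)
      + D (u * b) ** (w (u * b) - mat 1) + D (u * b) ** D (u * b)
      - (b ^ d *\<^sub>C Z) ** (m (2 * u * b) - mat 1) + (r (u * b) + r (u * b) - r (2 * u * b)))"
      by (intro vanishes_to_add vanishes_to_diff Du)
    moreover have "m (u * b) ** m (u * b) - (mat 1 + b ^ d *\<^sub>C Z) ** m (2 * u * b) =
      (w (u * b) - mat 1) ** D (u * b)
      + D (u * b) ** (w (u * b) - mat 1) + D (u * b) ** D (u * b)
      - (b ^ d *\<^sub>C Z) ** (m (2 * u * b) - mat 1) + (r (u * b) + r (u * b) - r (2 * u * b))" for b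
    proof -
      have m_eq: "m b = w b + D b" for b by (simp add: D_def)
      have ww: "w (2 * u * b) = w (u * b) ** w (u * b)"
        using w(2)[of "u * b" "u * b"] by (simp add: algebra_simps)
      have "D (u * b) + D (u * b) - D (2 * u * b) - b ^ d *\<^sub>C Z =
          (r (u * b) + r (u * b) - r (2 * u * b))
          + ((2 * u ^ d - (2 * u) ^ d) * b ^ d - b ^ d) *\<^sub>C Z"
        unfolding D_eq by (simp add: vec_eq_iff power_mult_distrib algebra_simps)
      also have "\<dots> = r (u * b) + r (u * b) - r (2 * u * b)" by (simp only: u) simp
      finally have rr: "r (u * b) + r (u * b) - r (2 * u * b) =
          D (u * b) + D (u * b) - D (2 * u * b) - b ^ d *\<^sub>C Z" ..
      show ?thesis
        unfolding rr unfolding m_eq ww by (simp add: mat_distribs cscale_distrib)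
    qed
    ultimately show ?thesis by simp
  qed
  from vanishes_to_mult[OF this vanishes_to_scale_arg[OF mpc(2), of "2 * u"]]
  have q1: "vanishes_to (Suc d) (\<lambda>b. q b - (mat 1 + b ^ d *\<^sub>C Z))"
    by (simp add: q_def mat_diff_mult matrix_mul_assoc[symmetric] mm)
  \<comment> \<open>Both w(-b) m(b) and q(b) are 1 + b^d Z modulo order d + 1, so multiplication by
    the inverse of q removes the leading error; the improved curve is m q'.\<close>
  have "vanishes_to (Suc d) (\<lambda>b. (w (- b) ** m b - mat 1 - b ^ d *\<^sub>C Z) - (q b - (mat 1 + b ^ d *\<^sub>C Z)))"
    by (intro vanishes_to_diff Z q1)
  then have "vanishes_to (Suc d) (\<lambda>b. w (- b) ** m b - q b)" by (simp add: algebra_simps)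
  from vanishes_to_mult[OF this, of 0 q'] q
  have "vanishes_to (Suc d) (\<lambda>b. w (- b) ** (m b ** q' b) - mat 1)"
    unfolding monoid_curve_def by (simp add: mat_diff_mult matrix_mul_assoc)
  moreover have "monoid_curve N h \<mu> (\<lambda>b. m b ** q' b) (\<lambda>b. q b ** m' b)"
    by (intro monoid_curve_mult N m monoid_curve_sym[OF q])
  ultimately show ?thesis using that by blast
qed

text \<open>The tangent vectors of the homogeneous curves in \<open>N\<close> form a closed subspace. It contains
  the conjugates of the tangent vector of \<open>w\<close> by \<open>g s\<close>, \<open>s \<noteq> 0\<close>, hence also their limit, so
  \<open>w\<close> is approximated in \<open>N\<close> to order \<open>2\<close>, and then to any order. By homogeneity a high
  order of approximation forces equality.\<close>

lemma one_parameter_limit_in_monoid: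
  fixes w g :: "complex \<Rightarrow> 'm::finite cmat" and P :: "'m cmat"
  assumes one: "mat 1 \<in> N" and N: "\<And>a b. a \<in> N \<Longrightarrow> b \<in> N \<Longrightarrow> a ** b \<in> N"
    and w: "poly_curve w" "\<And>s t. w (s + t) = w s ** w t" "w 0 = mat 1"
    and g: "poly_curve g" "g 0 = mat 1" "\<And>s. g s ** g (- s) = mat 1"
    and mem: "\<And>s b. s \<noteq> 0 \<Longrightarrow> g s ** w b ** g (- s) \<in> N"
    and P: "P ** P' = mat 1" "P' ** P = mat 1" and h: "h ** h' = mat 1"
    and diag: "\<And>r s. r \<noteq> s \<Longrightarrow> (P ** h ** P') $ r $ s = 0"
    and hg: "\<And>s. h ** g s = g s ** h" and hw: "\<And>b. h ** w b = w (\<mu> * b) ** h"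
    and \<mu>: "1 < cmod \<mu>"
  shows "w b \<in> N"
proof -
  have g_inv: "g (- s) ** g s = mat 1" for s using g(3)[of "- s"] by simp
  have w_inv: "w b ** w (- b) = mat 1" "w (- b) ** w b = mat 1" for b
    using w(2)[of b "-b"] w(2)[of "-b" b] w(3) by auto
  obtain X where X: "vanishes_to 2 (\<lambda>b. w b - mat 1 - b *\<^sub>C X)"
    using vanishes_to_leading[OF vanishes_to_first[OF w(1,3)]] by (auto simp: numeral_2_eq_2)
  define S where "S = {Y. \<exists>m m'. monoid_curve N h \<mu> m m' \<and> vanishes_to 2 (\<lambda>b. m b - mat 1 - b *\<^sub>C Y)}"
  have conj_in_S: "g s ** X ** g (- s) \<in> S" if "s \<noteq> 0" for s
  proof -
    have hw': "h ** (g s ** w b ** g (- s)) = g s ** w (\<mu> * b) ** g (- s) ** h" for b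
      by (metis hg hw matrix_mul_assoc)
    have inv: "g s ** w b ** g (- s) ** (g s ** w c ** g (- s)) = g s ** w (b + c) ** g (- s)" for b c
      using conj_mult[OF g_inv, of s "w b" "w c"] w(2) by simp
    have "monoid_curve N h \<mu> (\<lambda>b. g s ** w b ** g (- s)) (\<lambda>b. g s ** w (- b) ** g (- s))"
      unfolding monoid_curve_def
    proof (intro conjI allI)
      show "poly_curve (\<lambda>b. g s ** w b ** g (- s))" "poly_curve (\<lambda>b. g s ** w (- b) ** g (- s))"
        by (rule poly_curve_mult[OF poly_curve_mult] vanishes_to_const w(1) vanishes_to_neg_arg[OF w(1)])+
      show "h ** (g s ** w (- b) ** g (- s)) = g s ** w (- (\<mu> * b)) ** g (- s) ** h" for b
        using hw'[of "- b"] by simp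
    qed (simp_all add: hw' mem[OF that] inv w(3) g(3))
    moreover have "vanishes_to 2 (\<lambda>b. g s ** w b ** g (- s) - mat 1 - b *\<^sub>C (g s ** X ** g (- s)))"
    proof -
      have "vanishes_to 2 (\<lambda>b. g s ** (w b - mat 1 - b *\<^sub>C X) ** g (- s))"
        using vanishes_to_mult[OF vanishes_to_mult[OF vanishes_to_const[of "g s"] X]
            vanishes_to_const[of "g (- s)"]] by (simp only: add_0_left add_0_right)
      then show ?thesis by (simp add: mat_distribs g(3))
    qed
    ultimately show ?thesis unfolding S_def by blast
  qed
  \<comment> \<open>Real scalars suffice: the subspace property only serves to make S closed, by
    finite dimension.\<close>
  have "subspace S"
    unfolding subspace_def
  proof (intro conjI ballI allI)
    have "monoid_curve N h \<mu> (\<lambda>_. mat 1) (\<lambda>_. mat 1)"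
      using one by (simp add: monoid_curve_def)
    then show "0 \<in> S" unfolding S_def by (auto intro!: exI)
  next
    fix Y1 Y2 assume "Y1 \<in> S" "Y2 \<in> S"
    then obtain m m' k k' where m: "monoid_curve N h \<mu> m m'" "vanishes_to 2 (\<lambda>b. m b - mat 1 - b *\<^sub>C Y1)"
      and k: "monoid_curve N h \<mu> k k'" "vanishes_to 2 (\<lambda>b. k b - mat 1 - b *\<^sub>C Y2)"
      unfolding S_def by blast
    have first: "vanishes_to 1 (\<lambda>b. k b - mat 1)"
    proof -
      have "vanishes_to 1 (\<lambda>b. (k b - mat 1 - b *\<^sub>C Y2) + b ^ 1 *\<^sub>C Y2)"
        by (intro vanishes_to_add vanishes_to_power vanishes_to_mono[OF k(2)]) simp
      then show ?thesis by simp
    qed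
    have "vanishes_to 2 (\<lambda>b. (m b - mat 1 - b *\<^sub>C Y1) ** k b + (b ^ 1 *\<^sub>C Y1) ** (k b - mat 1)
       + (k b - mat 1 - b *\<^sub>C Y2))"
      using vanishes_to_mult[OF m(2), of 0 k] k vanishes_to_mult[OF vanishes_to_power[of 1 Y1] first]
      by (intro vanishes_to_add) (auto simp: monoid_curve_def numeral_2_eq_2)
    then have "vanishes_to 2 (\<lambda>b. m b ** k b - mat 1 - b *\<^sub>C (Y1 + Y2))"
      by (simp add: mat_distribs cscale_distrib algebra_simps)
    then show "Y1 + Y2 \<in> S" using monoid_curve_mult[OF N m(1) k(1)] unfolding S_def by blast
  next
    fix c :: real and Y assume "Y \<in> S"
    then obtain m m' where m: "monoid_curve N h \<mu> m m'" "vanishes_to 2 (\<lambda>b. m b - mat 1 - b *\<^sub>C Y)"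
      unfolding S_def by blast
    have "vanishes_to 2 (\<lambda>b. m (of_real c * b) - mat 1 - (of_real c * b) *\<^sub>C Y)"
      by (rule vanishes_to_scale_arg[OF m(2)])
    moreover have "(of_real c * b) *\<^sub>C Y = b *\<^sub>C (c *\<^sub>R Y)" for b
      by (simp add: vec_eq_iff scaleR_conv_of_real[where 'a=complex])
    ultimately show "c *\<^sub>R Y \<in> S"
      using monoid_curve_scale[OF m(1), of "of_real c"] unfolding S_def by (auto intro!: exI)
  qed
  then have closed: "closed S" by (rule closed_subspace)
  have lim: "((\<lambda>s. g s ** X ** g (- s)) \<longlongrightarrow> X) (at 0)"
  proof -
    have "poly_curve (\<lambda>s. g s ** X ** g (- s))"
      by (rule poly_curve_mult[OF poly_curve_mult] g(1) vanishes_to_const vanishes_to_neg_arg[OF g(1)])+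
    from continuous_poly_curve[OF this, of 0] show ?thesis by (simp add: isCont_def g(2))
  qed
  have ev: "\<forall>\<^sub>F s in at 0. g s ** X ** g (- s) \<in> S"
    using conj_in_S by (auto simp: eventually_at_filter)
  have "X \<in> S"
    by (rule Lim_in_closed_set[OF closed ev at_neq_bot lim])
  then obtain m m' where m: "monoid_curve N h \<mu> m m'" "vanishes_to 2 (\<lambda>b. m b - mat 1 - b *\<^sub>C X)"
    unfolding S_def by blast
  have start: "vanishes_to 2 (\<lambda>b. w (- b) ** m b - mat 1)"
  proof -
    have "vanishes_to 2 (\<lambda>b. w (- b) ** ((m b - mat 1 - b *\<^sub>C X) - (w b - mat 1 - b *\<^sub>C X)))"
      using vanishes_to_mult[OF vanishes_to_neg_arg[OF w(1)] vanishes_to_diff[OF m(2) X]] by (simp only: add_0_left)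
    then show ?thesis by (simp add: mat_distribs w_inv)
  qed
  \<comment> \<open>The target order is fixed here; the iteration below reaches it after d - 2
    improvements, and the remaining error is a homogeneous curve.\<close>
  obtain d where d: "2 \<le> d"
    "\<And>f t. vanishes_to d f \<Longrightarrow> (\<And>t. h ** f t = f (\<mu> * t) ** h) \<Longrightarrow> f t = 0"
    using homogeneous_vanishes[OF P h diag \<mu>] by metis
  have "\<exists>m m'. monoid_curve N h \<mu> m m' \<and> vanishes_to (2 + e) (\<lambda>b. w (- b) ** m b - mat 1)" for e
  proof (induction e)
    case 0
    show ?case using m(1) start by auto
  next
    case (Suc e)
    then obtain m m' where "monoid_curve N h \<mu> m m'" "vanishes_to (2 + e) (\<lambda>b. w (- b) ** m b - mat 1)"
      by blast
    then obtain k k' where "monoid_curve N h \<mu> k k'"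
      "vanishes_to (Suc (2 + e)) (\<lambda>b. w (- b) ** k b - mat 1)"
      using improve_approximation[OF N w, of h \<mu> m m' "2 + e"] by auto
    then show ?case by auto
  qed
  from this[of "d - 2"] obtain k k' where k: "monoid_curve N h \<mu> k k'"
    "vanishes_to d (\<lambda>b. w (- b) ** k b - mat 1)"
    unfolding le_add_diff_inverse[OF d(1)] by blast
  have "h ** (w (- b) ** k b - mat 1) = (w (- (\<mu> * b)) ** k (\<mu> * b) - mat 1) ** h" for b
  proof -
    have "h ** (w (- b) ** k b) = w (- (\<mu> * b)) ** k (\<mu> * b) ** h"
      using k(1) hw[of "- b"] unfolding monoid_curve_def by (metis matrix_mul_assoc mult_minus_right)
    then show ?thesis by (simp add: mat_distribs)
  qed
  then have "w (- b) ** k b - mat 1 = 0" using d(2)[OF k(2)] by blast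
  then have "w b ** (w (- b) ** k b) = w b" by simp
  then have "k b = w b" by (simp add: mat_cancel_left w_inv)
  then show ?thesis using k(1) unfolding monoid_curve_def by metis
qed

section \<open>Commutators of one-parameter subgroups\<close>

definition mpow :: "'m::finite cmat \<Rightarrow> nat \<Rightarrow> 'm cmat" where
  "mpow A k = ((**) A ^^ k) (mat 1)"

lemma mpow_simps [simp]: "mpow A 0 = mat 1" "mpow A (Suc k) = A ** mpow A k"
  by (simp_all add: mpow_def)

lemma mpow_add: "mpow A (j + k) = mpow A j ** mpow A k"
  by (induction j) (simp_all add: matrix_mul_assoc)

text \<open>The operator norm induced by the supremum norm. It is submultiplicative and at most 1 at
  the identity, so it controls long products of matrices close to the identity.\<close>

definition row_norm :: "'m::finite cmat \<Rightarrow> real" where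
  "row_norm A = Max (range (\<lambda>r. \<Sum>s\<in>UNIV. cmod (A $ r $ s)))"

lemma row_sum_le: "(\<Sum>s\<in>UNIV. cmod (A $ r $ s)) \<le> row_norm A"
  unfolding row_norm_def by (intro Max_ge) auto

lemma row_norm_leI: "(\<And>r. (\<Sum>s\<in>UNIV. cmod (A $ r $ s)) \<le> c) \<Longrightarrow> row_norm A \<le> c"
  unfolding row_norm_def by (intro Max.boundedI) auto

lemma norm_entry_le: "cmod (A $ r $ s) \<le> row_norm A"
  using member_le_sum[of s UNIV "\<lambda>s. cmod (A $ r $ s)"] row_sum_le[of A r] by simp

lemma row_norm_nonneg: "0 \<le> row_norm A"
  by (rule order_trans[OF norm_ge_zero norm_entry_le[of A undefined undefined]])

lemma row_norm_add: "row_norm (A + B) \<le> row_norm A + row_norm B"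
proof (rule row_norm_leI)
  fix r
  have "(\<Sum>s\<in>UNIV. cmod ((A + B) $ r $ s)) \<le> (\<Sum>s\<in>UNIV. cmod (A $ r $ s) + cmod (B $ r $ s))"
    by (intro sum_mono) (simp add: norm_triangle_ineq)
  then show "(\<Sum>s\<in>UNIV. cmod ((A + B) $ r $ s)) \<le> row_norm A + row_norm B"
    using row_sum_le[of A r] row_sum_le[of B r] by (simp add: sum.distrib)
qed

lemma row_norm_mult: "row_norm (A ** B) \<le> row_norm A * row_norm B"
proof (rule row_norm_leI)
  fix r
  have "(\<Sum>s\<in>UNIV. cmod ((A ** B) $ r $ s)) \<le> (\<Sum>s\<in>UNIV. \<Sum>u\<in>UNIV. cmod (A $ r $ u) * cmod (B $ u $ s))"
    by (intro sum_mono) (simp add: matrix_matrix_mult_def sum_norm_le norm_mult)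
  also have "\<dots> = (\<Sum>u\<in>UNIV. cmod (A $ r $ u) * (\<Sum>s\<in>UNIV. cmod (B $ u $ s)))"
    by (subst sum.swap) (simp add: sum_distrib_left)
  also have "\<dots> \<le> (\<Sum>u\<in>UNIV. cmod (A $ r $ u) * row_norm B)"
    by (intro sum_mono mult_left_mono row_sum_le) simp
  also have "\<dots> \<le> row_norm A * row_norm B"
    using row_sum_le[of A r] by (simp add: sum_distrib_right[symmetric] mult_right_mono row_norm_nonneg)
  finally show "(\<Sum>s\<in>UNIV. cmod ((A ** B) $ r $ s)) \<le> row_norm A * row_norm B" .
qed

lemma row_norm_one: "row_norm (mat 1 :: 'm::finite cmat) \<le> 1"
  by (rule row_norm_leI) (simp add: mat_def if_distrib cong: if_cong)

lemma vanishes_to_bound: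
  fixes f :: "complex \<Rightarrow> 'm::finite cmat"
  assumes "vanishes_to d f"
  obtains K where "0 \<le> K" "\<And>t. cmod t \<le> 1 \<Longrightarrow> row_norm (f t) \<le> K * cmod t ^ d"
proof -
  obtain p where p: "\<And>r s t. f t $ r $ s = t ^ d * poly (p r s) t"
    using assms unfolding vanishes_to_def by metis
  have "\<exists>K. \<forall>t. cmod t \<le> 1 \<longrightarrow> cmod (poly (p r s) t) \<le> K" for r s
  proof -
    have "compact (poly (p r s) ` cball 0 1)"
      by (intro compact_continuous_image continuous_intros compact_cball)
    then have "bounded (poly (p r s) ` cball 0 1)" by (rule compact_imp_bounded)
    then obtain a where "\<forall>x\<in>poly (p r s) ` cball 0 1. norm x \<le> a" unfolding bounded_iff by blast
    then show ?thesis by (intro exI[of _ a]) simp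
  qed
  then obtain K where K: "\<And>r s t. cmod t \<le> 1 \<Longrightarrow> cmod (poly (p r s) t) \<le> K r s"
    by metis
  have K0: "0 \<le> K r s" for r s using order_trans[OF norm_ge_zero K[of 0 r s]] by simp
  show ?thesis
  proof (rule that)
    show "0 \<le> (\<Sum>r\<in>UNIV. \<Sum>s\<in>UNIV. K r s)" using K0 by (intro sum_nonneg) auto
  next
    fix t assume t: "cmod t \<le> 1"
    show "row_norm (f t) \<le> (\<Sum>r\<in>UNIV. \<Sum>s\<in>UNIV. K r s) * cmod t ^ d"
    proof (rule row_norm_leI)
      fix r
      have "(\<Sum>s\<in>UNIV. cmod (f t $ r $ s)) \<le> (\<Sum>s\<in>UNIV. K r s) * cmod t ^ d"
        unfolding sum_distrib_right
        by (intro sum_mono) (simp add: p norm_mult norm_power mult.commute[of "cmod t ^ d"] mult_right_mono K[OF t])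
      also have "(\<Sum>s\<in>UNIV. K r s) \<le> (\<Sum>r\<in>UNIV. \<Sum>s\<in>UNIV. K r s)"
        using K0 by (intro member_le_sum[of r UNIV "\<lambda>r. \<Sum>s\<in>UNIV. K r s"]) (auto intro: sum_nonneg)
      finally show "(\<Sum>s\<in>UNIV. cmod (f t $ r $ s)) \<le> (\<Sum>r\<in>UNIV. \<Sum>s\<in>UNIV. K r s) * cmod t ^ d"
        by (simp add: mult_right_mono)
    qed
  qed
qed

lemma row_norm_mpow: "row_norm A \<le> a \<Longrightarrow> row_norm (mpow A k) \<le> a ^ k"
proof (induction k)
  case (Suc k)
  have "0 \<le> a" using Suc.prems row_norm_nonneg[of A] by linarith
  then have "row_norm A * row_norm (mpow A k) \<le> a * a ^ k"
    using Suc by (intro mult_mono row_norm_nonneg) auto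
  then show ?case using row_norm_mult[of A "mpow A k"] by simp
qed (simp add: row_norm_one)

text \<open>Telescoping. The bound uses a^k in place of the sharper a^(k-1), which is where 1 <= a
  enters.\<close>

lemma row_norm_mpow_diff:
  assumes "row_norm A \<le> a" "row_norm B \<le> a" "1 \<le> a"
  shows "row_norm (mpow A k - mpow B k) \<le> real k * a ^ k * row_norm (A - B)"
proof (induction k)
  case 0
  have "row_norm (0 :: 'a cmat) \<le> 0" by (rule row_norm_leI) simp
  then show ?case by simp
next
  case (Suc k)
  let ?d = "row_norm (A - B)"
  have "mpow A (Suc k) - mpow B (Suc k) = A ** (mpow A k - mpow B k) + (A - B) ** mpow B k"
    by (simp add: mat_distribs)
  then have "row_norm (mpow A (Suc k) - mpow B (Suc k))
      \<le> row_norm A * row_norm (mpow A k - mpow B k) + ?d * row_norm (mpow B k)"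
    using row_norm_add row_norm_mult by (smt (verit))
  also have "\<dots> \<le> a * (real k * a ^ k * ?d) + ?d * a ^ k"
    using Suc assms row_norm_mpow[OF assms(2), of k]
    by (intro add_mono mult_mono) (auto simp: row_norm_nonneg)
  also have "\<dots> \<le> a * (real k * a ^ k * ?d) + ?d * (a * a ^ k)"
    using assms(3) by (intro add_left_mono mult_left_mono) (auto simp: row_norm_nonneg)
  also have "\<dots> = real (Suc k) * a ^ Suc k * ?d" by (simp add: algebra_simps)
  finally show ?case .
qed

text \<open>The exponential of tX as soon as X^K = 0. As a finite sum it is polynomial in t, as
  required of a root subgroup.\<close>

definition nil_exp :: "nat \<Rightarrow> 'm::finite cmat \<Rightarrow> complex \<Rightarrow> 'm cmat" where
  "nil_exp K X t = (\<Sum>k<K. (t ^ k / fact k) *\<^sub>C mpow X k)"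

lemma vanishes_to_sum:
  "(\<And>k. k \<in> A \<Longrightarrow> vanishes_to d (f k)) \<Longrightarrow> vanishes_to d (\<lambda>t. \<Sum>k\<in>A. f k t)"
  by (induction A rule: infinite_finite_induct) (auto intro: vanishes_to_add)

lemma mat_sum_mult: "(\<Sum>k\<in>A. f k) ** B = (\<Sum>k\<in>A. f k ** (B :: 'm::finite cmat))"
  by (induction A rule: infinite_finite_induct) (auto simp: mat_distribs)

lemma mat_mult_sum: "B ** (\<Sum>k\<in>A. f k) = (\<Sum>k\<in>A. B ** (f k :: 'm::finite cmat))"
  by (induction A rule: infinite_finite_induct) (auto simp: mat_distribs)

lemma cscale_sum: "(\<Sum>k\<in>A. c k) *\<^sub>C X = (\<Sum>k\<in>A. c k *\<^sub>C X)"
  by (induction A rule: infinite_finite_induct) (auto simp: cscale_distrib)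

lemma mpow_zero_mono: "mpow X K = 0 \<Longrightarrow> K \<le> k \<Longrightarrow> mpow X k = 0"
  using mpow_add[of X K "k - K"] by simp

text \<open>In the product, a sum over a square of index pairs, all terms with i + j >= K vanish;
  the remaining triangle is the binomial expansion of the powers of s + t.\<close>

lemma nil_exp_add:
  assumes "mpow X K = 0"
  shows "nil_exp K X (s + t) = nil_exp K X s ** nil_exp K X t"
proof -
  let ?g = "\<lambda>i j. (s ^ i / fact i * (t ^ j / fact j)) *\<^sub>C mpow X (i + j)"
  have "nil_exp K X s ** nil_exp K X t = (\<Sum>(i, j)\<in>{..<K} \<times> {..<K}. ?g i j)"
    unfolding nil_exp_def mat_sum_mult unfolding mat_mult_sum
    by (simp add: cscale_mult mpow_add sum.cartesian_product mult.commute)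
  also have "\<dots> = (\<Sum>(i, j)\<in>{(i, j). i + j < K}. ?g i j)"
    by (intro sum.mono_neutral_right) (auto, metis mpow_zero_mono[OF assms] not_less cscale_simps(3))
  also have "\<dots> = (\<Sum>k<K. \<Sum>i\<le>k. ?g i (k - i))" by (rule sum.triangle_reindex)
  also have "\<dots> = (\<Sum>k<K. (\<Sum>i\<le>k. s ^ i / fact i * (t ^ (k - i) / fact (k - i))) *\<^sub>C mpow X k)"
    by (intro sum.cong refl) (simp add: cscale_sum)
  also have "\<dots> = nil_exp K X (s + t)"
    unfolding nil_exp_def
  proof (intro sum.cong refl arg_cong2[where f="(*\<^sub>C)"])
    fix k
    have "(s + t) ^ k /\<^sub>R fact k = (\<Sum>i\<le>k. (s ^ i /\<^sub>R fact i) * (t ^ (k - i) /\<^sub>R fact (k - i)))"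
      using exp_series_add_commuting[of s t k] by (simp add: mult.commute)
    then show "(\<Sum>i\<le>k. s ^ i / fact i * (t ^ (k - i) / fact (k - i))) = (s + t) ^ k / fact k"
      by (simp add: scaleR_conv_of_real field_simps)
  qed
  finally show ?thesis ..
qed

lemma nil_exp_split:
  assumes "2 \<le> K"
  shows "nil_exp K X t = mat 1 + t *\<^sub>C X + (\<Sum>k<K - 2. (t ^ (k + 2) / fact (k + 2)) *\<^sub>C mpow X (k + 2))"
proof -
  obtain L where "K = Suc (Suc L)"
    using assms by (metis One_nat_def Suc_le_D numeral_2_eq_2 Suc_le_mono)
  then show ?thesis
    by (simp add: nil_exp_def sum.lessThan_Suc_shift del: sum.lessThan_Suc mpow_simps(2))
       (simp add: algebra_simps)
qed

lemma nil_exp_0: "2 \<le> K \<Longrightarrow> nil_exp K X 0 = mat 1"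
  by (simp add: nil_exp_split del: mpow_simps)

lemma vanishes_to_nil_exp:
  assumes "2 \<le> K"
  shows "vanishes_to 2 (\<lambda>t. nil_exp K X t - mat 1 - t *\<^sub>C X)"
proof -
  have "vanishes_to 2 (\<lambda>t. \<Sum>k<K - 2. (t ^ (k + 2) / fact (k + 2)) *\<^sub>C mpow X (k + 2))"
  proof (rule vanishes_to_sum)
    fix k
    have "vanishes_to (k + 2) (\<lambda>t. (1 / fact (k + 2)) *\<^sub>C (t ^ (k + 2) *\<^sub>C mpow X (k + 2)))"
      by (intro vanishes_to_cscale vanishes_to_power)
    then show "vanishes_to 2 (\<lambda>t. (t ^ (k + 2) / fact (k + 2)) *\<^sub>C mpow X (k + 2))"
      using vanishes_to_mono[of "k + 2" _ 2] by simp
  qed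
  then show ?thesis by (simp add: nil_exp_split[OF assms] del: mpow_simps)
qed

lemma poly_curve_nil_exp: "poly_curve (nil_exp K X)"
proof -
  have "poly_curve (\<lambda>t. \<Sum>k<K. (1 / fact k) *\<^sub>C (t ^ k *\<^sub>C mpow X k))"
    by (intro vanishes_to_sum vanishes_to_cscale vanishes_to_mono[OF vanishes_to_power]) simp
  moreover have "(\<lambda>t. \<Sum>k<K. (1 / fact k) *\<^sub>C (t ^ k *\<^sub>C mpow X k)) = nil_exp K X"
    by (simp add: nil_exp_def fun_eq_iff)
  ultimately show ?thesis by simp
qed

lemma mpow_nil_exp:
  assumes "mpow X K = 0" "2 \<le> K"
  shows "mpow (nil_exp K X t) k = nil_exp K X (of_nat k * t)"
  by (induction k) (simp_all add: nil_exp_0 assms nil_exp_add[OF assms(1), symmetric] algebra_simps)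

text \<open>Multiplying the exponential of uX by the last power X^j with X^(j+1) nonzero leaves X^j
  + u X^(j+1), from which u can be read off.\<close>

lemma nil_exp_inj:
  assumes X: "mpow X K = 0" "2 \<le> K" "X \<noteq> 0"
  shows "inj (nil_exp K X)"
proof
  fix s t assume eq: "nil_exp K X s = nil_exp K X t"
  let ?u = "s - t"
  have "nil_exp K X ?u = mat 1"
    using nil_exp_add[OF X(1), of s "- t"] nil_exp_add[OF X(1), of t "- t"] eq nil_exp_0[OF X(2), of X]
    by simp
  define l where "l = (LEAST l. mpow X (Suc l) = 0)"
  have "\<exists>l. mpow X (Suc l) = 0" using X(1,2) by (intro exI[of _ "K - 1"]) (simp del: mpow_simps)
  then have l: "mpow X (Suc l) = 0" unfolding l_def by (rule LeastI_ex)
  have "l \<noteq> 0" using l X(3) by (intro notI) simp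
  then obtain j where j: "l = Suc j" by (cases l) auto
  have lj: "mpow X l \<noteq> 0"
    using not_less_Least[of j "\<lambda>l. mpow X (Suc l) = 0"] j unfolding l_def by simp
  have "mpow X j ** nil_exp K X ?u = mpow X j + ?u *\<^sub>C mpow X l
      + (\<Sum>k<K - 2. (?u ^ (k + 2) / fact (k + 2)) *\<^sub>C mpow X (j + (k + 2)))"
    unfolding nil_exp_split[OF X(2)] mpow_add
    using mpow_add[of X j 1] by (simp add: mat_distribs mat_mult_sum j del: mpow_simps) simp
  also have "(\<Sum>k<K - 2. (?u ^ (k + 2) / fact (k + 2)) *\<^sub>C mpow X (j + (k + 2))) = 0"
    using mpow_zero_mono[OF l] j by (intro sum.neutral) (simp del: mpow_simps)
  finally have "?u *\<^sub>C mpow X l = 0" using \<open>nil_exp K X ?u = mat 1\<close> by simp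
  then have "?u = 0" using lj by (auto simp: vec_eq_iff)
  then show "s = t" by simp
qed

lemma vanishes_to_square_arg:
  assumes "vanishes_to d f"
  shows "vanishes_to (2 * d) (\<lambda>t. f (t\<^sup>2))"
  unfolding vanishes_to_def
proof (intro allI)
  fix r s
  obtain p where "\<forall>t. f t $ r $ s = t ^ d * poly p t"
    using assms unfolding vanishes_to_def by blast
  then show "\<exists>p. \<forall>t. f (t\<^sup>2) $ r $ s = t ^ (2 * d) * poly p t"
    by (intro exI[of _ "pcompose p (monom 1 2)"])
       (simp add: poly_pcompose poly_monom power_mult)
qed

text \<open>The Lie product formula for commutators. At s = 1/n the matrices C(s) and exp(s^2 Y)
  differ by O(1/n^3), and both have norm at most 1 + L/n^2. Their powers with exponent n^2 therefore
  differ by at most n^2 e^L O(1/n^3), which tends to 0.\<close>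

lemma iterate_tendsto_nil_exp:
  fixes C :: "complex \<Rightarrow> 'm::finite cmat"
  assumes C: "vanishes_to 3 (\<lambda>s. C s - mat 1 - s\<^sup>2 *\<^sub>C Y)" and Y: "mpow Y K = 0" "2 \<le> K"
  shows "(\<lambda>n. mpow (C (1 / of_nat (Suc n))) ((Suc n)\<^sup>2)) \<longlonglongrightarrow> nil_exp K Y 1"
proof -
  define V where "V s = nil_exp K Y (s\<^sup>2)" for s
  have V: "vanishes_to 3 (\<lambda>s. V s - mat 1 - s\<^sup>2 *\<^sub>C Y)"
    unfolding V_def
    using vanishes_to_mono[OF vanishes_to_square_arg[OF vanishes_to_nil_exp[OF Y(2)]], of 3] by simp
  have "vanishes_to 2 (\<lambda>s. W s - mat 1)" if "vanishes_to 3 (\<lambda>s. W s - mat 1 - s\<^sup>2 *\<^sub>C Y)" for W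
  proof -
    have "vanishes_to 2 (\<lambda>s. (W s - mat 1 - s\<^sup>2 *\<^sub>C Y) + s\<^sup>2 *\<^sub>C Y)"
      by (intro vanishes_to_add vanishes_to_power vanishes_to_mono[OF that]) simp
    then show ?thesis by simp
  qed
  from this[OF C] this[OF V]
  obtain K1 K2 where K1: "0 \<le> K1" "\<And>t. cmod t \<le> 1 \<Longrightarrow> row_norm (C t - mat 1) \<le> K1 * cmod t ^ 2"
    and K2: "0 \<le> K2" "\<And>t. cmod t \<le> 1 \<Longrightarrow> row_norm (V t - mat 1) \<le> K2 * cmod t ^ 2"
    using vanishes_to_bound by metis
  obtain K3 where K3: "0 \<le> K3" "\<And>t. cmod t \<le> 1 \<Longrightarrow> row_norm (C t - V t) \<le> K3 * cmod t ^ 3"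
    using vanishes_to_bound[OF vanishes_to_diff[OF C V]] by auto
  define L where "L = K1 + K2"
  have bound: "row_norm (mpow (C (1 / of_nat (Suc n))) ((Suc n)\<^sup>2) - nil_exp K Y 1)
      \<le> exp L * K3 * (1 / real (Suc n))" for n
  proof -
    define t :: complex where "t = 1 / of_nat (Suc n)"
    define M where "M = (Suc n)\<^sup>2"
    have M0: "0 < real M" by (simp add: M_def)
    have t: "cmod t = 1 / real (Suc n)" unfolding t_def norm_divide by (simp add: norm_of_nat del: of_nat_Suc)
    then have t1: "cmod t \<le> 1" by simp
    have t2: "cmod t ^ 2 = 1 / real M" by (simp add: t M_def power_divide)
    have Mt: "of_nat M * t\<^sup>2 = 1" by (simp add: t_def M_def power_divide del: of_nat_Suc)
    have le: "row_norm W \<le> 1 + L / real M" if "row_norm (W - mat 1) \<le> K' * cmod t ^ 2" "K' \<le> L" for W :: "'m cmat" and K'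
    proof -
      have "row_norm W \<le> row_norm (W - mat 1) + row_norm (mat 1 :: 'm cmat)"
        using row_norm_add[of "W - mat 1" "mat 1"] by simp
      also have "\<dots> \<le> K' / real M + 1" using that(1) row_norm_one[where 'm='m] t2 by simp
      also have "\<dots> \<le> 1 + L / real M" using that(2) M0 by (simp add: divide_right_mono)
      finally show ?thesis .
    qed
    have "row_norm (mpow (C t) M - mpow (V t) M) \<le> real M * (1 + L / real M) ^ M * row_norm (C t - V t)"
      using K1 K2 t1 M0 by (intro row_norm_mpow_diff le[of _ K1] le[of _ K2]) (auto simp: L_def)
    also have "\<dots> \<le> real M * exp L * (K3 * cmod t ^ 3)"
    proof (intro mult_mono)
      have "(1 + L / real M) ^ M \<le> exp (L / real M) ^ M"
        using K1(1) K2(1) by (intro power_mono exp_ge_add_one_self) (simp add: L_def)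
      also have "\<dots> = exp L" using M0 by (simp add: exp_of_nat_mult[symmetric])
      finally show "(1 + L / real M) ^ M \<le> exp L" .
    qed (use K3 t1 K1 K2 in \<open>auto simp: row_norm_nonneg L_def\<close>)
    also have "\<dots> = exp L * K3 * (real M * cmod t ^ 2 * cmod t)"
      by (simp add: power3_eq_cube power2_eq_square)
    also have "\<dots> = exp L * K3 * (1 / real (Suc n))" using M0 unfolding t2 unfolding t by simp
    finally show ?thesis
      using mpow_nil_exp[OF Y, of "t\<^sup>2" M] by (simp only: V_def t_def[symmetric] M_def[symmetric] Mt)
  qed
  have null: "(\<lambda>n. exp L * K3 * (1 / real (Suc n))) \<longlonglongrightarrow> 0"
    using tendsto_mult_left[OF LIMSEQ_inverse_real_of_nat, of "exp L * K3"]
    by (simp add: inverse_eq_divide)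
  show ?thesis
  proof (intro vec_tendstoI)
    fix r s
    show "(\<lambda>n. mpow (C (1 / of_nat (Suc n))) ((Suc n)\<^sup>2) $ r $ s) \<longlonglongrightarrow> nil_exp K Y 1 $ r $ s"
      unfolding LIM_zero_iff[symmetric, of _ "nil_exp K Y 1 $ r $ s"]
    proof (rule Lim_null_comparison[OF _ null], intro always_eventually allI)
      fix n
      show "cmod (mpow (C (1 / of_nat (Suc n))) ((Suc n)\<^sup>2) $ r $ s - nil_exp K Y 1 $ r $ s)
          \<le> exp L * K3 * (1 / real (Suc n))"
        using order_trans[OF norm_entry_le bound[of n], of r s] by simp
    qed
  qed
qed

text \<open>The commutator \<open>f b = [v b, M]\<close> satisfies \<open>f (2 b) = v b f b + f b v b\<close>; comparing
  leading terms in this identity shows that \<open>f\<close> vanishes to all orders.\<close>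

lemma one_parameter_commute:
  fixes v :: "complex \<Rightarrow> 'm::finite cmat"
  assumes v: "poly_curve v" "\<And>s t. v (s + t) = v s ** v t" "v 0 = mat 1"
    and B: "vanishes_to 2 (\<lambda>b. v b - mat 1 - b *\<^sub>C B)" and comm: "B ** M = M ** B"
  shows "v b ** M = M ** v b"
proof -
  define f where "f b = v b ** M - M ** v b" for b
  have "vanishes_to (d + 2) f" for d
  proof (induction d)
    case 0
    have "vanishes_to 2 (\<lambda>b. (v b - mat 1 - b *\<^sub>C B) ** M - M ** (v b - mat 1 - b *\<^sub>C B))"
      by (intro vanishes_to_diff vanishes_to_mult_left vanishes_to_mult_right B)
    moreover have "(v b - mat 1 - b *\<^sub>C B) ** M - M ** (v b - mat 1 - b *\<^sub>C B) = f b" for b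
      by (simp add: mat_distribs f_def comm)
    ultimately show ?case by (simp only: add_0_left)
  next
    case (Suc d)
    obtain Z where Z: "vanishes_to (Suc (d + 2)) (\<lambda>b. f b - b ^ (d + 2) *\<^sub>C Z)"
      using vanishes_to_leading[OF Suc] .
    have v1: "vanishes_to 1 (\<lambda>b. v b - mat 1)" using vanishes_to_first[OF v(1,3)] .
    have "vanishes_to (Suc (d + 2)) (\<lambda>b. (v b - mat 1) ** f b + f b ** (v b - mat 1))"
      using vanishes_to_mult[OF v1 Suc] vanishes_to_mult[OF Suc v1]
      by (intro vanishes_to_add) simp_all
    moreover have "(v b - mat 1) ** f b + f b ** (v b - mat 1) = f (2 * b) - 2 *\<^sub>C f b" for b
    proof -
      have "v (2 * b) = v b ** v b" using v(2)[of b b] by simp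
      moreover have "2 *\<^sub>C f b = f b + f b" by (simp add: vec_eq_iff)
      ultimately show ?thesis by (simp add: f_def mat_distribs matrix_mul_assoc)
    qed
    ultimately have "vanishes_to (Suc (d + 2)) (\<lambda>b. f (2 * b) - 2 *\<^sub>C f b)" by simp
    \<comment> \<open>Replacing f by its leading term leaves (2^(d+2) - 2) b^(d+2) Z, which can
      vanish to a higher order only if Z = 0.\<close>
    from vanishes_to_add[OF vanishes_to_diff[OF this vanishes_to_scale_arg[OF Z, of 2]]
        vanishes_to_cscale[OF Z, of 2]]
    have "vanishes_to (Suc (d + 2)) (\<lambda>b. (f (2 * b) - 2 *\<^sub>C f b)
        - (f (2 * b) - (2 * b) ^ (d + 2) *\<^sub>C Z) + 2 *\<^sub>C (f b - b ^ (d + 2) *\<^sub>C Z))" .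
    moreover have "(f (2 * b) - 2 *\<^sub>C f b)
        - (f (2 * b) - (2 * b) ^ (d + 2) *\<^sub>C Z) + 2 *\<^sub>C (f b - b ^ (d + 2) *\<^sub>C Z)
        = b ^ (d + 2) *\<^sub>C ((2 ^ (d + 2) - 2) *\<^sub>C Z)" for b
      by (simp add: vec_eq_iff power_mult_distrib algebra_simps)
    ultimately have "(2 ^ (d + 2) - 2) *\<^sub>C Z = 0"
      using vanishes_to_leading_unique by (metis (no_types, lifting) ext)
    moreover have "(2::complex) ^ (d + 2) - 2 \<noteq> 0"
    proof
      assume "(2::complex) ^ (d + 2) - 2 = 0"
      then have "(2::complex) * 2 ^ d = 1" by simp
      then have "cmod (2 * 2 ^ d) = 1" by simp
      then have "2 * (2::real) ^ d = 1" by (simp add: norm_mult norm_power)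
      moreover have "(1::real) \<le> 2 ^ d" by simp
      ultimately show False by linarith
    qed
    ultimately have "Z = 0" by (auto simp: vec_eq_iff)
    with Z show ?case by simp
  qed
  then have "vanishes_to d f" for d using vanishes_to_mono[of "d + 2" f d] by simp
  then have "f b = 0" by (rule vanishes_to_all)
  then show ?thesis by (simp add: f_def)
qed

text \<open>Comparison of the terms of order 1 in s: the tangent vector of a root subgroup is a
  weight vector for h.\<close>

lemma one_parameter_equivariant_leading:
  fixes u :: "complex \<Rightarrow> 'm::finite cmat"
  assumes "vanishes_to 2 (\<lambda>s. u s - mat 1 - s *\<^sub>C A)" "\<And>s. h ** u s = u (a * s) ** h"
  shows "h ** A = a *\<^sub>C (A ** h)"
proof -
  note u2 = assms(1) vanishes_to_scale_arg[OF assms(1), of a]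
  have "vanishes_to 2 (\<lambda>s. (u (a * s) - mat 1 - (a * s) *\<^sub>C A) ** h - h ** (u s - mat 1 - s *\<^sub>C A))"
    by (intro vanishes_to_diff vanishes_to_mult_left vanishes_to_mult_right u2)
  moreover have "(u (a * s) - mat 1 - (a * s) *\<^sub>C A) ** h - h ** (u s - mat 1 - s *\<^sub>C A)
      = s ^ 1 *\<^sub>C (h ** A - a *\<^sub>C (A ** h))" for s
    by (simp add: mat_distribs assms(2) cscale_distrib algebra_simps)
  ultimately have "vanishes_to (Suc 1) (\<lambda>s. s ^ 1 *\<^sub>C (h ** A - a *\<^sub>C (A ** h)))"
    by (simp add: numeral_2_eq_2)
  then show ?thesis using vanishes_to_leading_unique by fastforce
qed

section \<open>Matrix groups and regular functions\<close>

lemma matrix_invI: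
  fixes A :: "'m::finite cmat"
  assumes "A ** B = mat 1"
  shows "matrix_inv A = B"
proof -
  have BA: "B ** A = mat 1" by (rule matrix_left_right_inverse[THEN iffD1, OF assms])
  then have "A ** matrix_inv A = mat 1 \<and> matrix_inv A ** A = mat 1"
    unfolding matrix_inv_def using assms by (intro someI[where P="\<lambda>A'. A ** A' = mat 1 \<and> A' ** A = mat 1" and x=B]) simp
  then have "B ** (A ** matrix_inv A) = B" by simp
  then show ?thesis by (simp add: mat_cancel_left[OF BA])
qed

lemma matrix_inv:
  fixes A :: "'m::finite cmat"
  assumes "invertible A"
  shows "A ** matrix_inv A = mat 1" "matrix_inv A ** A = mat 1"
proof -
  obtain B where B: "A ** B = mat 1" "B ** A = mat 1" using assms unfolding invertible_def by blast
  then have "matrix_inv A = B" by (intro matrix_invI)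
  with B show "A ** matrix_inv A = mat 1" "matrix_inv A ** A = mat 1" by simp_all
qed

lemma group_GL: "group (matrix_group {g :: 'm::finite cmat. invertible g})"
proof (rule groupI)
  fix x :: "'m cmat" assume "x \<in> carrier (matrix_group {g. invertible g})"
  then have "invertible x" by (simp add: matrix_group_def)
  then show "\<exists>y\<in>carrier (matrix_group {g. invertible g}).
      y \<otimes>\<^bsub>matrix_group {g. invertible g}\<^esub> x = \<one>\<^bsub>matrix_group {g. invertible g}\<^esub>"
    unfolding matrix_group_def invertible_def by auto
next
  show "\<one>\<^bsub>matrix_group {g :: 'm cmat. invertible g}\<^esub> \<in> carrier (matrix_group {g. invertible g})"
    by (auto simp: matrix_group_def invertible_def intro!: exI[of _ "mat 1"])
qed (auto simp: matrix_group_def invertible_mult matrix_mul_assoc)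

lemma matrix_poly_continuous: "matrix_poly P \<Longrightarrow> isCont P g"
proof (induction rule: matrix_poly.induct)
  case (entry r s)
  show ?case unfolding isCont_def by (intro tendsto_vec_nth tendsto_ident_at)
qed (rule continuous_const continuous_add continuous_mult; assumption)+

lemma linear_algebraic_groupD:
  fixes G :: "'m::finite cmat set"
  assumes "linear_algebraic_group G"
  shows "mat 1 \<in> G" "\<And>g h. g \<in> G \<Longrightarrow> h \<in> G \<Longrightarrow> g ** h \<in> G"
    "\<And>g. g \<in> G \<Longrightarrow> matrix_inv g \<in> G" "\<And>g. g \<in> G \<Longrightarrow> invertible g"
proof -
  interpret GL: group "matrix_group {g :: 'm cmat. invertible g}" by (rule group_GL)
  have sub: "subgroup G (matrix_group {g. invertible g})"
    using assms unfolding linear_algebraic_group_def by blast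
  show "mat 1 \<in> G" using subgroup.one_closed[OF sub] by (simp add: matrix_group_def)
  show "g ** h \<in> G" if "g \<in> G" "h \<in> G" for g h
    using subgroup.m_closed[OF sub that] by (simp add: matrix_group_def)
  show inv: "invertible g" if "g \<in> G" for g
    using subgroup.mem_carrier[OF sub that] by (simp add: matrix_group_def)
  show "matrix_inv g \<in> G" if "g \<in> G" for g
  proof -
    have "matrix_inv g ** g = mat 1" "invertible (matrix_inv g)"
      using matrix_inv[OF inv[OF that]] unfolding invertible_def by auto
    then have "inv\<^bsub>matrix_group {g. invertible g}\<^esub> g = matrix_inv g"
      using inv[OF that] by (intro GL.inv_equality) (simp_all add: matrix_group_def)
    then show ?thesis using subgroup.m_inv_closed[OF sub that] by simp
  qed
qed

text \<open>The defining equations pass to the limit, but invertibility does not, so it is assumed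
  of L.\<close>

lemma linear_algebraic_group_limit:
  fixes G :: "'m::finite cmat set"
  assumes G: "linear_algebraic_group G" and "\<And>n. X n \<in> G" "X \<longlonglongrightarrow> L" "invertible L"
  shows "L \<in> G"
proof -
  obtain E where E: "\<forall>P\<in>E. matrix_poly P" "G = {g. invertible g \<and> (\<forall>P\<in>E. P g = 0)}"
    using G unfolding linear_algebraic_group_def by blast
  have "P L = 0" if "P \<in> E" for P
  proof -
    have "(\<lambda>n. P (X n)) \<longlonglongrightarrow> P L"
      using isCont_tendsto_compose[OF matrix_poly_continuous assms(3)] E(1) that by blast
    moreover have "(\<lambda>n. P (X n)) = (\<lambda>_. 0)" using assms(2) E(2) that by auto
    ultimately show ?thesis using LIMSEQ_unique[OF _ tendsto_const] by fastforce
  qed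
  then show ?thesis using E(2) assms(4) by simp
qed

section \<open>Regular functions: algebra operations and continuity\<close>

lemma regular_on_const: "regular_on S (\<lambda>_. c)"
  unfolding regular_on_def
  by (rule ballI, rule exI[of _ "\<lambda>_. c"], rule exI[of _ "\<lambda>_. 1"]) (auto intro: matrix_poly.const)

lemma regular_on_add:
  assumes "regular_on S f" "regular_on S g"
  shows "regular_on S (\<lambda>x. f x + g x)"
  unfolding regular_on_def
proof
  fix p assume p: "p \<in> S"
  obtain P Q where 1: "matrix_poly P" "matrix_poly Q" "Q p \<noteq> 0"
    "\<forall>g\<in>S. Q g \<noteq> 0 \<longrightarrow> f g = P g / Q g"
    using assms(1) p unfolding regular_on_def by blast
  obtain P' Q' where 2: "matrix_poly P'" "matrix_poly Q'" "Q' p \<noteq> 0"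
    "\<forall>h\<in>S. Q' h \<noteq> 0 \<longrightarrow> g h = P' h / Q' h"
    using assms(2) p unfolding regular_on_def by blast
  show "\<exists>P Q. matrix_poly P \<and> matrix_poly Q \<and> Q p \<noteq> 0 \<and>
      (\<forall>x\<in>S. Q x \<noteq> 0 \<longrightarrow> f x + g x = P x / Q x)"
    using 1 2
    by (rule_tac exI[of _ "\<lambda>x. P x * Q' x + P' x * Q x"], rule_tac exI[of _ "\<lambda>x. Q x * Q' x"])
       (auto intro!: matrix_poly.intros simp: field_simps)
qed

lemma regular_on_mult:
  assumes "regular_on S f" "regular_on S g"
  shows "regular_on S (\<lambda>x. f x * g x)"
  unfolding regular_on_def
proof
  fix p assume p: "p \<in> S"
  obtain P Q where 1: "matrix_poly P" "matrix_poly Q" "Q p \<noteq> 0"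
    "\<forall>g\<in>S. Q g \<noteq> 0 \<longrightarrow> f g = P g / Q g"
    using assms(1) p unfolding regular_on_def by blast
  obtain P' Q' where 2: "matrix_poly P'" "matrix_poly Q'" "Q' p \<noteq> 0"
    "\<forall>h\<in>S. Q' h \<noteq> 0 \<longrightarrow> g h = P' h / Q' h"
    using assms(2) p unfolding regular_on_def by blast
  show "\<exists>P Q. matrix_poly P \<and> matrix_poly Q \<and> Q p \<noteq> 0 \<and>
      (\<forall>x\<in>S. Q x \<noteq> 0 \<longrightarrow> f x * g x = P x / Q x)"
    using 1 2
    by (rule_tac exI[of _ "\<lambda>x. P x * P' x"], rule_tac exI[of _ "\<lambda>x. Q x * Q' x"])
       (auto intro!: matrix_poly.intros)
qed

lemma regular_on_inverse:
  assumes f: "regular_on S f" and nz: "\<And>x. x \<in> S \<Longrightarrow> f x \<noteq> 0"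
  shows "regular_on S (\<lambda>x. inverse (f x))"
  unfolding regular_on_def
proof
  fix p assume p: "p \<in> S"
  obtain P Q where 1: "matrix_poly P" "matrix_poly Q" "Q p \<noteq> 0"
    "\<forall>g\<in>S. Q g \<noteq> 0 \<longrightarrow> f g = P g / Q g"
    using f p unfolding regular_on_def by blast
  have "P p \<noteq> 0" using 1(3,4) nz p by auto
  then show "\<exists>P Q. matrix_poly P \<and> matrix_poly Q \<and> Q p \<noteq> 0 \<and>
      (\<forall>x\<in>S. Q x \<noteq> 0 \<longrightarrow> inverse (f x) = P x / Q x)"
    using 1
    by (rule_tac exI[of _ "\<lambda>x. Q x * Q x"], rule_tac exI[of _ "\<lambda>x. P x * Q x"])
       (auto intro!: matrix_poly.intros)
qed

lemma regular_on_powi: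
  assumes f: "regular_on S f" and nz: "\<And>x. x \<in> S \<Longrightarrow> f x \<noteq> 0"
  shows "regular_on S (\<lambda>x. f x powi m)"
proof -
  have pow: "regular_on S (\<lambda>x. g x ^ k)" if "regular_on S g" for g k
    by (induction k) (auto intro: regular_on_const regular_on_mult that)
  show ?thesis
    using pow[OF f, of "nat m"] pow[OF regular_on_inverse[OF f nz], of "nat (- m)"]
    by (cases "0 \<le> m") (simp_all add: power_int_def power_inverse)
qed

lemma regular_on_prod:
  "(\<And>i. i \<in> A \<Longrightarrow> regular_on S (f i)) \<Longrightarrow> regular_on S (\<lambda>x. \<Prod>i\<in>A. f i x)"
  by (induction A rule: infinite_finite_induct) (auto intro: regular_on_const regular_on_mult)

lemma regular_on_cong:
  "(\<And>x. x \<in> S \<Longrightarrow> f x = g x) \<Longrightarrow> regular_on S f \<longleftrightarrow> regular_on S g"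
  unfolding regular_on_def by simp

lemma regular_on_subset: "regular_on S f \<Longrightarrow> S' \<subseteq> S \<Longrightarrow> regular_on S' f"
  proof (unfold regular_on_def, intro ballI)
  fix p assume "\<forall>p\<in>S. \<exists>P Q. matrix_poly P \<and> matrix_poly Q \<and> Q p \<noteq> 0 \<and> (\<forall>g\<in>S. Q g \<noteq> 0 \<longrightarrow> f g = P g / Q g)"
    and "S' \<subseteq> S" "p \<in> S'"
  then obtain P Q where "matrix_poly P \<and> matrix_poly Q \<and> Q p \<noteq> 0 \<and> (\<forall>g\<in>S. Q g \<noteq> 0 \<longrightarrow> f g = P g / Q g)"
    by blast
  with \<open>S' \<subseteq> S\<close> show "\<exists>P Q. matrix_poly P \<and> matrix_poly Q \<and> Q p \<noteq> 0 \<and> (\<forall>g\<in>S'. Q g \<noteq> 0 \<longrightarrow> f g = P g / Q g)"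
    by (rule_tac exI[of _ P], rule_tac exI[of _ Q]) auto
qed

lemma coordinate_ringI: "regular_on S f \<Longrightarrow> restrict f S \<in> coordinate_ring S"
  unfolding coordinate_ring_def using regular_on_cong[of S "restrict f S" f] by simp

lemma regular_on_tendsto:
  assumes f: "regular_on S f" and X: "\<And>n. X n \<in> S" "X \<longlonglongrightarrow> L" and L: "L \<in> S"
  shows "(\<lambda>n. f (X n)) \<longlonglongrightarrow> f L"
proof -
  obtain P Q where 1: "matrix_poly P" "matrix_poly Q" "Q L \<noteq> 0"
    "\<forall>g\<in>S. Q g \<noteq> 0 \<longrightarrow> f g = P g / Q g"
    using f L unfolding regular_on_def by blast
  have P: "(\<lambda>n. P (X n)) \<longlonglongrightarrow> P L" and Q: "(\<lambda>n. Q (X n)) \<longlonglongrightarrow> Q L"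
    using isCont_tendsto_compose[OF matrix_poly_continuous X(2)] 1(1,2) by blast+
  have "(\<lambda>n. P (X n) / Q (X n)) \<longlonglongrightarrow> f L"
    using tendsto_divide[OF P Q 1(3)] 1(3,4) L by simp
  moreover have "\<forall>\<^sub>F n in sequentially. P (X n) / Q (X n) = f (X n)"
    using tendsto_imp_eventually_ne[OF Q 1(3)]
    by eventually_elim (use 1(4) X(1) in auto)
  ultimately show ?thesis by (rule Lim_transform_eventually)
qed

section \<open>Integer linear systems\<close>

text \<open>Elimination without fractions: \<open>j0\<close> is the pivot of the equation k, and its
  coefficient is chosen last so as to satisfy this equation.\<close>

lemma integer_dependency:
  fixes M :: "'a \<Rightarrow> 'b \<Rightarrow> int"
  assumes "finite K" "finite J" "card K < card J"
  shows "\<exists>c. (\<exists>j\<in>J. c j \<noteq> 0) \<and> (\<forall>k\<in>K. (\<Sum>j\<in>J. c j * M j k) = 0)"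
  using assms
proof (induction K arbitrary: J M rule: finite_induct)
  case empty
  then have "J \<noteq> {}" by auto
  then show ?case by (intro exI[of _ "\<lambda>_. 1"]) auto
next
  case (insert k K)
  show ?case
  proof (cases "\<forall>j\<in>J. M j k = 0")
    case True
    then show ?thesis using insert.IH[of J M] insert.prems insert.hyps by auto
  next
    case False
    then obtain j0 where j0: "j0 \<in> J" "M j0 k \<noteq> 0" by blast
    define J' where "J' = J - {j0}"
    have J': "finite J'" "card K < card J'" "j0 \<notin> J'" "J = insert j0 J'"
      using insert.prems insert.hyps j0 by (auto simp: J'_def)
    define M' where "M' j l = M j0 k * M j l - M j k * M j0 l" for j l
    obtain c where c: "\<exists>j\<in>J'. c j \<noteq> 0" "\<And>l. l \<in> K \<Longrightarrow> (\<Sum>j\<in>J'. c j * M' j l) = 0"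
      using insert.IH[OF J'(1,2), of M'] by blast
    define e where "e j = (if j = j0 then - (\<Sum>i\<in>J'. c i * M i k) else M j0 k * c j)" for j
    have e_sum: "(\<Sum>j\<in>J. e j * M j l) =
        - (\<Sum>i\<in>J'. c i * M i k) * M j0 l + (\<Sum>j\<in>J'. M j0 k * c j * M j l)" for l
    proof -
      have "(\<Sum>j\<in>J'. e j * M j l) = (\<Sum>j\<in>J'. M j0 k * c j * M j l)"
        using J'(3) by (intro sum.cong) (auto simp: e_def)
      then show ?thesis using J'(1,3) by (simp add: J'(4) e_def)
    qed
    have "(\<Sum>j\<in>J. e j * M j k) = 0"
      unfolding e_sum by (simp add: sum_distrib_left mult_ac)
    moreover have "(\<Sum>j\<in>J. e j * M j l) = 0" if "l \<in> K" for l
      using c(2)[OF that] unfolding e_sum M'_def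
      by (simp add: algebra_simps sum_subtractf sum_distrib_left)
    moreover have "\<exists>j\<in>J. e j \<noteq> 0"
    proof -
      obtain j where "j \<in> J'" "c j \<noteq> 0" using c(1) by blast
      moreover from this have "e j = M j0 k * c j" using J'(3) by (auto simp: e_def)
      ultimately show ?thesis using j0(2) J'(4) by (intro bexI[of _ j]) auto
    qed
    ultimately show ?thesis by blast
  qed
qed

text \<open>The right-hand side is adjoined as one more vector, indexed by \<open>None\<close>. The
  trivial kernel forces every dependency to involve it, and its coefficient, up to sign, is the
  common denominator d.\<close>

lemma integer_system_solvable:
  fixes a :: "'a \<Rightarrow> 'a \<Rightarrow> int"
  assumes I: "finite I"
    and ker: "\<And>m. (\<forall>i\<in>I. (\<Sum>j\<in>I. a i j * m j) = 0) \<Longrightarrow> \<forall>j\<in>I. m j = 0"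
  shows "\<exists>d m. 0 < d \<and> (\<forall>i\<in>I. (\<Sum>j\<in>I. a i j * m j) = d * p i)"
proof -
  define M where "M x i = (case x of None \<Rightarrow> - p i | Some j \<Rightarrow> a i j)" for x i
  have "card I < card (insert None (Some ` I))"
    using I by (simp add: card_image)
  then obtain c where c: "\<exists>x\<in>insert None (Some ` I). c x \<noteq> 0"
    "\<And>i. i \<in> I \<Longrightarrow> (\<Sum>x\<in>insert None (Some ` I). c x * M x i) = 0"
    using integer_dependency[of I "insert None (Some ` I)" M] I by auto
  have sys: "(\<Sum>j\<in>I. a i j * c (Some j)) = c None * p i" if "i \<in> I" for i
    using c(2)[OF that] I by (simp add: M_def sum.reindex mult.commute)
  have "c None \<noteq> 0"
  proof
    assume "c None = 0"
    then have "\<forall>j\<in>I. c (Some j) = 0" using ker[of "\<lambda>j. c (Some j)"] sys by simp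
    then show False using c(1) \<open>c None = 0\<close> by auto
  qed
  then consider "0 < c None" | "0 < - c None" by linarith
  then show ?thesis
  proof cases
    case 1
    then show ?thesis using sys by (intro exI[of _ "c None"] exI[of _ "\<lambda>j. c (Some j)"]) auto
  next
    case 2
    then show ?thesis using sys
      by (intro exI[of _ "- c None"] exI[of _ "\<lambda>j. - c (Some j)"]) (auto simp: sum_negf)
  qed
qed

text \<open>Solving the original system for each unit vector shows that the transposed matrix has
  trivial kernel too.\<close>

lemma integer_system_solvable_transpose:
  fixes a :: "'a \<Rightarrow> 'a \<Rightarrow> int"
  assumes I: "finite I"
    and ker: "\<And>m. (\<forall>i\<in>I. (\<Sum>j\<in>I. a i j * m j) = 0) \<Longrightarrow> \<forall>j\<in>I. m j = 0"
  shows "\<exists>d m. 0 < d \<and> (\<forall>j\<in>I. (\<Sum>i\<in>I. a i j * m i) = d * p j)"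
proof (rule integer_system_solvable[OF I, where a = "\<lambda>i j. a j i"], intro ballI)
  fix l :: "'a \<Rightarrow> int" and k assume l: "\<forall>j\<in>I. (\<Sum>i\<in>I. a i j * l i) = 0" and k: "k \<in> I"
  obtain d m where d: "0 < d" "\<And>i. i \<in> I \<Longrightarrow> (\<Sum>j\<in>I. a i j * m j) = d * (if i = k then 1 else 0)"
    using integer_system_solvable[OF I ker, where p = "\<lambda>i. if i = k then 1 else 0"] by blast
  have "0 = (\<Sum>j\<in>I. (\<Sum>i\<in>I. a i j * l i) * m j)" using l by simp
  also have "\<dots> = (\<Sum>i\<in>I. l i * (\<Sum>j\<in>I. a i j * m j))"
    unfolding sum_distrib_left sum_distrib_right by (subst sum.swap) (simp add: mult_ac)
  also have "\<dots> = (\<Sum>i\<in>I. if i = k then l i * d else 0)"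
    by (intro sum.cong refl) (auto simp: d(2))
  also have "\<dots> = l k * d" using I k by simp
  finally show "l k = 0" using d(1) by simp
qed

section \<open>Torus action on nilpotent exponentials, and the group commutator to second
  order\<close>

lemma mpow_cscale: "mpow (t *\<^sub>C X) k = t ^ k *\<^sub>C mpow X k"
  by (induction k) (simp_all add: cscale_mult mult.commute)

lemma mpow_equivariant:
  assumes "h ** X = b *\<^sub>C (X ** h)"
  shows "h ** mpow X k = b ^ k *\<^sub>C (mpow X k ** h)"
proof (induction k)
  case (Suc k)
  have "h ** mpow X (Suc k) = (h ** X) ** mpow X k" by (simp add: matrix_mul_assoc)
  also have "\<dots> = b *\<^sub>C (X ** (h ** mpow X k))" by (simp add: assms cscale_mult matrix_mul_assoc)
  also have "\<dots> = b ^ Suc k *\<^sub>C (mpow X (Suc k) ** h)"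
    by (simp add: Suc cscale_mult matrix_mul_assoc)
  finally show ?case .
qed simp

lemma nil_exp_equivariant:
  assumes "h ** X = b *\<^sub>C (X ** h)"
  shows "h ** nil_exp K X t = nil_exp K X (b * t) ** h"
  unfolding nil_exp_def mat_mult_sum mat_sum_mult
  by (intro sum.cong refl) (simp add: cscale_mult mpow_equivariant[OF assms] power_mult_distrib mult.commute)

text \<open>The commutator minus the identity is (u v - v u) times the curve u(-s) v(-s), which
  starts with the identity. Since u v - v u is also the commutator of u - 1 and v - 1, it starts
  with s^2 (AB - BA).\<close>

lemma commutator_expansion:
  fixes u v :: "complex \<Rightarrow> 'm::finite cmat"
  assumes u: "poly_curve u" "u 0 = mat 1" "\<And>s. u s ** u (- s) = mat 1"
    and v: "poly_curve v" "v 0 = mat 1" "\<And>s. v s ** v (- s) = mat 1"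
    and A: "vanishes_to 2 (\<lambda>s. u s - mat 1 - s *\<^sub>C A)"
    and B: "vanishes_to 2 (\<lambda>s. v s - mat 1 - s *\<^sub>C B)"
  shows "vanishes_to 3 (\<lambda>s. u s ** v s ** u (- s) ** v (- s) - mat 1 - s\<^sup>2 *\<^sub>C (A ** B - B ** A))"
proof -
  define X where "X = A ** B - B ** A"
  have u1: "vanishes_to 1 (\<lambda>s. u s - mat 1)" and v1: "vanishes_to 1 (\<lambda>s. v s - mat 1)"
    using vanishes_to_first u v by blast+
  have product: "vanishes_to 3 (\<lambda>s. (u s - mat 1) ** (v s - mat 1) - s\<^sup>2 *\<^sub>C (A ** B))"
    if u1: "vanishes_to 1 (\<lambda>s. u s - mat 1)" and v1: "vanishes_to 1 (\<lambda>s. v s - mat 1)"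
      and A: "vanishes_to 2 (\<lambda>s. u s - mat 1 - s *\<^sub>C A)"
      and B: "vanishes_to 2 (\<lambda>s. v s - mat 1 - s *\<^sub>C B)" for u v :: "complex \<Rightarrow> 'm cmat" and A B
  proof -
    have "vanishes_to 3 (\<lambda>s. (u s - mat 1 - s *\<^sub>C A) ** (v s - mat 1)
        + (s ^ 1 *\<^sub>C A) ** (v s - mat 1 - s *\<^sub>C B))"
      using vanishes_to_mult[OF A v1] vanishes_to_mult[OF vanishes_to_power[of 1 A] B]
      by (intro vanishes_to_add) (simp_all only: numeral_2_eq_2 numeral_3_eq_3 One_nat_def add_Suc add_Suc_right add_0 add_0_right)
    moreover have "(u s - mat 1 - s *\<^sub>C A) ** (v s - mat 1) + (s ^ 1 *\<^sub>C A) ** (v s - mat 1 - s *\<^sub>C B)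
        = (u s - mat 1) ** (v s - mat 1) - s\<^sup>2 *\<^sub>C (A ** B)" for s
      by (simp add: mat_distribs power2_eq_square cscale_distrib algebra_simps)
    ultimately show ?thesis by simp
  qed
  have "vanishes_to 3 (\<lambda>s. ((u s - mat 1) ** (v s - mat 1) - s\<^sup>2 *\<^sub>C (A ** B))
      - ((v s - mat 1) ** (u s - mat 1) - s\<^sup>2 *\<^sub>C (B ** A)))"
    by (intro vanishes_to_diff product u1 v1 A B)
  then have c: "vanishes_to 3 (\<lambda>s. u s ** v s - v s ** u s - s\<^sup>2 *\<^sub>C X)"
    by (simp add: X_def mat_distribs cscale_distrib algebra_simps)
  define w where "w s = u (- s) ** v (- s)" for s
  have w: "poly_curve w" unfolding w_def
    by (rule poly_curve_mult vanishes_to_neg_arg[OF u(1)] vanishes_to_neg_arg[OF v(1)])+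
  have w1: "vanishes_to 1 (\<lambda>s. w s - mat 1)"
    by (rule vanishes_to_first[OF w]) (simp add: w_def u v)
  have vuw: "v s ** (u s ** w s) = mat 1" for s
    by (simp add: w_def mat_cancel_left[OF u(3)] v(3))
  have "vanishes_to 3 (\<lambda>s. (u s ** v s - v s ** u s - s\<^sup>2 *\<^sub>C X) ** w s + (s\<^sup>2 *\<^sub>C X) ** (w s - mat 1))"
    using vanishes_to_mult[OF c w] vanishes_to_mult[OF vanishes_to_power[of 2 X] w1]
    by (intro vanishes_to_add) simp_all
  then have "vanishes_to 3 (\<lambda>s. u s ** v s ** w s - mat 1 - s\<^sup>2 *\<^sub>C X)"
    by (simp add: mat_distribs vuw matrix_mul_assoc[symmetric] cscale_distrib algebra_simps)
  then show ?thesis by (simp add: w_def X_def matrix_mul_assoc)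
qed

section \<open>Simply connected semisimple groups\<close>

lemma mat2_mult: "mat2 a b c d ** mat2 a' b' c' d' =
    mat2 (a * a' + b * c') (a * b' + b * d') (c * a' + d * c') (c * b' + d * d')"
  by (simp add: mat2_def matrix_matrix_mult_def vec_eq_iff forall_2 sum_2)

lemma mat2_SL2: "mat2 a b c d \<in> SL2 \<longleftrightarrow> a * d - b * c = 1"
  by (simp add: mat2_def SL2_def det_2)

locale pinned =
  fixes D :: "('m::finite) pinned_group"
  assumes D: "simply_connected_semisimple D"
begin

abbreviation "\<alpha> \<equiv> simple_root D"

lemma lag_grp: "linear_algebraic_group (grp D)"
  using D unfolding simply_connected_semisimple_def semisimple_group_def by simp

lemma torus_algebraic: "algebraic_torus (torus D)"
  using D unfolding simply_connected_semisimple_def maximal_torus_def by simp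

lemma lag_torus: "linear_algebraic_group (torus D)"
  using torus_algebraic unfolding algebraic_torus_def by blast

lemmas grp_one = linear_algebraic_groupD(1)[OF lag_grp]
  and grp_mult = linear_algebraic_groupD(2)[OF lag_grp]
  and grp_inv = linear_algebraic_groupD(3)[OF lag_grp]
  and grp_invertible = linear_algebraic_groupD(4)[OF lag_grp]
  and torus_one = linear_algebraic_groupD(1)[OF lag_torus]
  and torus_mult = linear_algebraic_groupD(2)[OF lag_torus]
  and torus_inv = linear_algebraic_groupD(3)[OF lag_torus]
  and torus_invertible = linear_algebraic_groupD(4)[OF lag_torus]

lemma torus_diagonal:
  obtains P P' :: "'m cmat" where "P ** P' = mat 1" "P' ** P = mat 1"
    "\<And>h r s. h \<in> torus D \<Longrightarrow> r \<noteq> s \<Longrightarrow> (P ** h ** P') $ r $ s = 0"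
proof -
  have "\<exists>P :: 'm cmat. invertible P \<and> (\<forall>h\<in>torus D. \<forall>r s. r \<noteq> s \<longrightarrow> (P ** h ** matrix_inv P) $ r $ s = 0)"
    using torus_algebraic by (simp only: algebraic_torus_def)
  then obtain P :: "'m cmat" where P: "invertible P"
    "\<forall>h\<in>torus D. \<forall>r s. r \<noteq> s \<longrightarrow> (P ** h ** matrix_inv P) $ r $ s = 0" by (elim exE conjE)
  show ?thesis by (rule that[OF matrix_inv[OF P(1)]]) (simp add: P(2))
qed

lemma root_base: "is_root_base (grp D) (torus D) (index_set D) \<alpha>"
  using D unfolding simply_connected_semisimple_def by simp

lemma emb_facts:
  assumes "i \<in> index_set D"
  shows "\<And>g h. g \<in> SL2 \<Longrightarrow> h \<in> SL2 \<Longrightarrow> emb D i (g ** h) = emb D i g ** emb D i h"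
    "\<And>g. g \<in> SL2 \<Longrightarrow> emb D i g \<in> grp D"
    "\<And>t. t \<noteq> 0 \<Longrightarrow> coroot D i t \<in> torus D"
    "root_subgroup (grp D) (torus D) (\<alpha> i) (x_pos D i)"
    "root_subgroup (grp D) (torus D) (\<lambda>h. inverse (\<alpha> i h)) (x_neg D i)"
proof -
  have all: "(\<forall>g\<in>SL2. \<forall>h\<in>SL2. emb D i (g ** h) = emb D i g ** emb D i h) \<and>
        emb D i ` SL2 \<subseteq> grp D \<and> (\<forall>t. t \<noteq> 0 \<longrightarrow> coroot D i t \<in> torus D) \<and>
        root_subgroup (grp D) (torus D) (\<alpha> i) (x_pos D i) \<and>
        root_subgroup (grp D) (torus D) (\<lambda>h. inverse (\<alpha> i h)) (x_neg D i)"
    using D assms unfolding simply_connected_semisimple_def by simp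
  show "emb D i (g ** h) = emb D i g ** emb D i h" if "g \<in> SL2" "h \<in> SL2" for g h
    using all that by simp
  show "emb D i g \<in> grp D" if "g \<in> SL2" for g using all that by auto
  show "coroot D i t \<in> torus D" if "t \<noteq> 0" for t using all that by simp
  show "root_subgroup (grp D) (torus D) (\<alpha> i) (x_pos D i)"
    "root_subgroup (grp D) (torus D) (\<lambda>h. inverse (\<alpha> i h)) (x_neg D i)" using all by simp_all
qed

lemma root_coroot:
  "i \<in> index_set D \<Longrightarrow> j \<in> index_set D \<Longrightarrow> t \<noteq> 0 \<Longrightarrow> \<alpha> j (coroot D i t) = t powi cartan D i j"
  using D unfolding simply_connected_semisimple_def by simp

lemma character_unique:
  "\<exists>!\<xi>. \<xi> \<in> characters (torus D) \<and>
     (\<forall>i\<in>index_set D. \<forall>t. t \<noteq> 0 \<longrightarrow> \<xi> (coroot D i t) = t powi \<gamma> i)"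
  using D unfolding simply_connected_semisimple_def by simp

lemma simple_root_character: "i \<in> index_set D \<Longrightarrow> \<alpha> i \<in> characters (torus D)"
  using root_base unfolding is_root_base_def roots_def by blast

lemma simple_roots_independent:
  "(\<And>h. h \<in> torus D \<Longrightarrow> (\<Prod>i\<in>index_set D. \<alpha> i h powi m i) = 1) \<Longrightarrow> i \<in> index_set D \<Longrightarrow> m i = 0"
  using root_base unfolding is_root_base_def by blast

lemma simple_root_nz: "i \<in> index_set D \<Longrightarrow> h \<in> torus D \<Longrightarrow> \<alpha> i h \<noteq> 0"
  and simple_root_mult: "i \<in> index_set D \<Longrightarrow> g \<in> torus D \<Longrightarrow> h \<in> torus D \<Longrightarrow> \<alpha> i (g ** h) = \<alpha> i g * \<alpha> i h"
  using simple_root_character[of i] by (simp_all add: characters_def)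

lemma simple_root_one: "i \<in> index_set D \<Longrightarrow> \<alpha> i (mat 1) = 1"
  using simple_root_mult[of i "mat 1" "mat 1"] simple_root_nz[of i "mat 1"] torus_one by simp

lemma root_monomial_character:
  "restrict (\<lambda>h. \<Prod>i\<in>index_set D. \<alpha> i h powi m i) (torus D) \<in> characters (torus D)"
proof -
  have "regular_on (torus D) (\<alpha> i)" if "i \<in> index_set D" for i
    using simple_root_character[OF that] unfolding characters_def coordinate_ring_def by blast
  then have "restrict (\<lambda>h. \<Prod>i\<in>index_set D. \<alpha> i h powi m i) (torus D) \<in> coordinate_ring (torus D)"
    by (intro coordinate_ringI regular_on_prod regular_on_powi) (auto simp: simple_root_nz)
  then show ?thesis
    unfolding characters_def
    by (auto simp: simple_root_nz torus_mult simple_root_mult power_int_mult_distrib prod.distrib)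
qed

text \<open>A kernel vector gives a product of powers of simple roots that is 1 on all coroots. A
  character is determined by its values on the coroots, by simple connectedness, so the product is
  trivial, and the simple roots are independent.\<close>

lemma cartan_nonsingular:
  assumes "\<And>i. i \<in> index_set D \<Longrightarrow> (\<Sum>j\<in>index_set D. cartan D i j * m j) = 0" and j: "j \<in> index_set D"
  shows "m j = 0"
proof -
  let ?\<xi> = "restrict (\<lambda>h. \<Prod>i\<in>index_set D. \<alpha> i h powi m i) (torus D)"
  let ?one = "restrict (\<lambda>h. \<Prod>i\<in>index_set D. \<alpha> i h powi 0) (torus D)"
  have "?\<xi> (coroot D i t) = t powi 0" if i: "i \<in> index_set D" and t: "t \<noteq> 0" for i t
  proof -
    have "?\<xi> (coroot D i t) = (\<Prod>j\<in>index_set D. t powi (cartan D i j * m j))"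
      using emb_facts(3)[OF i t] root_coroot[OF i _ t]
      by (simp only: restrict_apply if_True power_int_mult cong: prod.cong)
    also have "\<dots> = t powi (\<Sum>j\<in>index_set D. cartan D i j * m j)"
      using t by (induction rule: finite_induct[OF finite_atLeastAtMost[of 1 "rk D"]])
        (simp_all add: power_int_add)
    finally show ?thesis using assms(1)[OF i] by simp
  qed
  moreover have "?one (coroot D i t) = t powi 0" if "i \<in> index_set D" "t \<noteq> 0" for i t
    using emb_facts(3)[OF that] by simp
  ultimately have eq: "?\<xi> = ?one"
    using character_unique[of "\<lambda>_. 0"] root_monomial_character[of m] root_monomial_character[of "\<lambda>_. 0"]
    by blast
  have "(\<Prod>i\<in>index_set D. \<alpha> i h powi m i) = 1" if "h \<in> torus D" for h
    using fun_cong[OF eq, of h] that by (simp only: restrict_apply if_True) simp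
  then show ?thesis using simple_roots_independent j by blast
qed

lemma torus_product:
  assumes "finite A" "A \<subseteq> index_set D"
  shows "\<exists>h\<in>torus D. \<forall>j\<in>index_set D. \<alpha> j h = (\<Prod>i\<in>A. 2 powi (cartan D i j * m i))"
  using assms
proof (induction A rule: finite_induct)
  case empty
  show ?case using torus_one simple_root_one by (intro bexI[of _ "mat 1"]) auto
next
  case (insert i A)
  then obtain h where h: "h \<in> torus D" "\<And>j. j \<in> index_set D \<Longrightarrow> \<alpha> j h = (\<Prod>i\<in>A. 2 powi (cartan D i j * m i))"
    by auto
  have i: "i \<in> index_set D" and nz: "(2::complex) powi m i \<noteq> 0" using insert.prems by auto
  have "\<alpha> j (coroot D i (2 powi m i) ** h) = (\<Prod>i\<in>insert i A. 2 powi (cartan D i j * m i))"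
    if "j \<in> index_set D" for j
    using that insert.hyps h i
    by (simp add: simple_root_mult emb_facts(3)[OF i nz] root_coroot[OF i that nz] mult.commute
        flip: power_int_mult)
  then show ?case using torus_mult[OF emb_facts(3)[OF i nz] h(1)] by blast
qed

text \<open>Products of coroot values pair with the simple roots through the Cartan matrix, which in
  general is invertible only over the rationals; hence the factor d. As d is positive, the signs and
  zeros of p are preserved, and later arguments use nothing else.\<close>

lemma torus_scaling:
  "\<exists>h\<in>torus D. \<exists>d>0. \<forall>j\<in>index_set D. \<alpha> j h = 2 powi (d * p j)"
proof -
  obtain d m where d: "0 < d" "\<And>j. j \<in> index_set D \<Longrightarrow> (\<Sum>i\<in>index_set D. cartan D i j * m i) = d * p j"
    using integer_system_solvable_transpose[where I="index_set D" and a="cartan D" and p=p]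
      cartan_nonsingular by blast
  obtain h where h: "h \<in> torus D"
    "\<And>j. j \<in> index_set D \<Longrightarrow> \<alpha> j h = (\<Prod>i\<in>index_set D. 2 powi (cartan D i j * m i))"
    using torus_product[of "index_set D" m] by auto
  have "(\<Prod>i\<in>A. 2 powi f i) = (2::complex) powi (\<Sum>i\<in>A. f i)" for f :: "nat \<Rightarrow> int" and A
    by (induction A rule: infinite_finite_induct) (simp_all add: power_int_add)
  then show ?thesis using h d by metis
qed

lemma root_subgroupD:
  assumes "root_subgroup (grp D) (torus D) \<beta> u"
  shows "poly_curve u" "\<And>s t. u (s + t) = u s ** u t" "u 0 = mat 1" "\<And>s. u s ** u (- s) = mat 1"
    "\<And>t. u t \<in> grp D" "\<And>h t. h \<in> torus D \<Longrightarrow> h ** u t = u (\<beta> h * t) ** h"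
proof -
  show "poly_curve u" using assms by (simp add: root_subgroup_def vanishes_to_def)
  show add: "u (s + t) = u s ** u t" for s t using assms by (simp add: root_subgroup_def)
  show mem: "u t \<in> grp D" for t using assms by (auto simp: root_subgroup_def)
  have inv: "u 0 ** matrix_inv (u 0) = mat 1" by (rule matrix_inv(1)[OF grp_invertible[OF mem]])
  have "u 0 ** u 0 = u 0" using add[of 0 0] by simp
  then have "u 0 ** (u 0 ** matrix_inv (u 0)) = u 0 ** matrix_inv (u 0)"
    by (simp add: matrix_mul_assoc)
  then show one: "u 0 = mat 1" by (simp add: inv)
  show "u s ** u (- s) = mat 1" for s using add[of s "- s"] one by simp
  fix h t assume h: "h \<in> torus D"
  then have "h ** u t ** matrix_inv h = u (\<beta> h * t)"
    using assms by (simp add: root_subgroup_def)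
  then have "h ** u t ** (matrix_inv h ** h) = u (\<beta> h * t) ** h" by (simp add: matrix_mul_assoc)
  then show "h ** u t = u (\<beta> h * t) ** h" using matrix_inv(2)[OF torus_invertible[OF h]] by simp
qed

text \<open>If the commutator \<open>X\<close> of the two tangent vectors were nonzero, the one-parameter group
  of \<open>X\<close>, a limit of iterated group commutators, would exhibit \<open>\<alpha>\<^sub>i - \<alpha>\<^sub>j\<close> as a root.\<close>

lemma pos_neg_commute:
  assumes i: "i \<in> index_set D" and j: "j \<in> index_set D" and ij: "i \<noteq> j"
  shows "x_pos D i s ** x_neg D j t = x_neg D j t ** x_pos D i s"
proof -
  note u = root_subgroupD[OF emb_facts(4)[OF i]]
  note v = root_subgroupD[OF emb_facts(5)[OF j]]
  obtain A where A: "vanishes_to 2 (\<lambda>s. x_pos D i s - mat 1 - s *\<^sub>C A)"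
    using vanishes_to_leading[OF vanishes_to_first[OF u(1,3)]] by (auto simp: numeral_2_eq_2)
  obtain B where B: "vanishes_to 2 (\<lambda>s. x_neg D j s - mat 1 - s *\<^sub>C B)"
    using vanishes_to_leading[OF vanishes_to_first[OF v(1,3)]] by (auto simp: numeral_2_eq_2)
  define X where "X = A ** B - B ** A"
  have "X = 0"
  proof (rule ccontr)
    assume X0: "X \<noteq> 0"
    define e where "e k = (if k = i then 1 else if k = j then - 1 else 0 :: int)" for k
    define \<beta> where "\<beta> = restrict (\<lambda>h. \<Prod>k\<in>index_set D. \<alpha> k h powi e k) (torus D)"
    have \<beta>: "\<beta> h = \<alpha> i h * inverse (\<alpha> j h)" if "h \<in> torus D" for h
    proof -
      have "\<beta> h = (\<Prod>k\<in>index_set D. \<alpha> k h powi e k)" using that by (simp add: \<beta>_def)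
      also have "\<dots> = (\<Prod>k\<in>{i, j}. \<alpha> k h powi e k)"
        using i j by (intro prod.mono_neutral_right) (auto simp: e_def)
      finally show ?thesis using ij by (simp add: e_def power_int_minus)
    qed
    have equi: "h ** X = \<beta> h *\<^sub>C (X ** h)" if h: "h \<in> torus D" for h
    proof -
      have hA: "h ** A = \<alpha> i h *\<^sub>C (A ** h)"
        by (rule one_parameter_equivariant_leading[OF A]) (rule u(6)[OF h])
      have hB: "h ** B = inverse (\<alpha> j h) *\<^sub>C (B ** h)"
        by (rule one_parameter_equivariant_leading[OF B]) (rule v(6)[OF h])
      have "h ** (A ** B) = \<beta> h *\<^sub>C (A ** B ** h)" "h ** (B ** A) = \<beta> h *\<^sub>C (B ** A ** h)"
        by (simp_all add: matrix_mul_assoc hA hB cscale_mult \<beta>[OF h])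
           (simp_all add: matrix_mul_assoc[symmetric] hA hB cscale_mult mult.commute)
      then show ?thesis by (simp add: X_def mat_distribs cscale_distrib)
    qed
    \<comment> \<open>This element scales the root i and fixes the root j, so
      \<open>\<beta> h0\<close> has modulus greater than 1.\<close>
    obtain h0 d where h0: "h0 \<in> torus D" "0 < d"
      "\<And>k. k \<in> index_set D \<Longrightarrow> \<alpha> k h0 = 2 powi (d * (if k = i then 1 else 0))"
      using torus_scaling[of "\<lambda>k. if k = i then 1 else 0"] by blast
    have \<beta>h0: "\<beta> h0 = 2 powi d" using h0 i j ij by (simp add: \<beta>)
    have big: "1 < cmod (\<beta> h0)"
      using h0(2) by (simp add: \<beta>h0 norm_power_int one_less_power_int)
    obtain P P' :: "'m cmat" where P: "P ** P' = mat 1" "P' ** P = mat 1"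
      "\<And>h r s. h \<in> torus D \<Longrightarrow> r \<noteq> s \<Longrightarrow> (P ** h ** P') $ r $ s = 0"
      using torus_diagonal by metis
    obtain K where K: "2 \<le> K"
      "\<And>f t. vanishes_to K f \<Longrightarrow> (\<And>t. h0 ** f t = f (\<beta> h0 * t) ** h0) \<Longrightarrow> f t = 0"
      using homogeneous_vanishes[OF P(1,2) matrix_inv(1)[OF torus_invertible[OF h0(1)]] P(3)[OF h0(1)] big]
      by metis
    \<comment> \<open>The curve t^K X^K is homogeneous and vanishes to order K, so it is 0; thus X
      is nilpotent.\<close>
    have "(1::complex) ^ K *\<^sub>C mpow X K = 0"
      by (rule K(2)[of "\<lambda>t. t ^ K *\<^sub>C mpow X K"])
         (simp_all add: vanishes_to_power cscale_mult mpow_equivariant[OF equi[OF h0(1)]]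
           power_mult_distrib mult.commute)
    then have nil: "mpow X K = 0" by simp
    have mem: "nil_exp K X t \<in> grp D" for t
    proof (rule linear_algebraic_group_limit[OF lag_grp])
      \<comment> \<open>Only the positive root subgroup gets the factor t, so the bracket of the
        tangent vectors is tX, and the limit of the iterated commutators is the exponential of
        tX.\<close>
      define C where "C s = x_pos D i (t * s) ** x_neg D j s ** x_pos D i (t * - s) ** x_neg D j (- s)" for s
      show "mpow (C (1 / of_nat (Suc n))) ((Suc n)\<^sup>2) \<in> grp D" for n
      proof -
        have "C s \<in> grp D" for s unfolding C_def by (intro grp_mult u(5) v(5))
        then have "mpow (C s) k \<in> grp D" for s k by (induction k) (auto intro: grp_one grp_mult)
        then show ?thesis .
      qed
      have "vanishes_to 2 (\<lambda>s. x_pos D i (t * s) - mat 1 - s *\<^sub>C (t *\<^sub>C A))"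
        using vanishes_to_scale_arg[OF A, of t] by (simp add: mult.commute)
      then have "vanishes_to 3 (\<lambda>s. C s - mat 1 - s\<^sup>2 *\<^sub>C ((t *\<^sub>C A) ** B - B ** (t *\<^sub>C A)))"
        unfolding C_def using vanishes_to_scale_arg[OF u(1), of t] u(3,4) v(1,3,4) B
        by (intro commutator_expansion[where u="\<lambda>s. x_pos D i (t * s)"]) simp_all
      then have "vanishes_to 3 (\<lambda>s. C s - mat 1 - s\<^sup>2 *\<^sub>C (t *\<^sub>C X))"
        by (simp add: X_def cscale_mult cscale_distrib)
      from iterate_tendsto_nil_exp[OF this _ K(1)] nil
      have "(\<lambda>n. mpow (C (1 / of_nat (Suc n))) ((Suc n)\<^sup>2)) \<longlonglongrightarrow> nil_exp K (t *\<^sub>C X) 1"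
        by (simp add: mpow_cscale)
      moreover have "nil_exp K (t *\<^sub>C X) 1 = nil_exp K X t"
        by (simp add: nil_exp_def mpow_cscale)
      ultimately show "(\<lambda>n. mpow (C (1 / of_nat (Suc n))) ((Suc n)\<^sup>2)) \<longlonglongrightarrow> nil_exp K X t"
        by simp
      show "invertible (nil_exp K X t)"
        using nil_exp_add[OF nil, of t "- t"] nil_exp_add[OF nil, of "- t" t] nil_exp_0[OF K(1), of X]
        unfolding invertible_def by (intro exI[of _ "nil_exp K X (- t)"]) simp
    qed
    have "root_subgroup (grp D) (torus D) \<beta> (nil_exp K X)"
      unfolding root_subgroup_def
    proof (intro conjI ballI allI)
      show "inj (nil_exp K X)" by (rule nil_exp_inj[OF nil K(1) X0])
      show "range (nil_exp K X) \<subseteq> grp D" using mem by blast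
      show "nil_exp K X (s + t) = nil_exp K X s ** nil_exp K X t" for s t by (rule nil_exp_add[OF nil])
      show "\<exists>p. \<forall>t. nil_exp K X t $ r $ s = poly p t" for r s
        using poly_curve_nil_exp[of K X] unfolding vanishes_to_def power_0 mult_1 by blast
      fix h t assume h: "h \<in> torus D"
      show "h ** nil_exp K X t ** matrix_inv h = nil_exp K X (\<beta> h * t)"
        unfolding nil_exp_equivariant[OF equi[OF h]]
        by (simp add: matrix_mul_assoc[symmetric] matrix_inv[OF torus_invertible[OF h]])
    qed
    moreover have "\<beta> \<in> characters (torus D)"
      unfolding \<beta>_def by (rule root_monomial_character)
    moreover have "\<exists>h\<in>torus D. \<beta> h \<noteq> 1" using h0(1) big by force
    ultimately have "\<beta> \<in> roots (grp D) (torus D)" unfolding roots_def by blast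
    then have "\<exists>m :: nat \<Rightarrow> int. ((\<forall>k\<in>index_set D. 0 \<le> m k) \<or> (\<forall>k\<in>index_set D. m k \<le> 0)) \<and>
        (\<forall>h\<in>torus D. \<beta> h = (\<Prod>k\<in>index_set D. \<alpha> k h powi m k))"
      using root_base by (simp only: is_root_base_def)
    then obtain m :: "nat \<Rightarrow> int" where m: "(\<forall>k\<in>index_set D. 0 \<le> m k) \<or> (\<forall>k\<in>index_set D. m k \<le> 0)"
      and m\<beta>: "\<forall>h\<in>torus D. \<beta> h = (\<Prod>k\<in>index_set D. \<alpha> k h powi m k)" by (elim exE conjE)
    \<comment> \<open>By independence the exponents of \<open>\<beta>\<close> are unique: 1 at i and
      -1 at j. These have opposite signs, against the definition of a root base.\<close>
    have "m k - e k = 0" if "k \<in> index_set D" for k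
    proof (rule simple_roots_independent[of "\<lambda>k. m k - e k", OF _ that])
      fix h assume h: "h \<in> torus D"
      have "(\<Prod>k\<in>index_set D. \<alpha> k h powi (m k - e k)) =
          (\<Prod>k\<in>index_set D. \<alpha> k h powi m k) / (\<Prod>k\<in>index_set D. \<alpha> k h powi e k)"
        unfolding prod_dividef[symmetric] using simple_root_nz h
        by (intro prod.cong refl power_int_diff) auto
      also have "\<dots> = \<beta> h / \<beta> h" using m\<beta> h by (simp add: \<beta>_def)
      also have "\<beta> h \<noteq> 0" using \<beta>[OF h] simple_root_nz h i j by simp
      then have "\<beta> h / \<beta> h = 1" by simp
      finally show "(\<Prod>k\<in>index_set D. \<alpha> k h powi (m k - e k)) = 1" .
    qed
    from this[OF i] this[OF j] have "m i = 1" "m j = - 1" using ij by (auto simp: e_def)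
    then show False using m i j by force
  qed
  then have AB: "A ** B = B ** A" by (simp add: X_def)
  have "x_neg D j t ** A = A ** x_neg D j t"
    by (rule one_parameter_commute[OF v(1-3) B]) (simp add: AB)
  then show ?thesis
    by (intro one_parameter_commute[OF u(1-3) A]) simp
qed

end

section \<open>Groups generated by root subgroups\<close>

text \<open>Words grown by one left factor at a time, which gives a convenient induction. If
  \<open>u i (- t)\<close> inverts \<open>u i t\<close>, this monoid is the generated group, see
  \<open>generate_eq_gen\<close>.\<close>

inductive_set gen :: "(nat \<Rightarrow> complex \<Rightarrow> 'm::finite cmat) \<Rightarrow> nat set \<Rightarrow> 'm cmat set"
  for u :: "nat \<Rightarrow> complex \<Rightarrow> 'm::finite cmat" and J :: "nat set" where
  gen_one: "mat 1 \<in> gen u J"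
| gen_step: "i \<in> J \<Longrightarrow> g \<in> gen u J \<Longrightarrow> u i t ** g \<in> gen u J"

lemma gen_base: "i \<in> J \<Longrightarrow> u i t \<in> gen u J"
  using gen_step[OF _ gen_one, of i J u t] by simp

lemma gen_mult: "g \<in> gen u J \<Longrightarrow> h \<in> gen u J \<Longrightarrow> g ** h \<in> gen u J"
  by (induction rule: gen.induct) (simp_all add: gen_step matrix_mul_assoc[symmetric])

lemma gen_mono: "g \<in> gen u J \<Longrightarrow> J \<subseteq> J' \<Longrightarrow> g \<in> gen u J'"
  by (induction rule: gen.induct) (auto intro: gen_one gen_step)

lemma gen_inverse:
  assumes "\<And>i t. i \<in> J \<Longrightarrow> u i t ** u i (- t) = mat 1" "g \<in> gen u J"
  shows "\<exists>g'\<in>gen u J. g ** g' = mat 1"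
  using assms(2)
proof (induction rule: gen.induct)
  case gen_one
  show ?case by (intro bexI[of _ "mat 1"] gen.gen_one) simp
next
  case (gen_step i g t)
  then obtain g' where g': "g' \<in> gen u J" "g ** g' = mat 1" by blast
  have "u i t ** g ** (g' ** u i (- t)) = u i t ** ((g ** g') ** u i (- t))"
    by (simp only: matrix_mul_assoc)
  also have "\<dots> = mat 1" using assms(1)[OF gen_step(1)] g'(2) by simp
  finally show ?case
    using gen_mult[OF g'(1) gen_base[of i J u "- t", OF gen_step(1)]] by blast
qed

lemma mat_prod_simps [simp]: "mat_prod [] = mat 1" "mat_prod (g # gs) = g ** mat_prod gs"
  "mat_prod (gs @ hs) = mat_prod gs ** mat_prod hs"
proof -
  show "mat_prod [] = mat 1" and c: "mat_prod (g # gs) = g ** mat_prod gs" for g gs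
    by (simp_all add: mat_prod_def)
  show "mat_prod (gs @ hs) = mat_prod gs ** mat_prod hs"
    by (induction gs) (simp_all add: c mat_prod_def[of "[]"] matrix_mul_assoc)
qed

lemma mat_rewrite: "a ** b = c \<Longrightarrow> (x :: 'm::finite cmat) ** a ** b = x ** c"
  by (simp add: matrix_mul_assoc[symmetric])

text \<open>\<open>E i a b c d\<close> stands for \<open>\<phi>\<^sub>i\<close> of the matrix with rows \<open>(a, b)\<close> and \<open>(c, d)\<close>. The
  assumptions are invariant under exchanging the two Borel subgroups.\<close>

locale chevalley =
  fixes I :: "nat set" and E :: "nat \<Rightarrow> complex \<Rightarrow> complex \<Rightarrow> complex \<Rightarrow> complex \<Rightarrow> 'm::finite cmat"
    and T :: "'m cmat set" and \<alpha> :: "nat \<Rightarrow> 'm cmat \<Rightarrow> complex" and P P' :: "'m cmat"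
  assumes E_mult: "i \<in> I \<Longrightarrow> a * d - b * c = 1 \<Longrightarrow> a' * d' - b' * c' = 1 \<Longrightarrow>
      E i a b c d ** E i a' b' c' d' =
      E i (a * a' + b * c') (a * b' + b * d') (c * a' + d * c') (c * b' + d * d')"
    and E_one: "i \<in> I \<Longrightarrow> E i 1 0 0 1 = mat 1"
    and E_poly: "i \<in> I \<Longrightarrow> poly_curve (\<lambda>t. E i 1 t 0 1)" "i \<in> I \<Longrightarrow> poly_curve (\<lambda>t. E i 1 0 t 1)"
    and T_one: "mat 1 \<in> T"
    and T_mult: "g \<in> T \<Longrightarrow> h \<in> T \<Longrightarrow> g ** h \<in> T"
    and T_inverse: "h \<in> T \<Longrightarrow> \<exists>h'\<in>T. h ** h' = mat 1 \<and> h' ** h = mat 1"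
    and PP': "P ** P' = mat 1" "P' ** P = mat 1"
    and T_diagonal: "h \<in> T \<Longrightarrow> r \<noteq> s \<Longrightarrow> (P ** h ** P') $ r $ s = 0"
    and k_in_T: "i \<in> I \<Longrightarrow> t \<noteq> 0 \<Longrightarrow> E i t 0 0 (1 / t) \<in> T"
    and \<alpha>_nz: "i \<in> I \<Longrightarrow> h \<in> T \<Longrightarrow> \<alpha> i h \<noteq> 0"
    and T_conj_pos: "i \<in> I \<Longrightarrow> h \<in> T \<Longrightarrow> h ** E i 1 t 0 1 = E i 1 (\<alpha> i h * t) 0 1 ** h"
    and T_conj_neg: "i \<in> I \<Longrightarrow> h \<in> T \<Longrightarrow> h ** E i 1 0 t 1 = E i 1 0 (inverse (\<alpha> i h) * t) 1 ** h"
    and T_scaling: "\<exists>h\<in>T. \<exists>d>0. \<forall>j\<in>I. \<alpha> j h = 2 powi (d * p j)"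
    and pos_neg_comm: "i \<in> I \<Longrightarrow> j \<in> I \<Longrightarrow> i \<noteq> j \<Longrightarrow>
      E i 1 x 0 1 ** E j 1 0 y 1 = E j 1 0 y 1 ** E i 1 x 0 1"
begin

abbreviation "e i t \<equiv> E i 1 t 0 1"
abbreviation "f i t \<equiv> E i 1 0 t 1"
abbreviation "k i t \<equiv> E i t 0 0 (1 / t)"
abbreviation "s i \<equiv> E i 0 (- 1) 1 0"
abbreviation "s' i \<equiv> E i 0 1 (- 1) 0"

text \<open>Conjugation by the permutation matrix of size 2 is an automorphism of SL2 that maps rows
  (a, b), (c, d) to (d, c), (b, a). It exchanges e with f and s with s' and inverts the roots, so
  each result about N also holds for the opposite group.\<close>

lemma opposite: "chevalley I (\<lambda>i a b c d. E i d c b a) T (\<lambda>i h. inverse (\<alpha> i h)) P P'"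
proof
  show "E i d c b a ** E i d' c' b' a' =
      E i (c * b' + d * d') (c * a' + d * c') (a * b' + b * d') (a * a' + b * c')"
    if "i \<in> I" "a * d - b * c = 1" "a' * d' - b' * c' = 1" for i a b c d a' b' c' d'
    using E_mult[of i d a c b d' a' c' b'] that by (simp add: algebra_simps)
  show "E i (1 / t) 0 0 t \<in> T" if "i \<in> I" "t \<noteq> 0" for i t
    using k_in_T[of i "1 / t"] that by simp
  show "\<exists>h\<in>T. \<exists>d>0. \<forall>j\<in>I. inverse (\<alpha> j h) = 2 powi (d * p j)" for p
    using T_scaling[of "\<lambda>j. - p j"] by (simp add: power_int_minus)
      (metis inverse_inverse_eq)
  show "E i 1 0 s 1 ** E j 1 t 0 1 = E j 1 t 0 1 ** E i 1 0 s 1"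
    if "i \<in> I" "j \<in> I" "i \<noteq> j" for i j s t
    using pos_neg_comm[of j i t s] that by simp
qed (auto simp: E_one E_poly T_one T_mult T_inverse PP' T_diagonal \<alpha>_nz T_conj_pos T_conj_neg)

text \<open>The entries of the product become separate equations, so that a factorization in SL2 can
  be checked against any desired form of the result.\<close>

lemma E_mult_eq:
  "i \<in> I \<Longrightarrow> a * d - b * c = 1 \<Longrightarrow> a' * d' - b' * c' = 1 \<Longrightarrow>
   a * a' + b * c' = p \<Longrightarrow> a * b' + b * d' = q \<Longrightarrow> c * a' + d * c' = r \<Longrightarrow> c * b' + d * d' = u \<Longrightarrow>
   E i a b c d ** E i a' b' c' d' = E i p q r u"
  by (simp only: E_mult)

lemma E_mult3_eq:
  assumes i: "i \<in> I" and det: "a * d - b * c = 1" "a' * d' - b' * c' = 1" "a'' * d'' - b'' * c'' = 1"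
    and "(a * a' + b * c') * a'' + (a * b' + b * d') * c'' = p"
    "(a * a' + b * c') * b'' + (a * b' + b * d') * d'' = q"
    "(c * a' + d * c') * a'' + (c * b' + d * d') * c'' = r"
    "(c * a' + d * c') * b'' + (c * b' + d * d') * d'' = u"
  shows "E i a b c d ** E i a' b' c' d' ** E i a'' b'' c'' d'' = E i p q r u"
proof -
  have "(a * a' + b * c') * (c * b' + d * d') - (a * b' + b * d') * (c * a' + d * c')
      = (a * d - b * c) * (a' * d' - b' * c')" by (simp add: algebra_simps)
  also have "\<dots> = 1" unfolding det by simp
  finally show ?thesis
    unfolding E_mult[OF i det(1,2)] by (intro E_mult_eq i det(3) assms(5-))
qed

lemma E_inverse:
  assumes "i \<in> I" "a * d - b * c = 1"
  shows "E i a b c d ** E i d (- b) (- c) a = mat 1"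
proof -
  have "E i a b c d ** E i d (- b) (- c) a = E i 1 0 0 1"
    using assms(2) by (intro E_mult_eq assms) (simp_all add: mult.commute)
  then show ?thesis using E_one assms(1) by simp
qed

lemma e_add: "i \<in> I \<Longrightarrow> e i (x + y) = e i x ** e i y"
  by (rule E_mult_eq[symmetric]) simp_all

lemma f_add: "i \<in> I \<Longrightarrow> f i (x + y) = f i x ** f i y"
  by (rule E_mult_eq[symmetric]) simp_all

lemma e_inverse: "i \<in> I \<Longrightarrow> e i x ** e i (- x) = mat 1" "i \<in> I \<Longrightarrow> e i (- x) ** e i x = mat 1"
  and f_inverse: "i \<in> I \<Longrightarrow> f i x ** f i (- x) = mat 1" "i \<in> I \<Longrightarrow> f i (- x) ** f i x = mat 1"
  and s_inverse: "i \<in> I \<Longrightarrow> s i ** s' i = mat 1" "i \<in> I \<Longrightarrow> s' i ** s i = mat 1"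
  and k_inverse: "i \<in> I \<Longrightarrow> t \<noteq> 0 \<Longrightarrow> k i t ** E i (1 / t) 0 0 t = mat 1"
    "i \<in> I \<Longrightarrow> t \<noteq> 0 \<Longrightarrow> E i (1 / t) 0 0 t ** k i t = mat 1"
proof -
  assume i: "i \<in> I"
  show "e i x ** e i (- x) = mat 1" "e i (- x) ** e i x = mat 1"
    "f i x ** f i (- x) = mat 1" "f i (- x) ** f i x = mat 1"
    using e_add[OF i, of x "- x"] e_add[OF i, of "- x" x] f_add[OF i, of x "- x"]
      f_add[OF i, of "- x" x] E_one[OF i] by simp_all
  show "s i ** s' i = mat 1" "s' i ** s i = mat 1"
    using E_inverse[OF i, of 0 0 "- 1" 1] E_inverse[OF i, of 0 0 1 "- 1"] by simp_all
  assume "t \<noteq> 0"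
  then show "k i t ** E i (1 / t) 0 0 t = mat 1" "E i (1 / t) 0 0 t ** k i t = mat 1"
    using E_inverse[OF i, of t "1 / t" 0 0] E_inverse[OF i, of "1 / t" t 0 0] by simp_all
qed

lemma s_eq: "j \<in> I \<Longrightarrow> s j = e j (- 1) ** f j 1 ** e j (- 1)"
  and s'_eq: "j \<in> I \<Longrightarrow> s' j = e j 1 ** f j (- 1) ** e j 1"
  by (rule E_mult3_eq[symmetric]; simp)+

lemma gen_T_conj:
  assumes "J \<subseteq> I" "h \<in> T" "x \<in> gen e J"
  shows "\<exists>x'\<in>gen e J. h ** x = x' ** h"
  using assms(3)
proof (induction rule: gen.induct)
  case gen_one
  show ?case by (intro bexI[of _ "mat 1"] gen.gen_one) simp
next
  case (gen_step i g t)
  then obtain x' where x': "x' \<in> gen e J" "h ** g = x' ** h" by blast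
  have "h ** (e i t ** g) = e i (\<alpha> i h * t) ** (h ** g)"
    using T_conj_pos[of i h t] gen_step assms by (auto simp: matrix_mul_assoc)
  also have "\<dots> = (e i (\<alpha> i h * t) ** x') ** h" by (simp only: x'(2) matrix_mul_assoc)
  finally show ?case using gen.gen_step[OF gen_step(1) x'(1)] by blast
qed

lemma gen_T_conj':
  assumes "J \<subseteq> I" "h \<in> T" "x \<in> gen e J"
  shows "\<exists>x'\<in>gen e J. x ** h = h ** x'"
proof -
  obtain h' where h': "h' \<in> T" "h ** h' = mat 1" "h' ** h = mat 1" using T_inverse assms by blast
  obtain x' where x': "x' \<in> gen e J" "h' ** x = x' ** h'" using gen_T_conj[OF assms(1) h'(1) assms(3)] by blast
  have "h ** (h' ** x) ** h = h ** (x' ** h') ** h" by (simp add: x')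
  then have "x ** h = h ** x'"
    by (simp add: mat_cancel_left h' matrix_mul_assoc[symmetric])
  then show ?thesis using x'(1) by blast
qed

text \<open>Writing s_j through root subgroups gives h s_j = k_j(a) s_j h with a the value of the
  j-th root at h. Hence s_j h = k_j(a)^(-1) h s_j, the reflection acting on the torus.\<close>

lemma T_s: "j \<in> I \<Longrightarrow> h \<in> T \<Longrightarrow> \<exists>h'\<in>T. s j ** h = h' ** s j"
proof -
  assume j: "j \<in> I" and h: "h \<in> T"
  let ?a = "\<alpha> j h"
  have a: "?a \<noteq> 0" using \<alpha>_nz j h by blast
  note hc = T_conj_pos[OF j h, of "- 1"] T_conj_neg[OF j h, of 1]
  have "h ** s j = e j (- ?a) ** f j (inverse ?a) ** e j (- ?a) ** h"
    using hc mat_rewrite[OF hc(1)] mat_rewrite[OF hc(2)] by (simp add: s_eq[OF j] matrix_mul_assoc)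
  also have "e j (- ?a) ** f j (inverse ?a) ** e j (- ?a) = E j 0 (- ?a) (1 / ?a) 0"
    using a j by (intro E_mult3_eq) (simp_all add: field_simps)
  also have "\<dots> = k j ?a ** s j"
    using a j by (intro E_mult_eq[symmetric]) simp_all
  finally have "E j (1 / ?a) 0 0 ?a ** (h ** s j) = E j (1 / ?a) 0 0 ?a ** (k j ?a ** (s j ** h))"
    by (simp add: matrix_mul_assoc)
  then have "E j (1 / ?a) 0 0 ?a ** h ** s j = s j ** h"
    by (simp add: mat_cancel_left[OF k_inverse(2)[OF j a]] matrix_mul_assoc[symmetric])
  moreover have "E j (1 / ?a) 0 0 ?a \<in> T" using k_in_T[OF j, of "1 / ?a"] a by simp
  ultimately show ?thesis using T_mult[OF _ h] by (intro bexI[of _ "E j (1 / ?a) 0 0 ?a ** h"]) simp_all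
qed

text \<open>The subgroups \<open>x\<^sub>j(a) x\<^sub>i(\<cdot>) x\<^sub>j(-a)\<close> are indexed by the points \<open>a \<noteq> \<infinity>\<close> of the projective
  line of \<open>\<phi>\<^sub>j\<close>, because \<open>x\<^sub>i\<close> commutes with the opposite \<open>x\<^bsub>-j\<^esub>\<close>. The subgroup below belongs
  to the missing point \<open>\<infinity>\<close>.\<close>

lemma e_conj_s:
  assumes i: "i \<in> I" and j: "j \<in> I" and ij: "i \<noteq> j"
  shows "s' j ** e i b ** s j \<in> gen e {i, j}"
proof -
  \<comment> \<open>This h commutes with the image of the embedding for j and scales the parameter
    of e_i. So it commutes with the conjugating curve \<open>f j\<close>, and the limiting
    one-parameter group is homogeneous.\<close>
  obtain h d where h: "h \<in> T" "0 < d" "\<And>l. l \<in> I \<Longrightarrow> \<alpha> l h = 2 powi (d * (if l = i then 1 else 0))"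
    using T_scaling[of "\<lambda>l. if l = i then 1 else 0"] by blast
  obtain h' where h': "h ** h' = mat 1" using T_inverse h(1) by blast
  have \<alpha>j: "\<alpha> j h = 1" and \<alpha>i: "\<alpha> i h = 2 powi d" using h(3) i j ij by simp_all
  have he: "h ** e j x = e j x ** h" and hf: "h ** f j x = f j x ** h" for x
    using T_conj_pos[OF j h(1), of x] T_conj_neg[OF j h(1), of x] by (simp_all add: \<alpha>j)
  have hs: "h ** s j = s j ** h" "h ** s' j = s' j ** h"
    by (simp_all add: s_eq[OF j] s'_eq[OF j] matrix_mul_assoc he hf mat_rewrite[OF he] mat_rewrite[OF hf])
  have i0: "e i 0 = mat 1" "f j 0 = mat 1" using E_one i j by simp_all
  show ?thesis
  proof (rule one_parameter_limit_in_monoid[where N="gen e {i, j}" and w="\<lambda>b. s' j ** e i b ** s j"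
      and g="f j" and P=P and P'=P' and h=h and h'=h' and \<mu>="2 powi d"])
    show "poly_curve (\<lambda>b. s' j ** e i b ** s j)"
      by (intro vanishes_to_mult_left vanishes_to_mult_right E_poly i)
    show "s' j ** e i (x + y) ** s j = (s' j ** e i x ** s j) ** (s' j ** e i y ** s j)" for x y
      unfolding e_add[OF i] by (rule conj_mult[OF s_inverse(1)[OF j]])
    show "s' j ** e i 0 ** s j = mat 1" by (simp add: i0 s_inverse j)
    show "h ** (s' j ** e i b ** s j) = s' j ** e i (2 powi d * b) ** s j ** h" for b
      using mat_rewrite[OF T_conj_pos[OF i h(1)], of "s' j" b]
      by (simp add: \<alpha>i hs matrix_mul_assoc mat_rewrite[OF hs(1)])
    show "1 < cmod (2 powi d)"
      using h(2) by (simp add: norm_power_int one_less_power_int)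
    fix x b :: complex assume x: "x \<noteq> 0"
    let ?k = "k j (1 / x)" and ?k' = "k j x"
    \<comment> \<open>For nonzero x, the element f_j(x) moves the missing point at infinity to the
      finite point 1/x; these factorizations express the move. The case x = 0 is then reached as a
      limit.\<close>
    have "f j x ** s' j = E j 0 1 (- 1) x"
      using j by (intro E_mult_eq) simp_all
    also have "\<dots> = e j (1 / x) ** f j (- x) ** ?k"
      using x j by (intro E_mult3_eq[symmetric]) simp_all
    finally have 1: "f j x ** s' j = e j (1 / x) ** f j (- x) ** ?k" .
    have "s j ** f j (- x) = E j x (- 1) 1 0"
      using j by (intro E_mult_eq) simp_all
    also have "\<dots> = ?k' ** f j x ** e j (- 1 / x)"
      using x j by (intro E_mult3_eq[symmetric]) simp_all
    finally have 2: "s j ** f j (- x) = ?k' ** f j x ** e j (- 1 / x)" .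
    let ?b = "\<alpha> i ?k * b"
    have kT: "?k \<in> T" using k_in_T[OF j, of "1 / x"] x by simp
    have kk: "?k ** ?k' = mat 1" using k_inverse(2)[OF j x] by simp
    have "f j x ** (s' j ** e i b ** s j) ** f j (- x) =
        (f j x ** s' j) ** e i b ** (s j ** f j (- x))" by (simp add: matrix_mul_assoc)
    also have "\<dots> = e j (1 / x) ** f j (- x) ** (?k ** e i b) ** ?k' ** f j x ** e j (- 1 / x)"
      unfolding 1 2 by (simp only: matrix_mul_assoc)
    also have "\<dots> = e j (1 / x) ** (f j (- x) ** e i ?b) ** (?k ** ?k') ** f j x ** e j (- 1 / x)"
      unfolding T_conj_pos[OF i kT] by (simp only: matrix_mul_assoc)
    also have "\<dots> = e j (1 / x) ** e i ?b ** (f j (- x) ** f j x) ** e j (- 1 / x)"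
      unfolding kk pos_neg_comm[OF i j ij, symmetric] by (simp add: matrix_mul_assoc)
    also have "\<dots> = e j (1 / x) ** e i ?b ** e j (- 1 / x)"
      by (simp add: f_inverse j)
    also have "\<dots> \<in> gen e {i, j}" by (intro gen_mult gen_base) simp_all
    finally show "f j x ** (s' j ** e i b ** s j) ** f j (- x) \<in> gen e {i, j}" .
  qed (use E_poly(2)[OF j] in \<open>simp_all add: gen_one gen_mult i0 f_inverse j PP' h' T_diagonal h(1) hf\<close>)
qed

text \<open>A lower triangular element k_j f_j only rescales the parameter of e_i. Modulo such
  elements a matrix in SL2 is e_j(b/d) if d is nonzero, and s'_j otherwise; the second case is
  \<open>e_conj_s\<close>.\<close>

lemma e_conj_E:
  assumes i: "i \<in> I" and j: "j \<in> I" and ij: "i \<noteq> j" and det: "a * d - b * c = 1"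
  shows "E j a b c d ** e i t ** E j d (- b) (- c) a \<in> gen e {i, j}"
proof -
  have lower: "\<exists>t'. (k j p ** f j q) ** e i t = e i t' ** (k j p ** f j q)" if p: "p \<noteq> 0" for p q
  proof -
    have "(k j p ** f j q) ** e i t = k j p ** (f j q ** e i t)" by (simp only: matrix_mul_assoc)
    also have "\<dots> = (k j p ** e i t) ** f j q"
      unfolding pos_neg_comm[OF i j ij, symmetric] by (simp only: matrix_mul_assoc)
    also have "\<dots> = e i (\<alpha> i (k j p) * t) ** (k j p ** f j q)"
      unfolding T_conj_pos[OF i k_in_T[OF j p]] by (simp only: matrix_mul_assoc)
    finally show ?thesis by blast
  qed
  show ?thesis
  proof (cases "d = 0")
    case False
    let ?L = "k j (1 / d) ** f j (c / d)"
    obtain t' where t': "?L ** e i t = e i t' ** ?L" using lower[of "1 / d" "c / d"] False by auto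
    have a: "a = (1 + b * c) / d" using det False by (simp add: field_simps)
    have eq: "E j a b c d = e j (b / d) ** ?L"
      unfolding matrix_mul_assoc
      by (rule E_mult3_eq[symmetric]) (use False j a in \<open>simp_all add: field_simps\<close>)
    have inv: "?L ** E j d (- b) (- c) a = e j (- b / d)"
      by (rule E_mult3_eq) (use False j a in \<open>simp_all add: field_simps\<close>)
    have "E j a b c d ** e i t ** E j d (- b) (- c) a = e j (b / d) ** (?L ** e i t) ** E j d (- b) (- c) a"
      unfolding eq by (simp only: matrix_mul_assoc)
    also have "\<dots> = e j (b / d) ** e i t' ** (?L ** E j d (- b) (- c) a)"
      unfolding t' by (simp only: matrix_mul_assoc)
    also have "\<dots> \<in> gen e {i, j}" unfolding inv by (intro gen_mult gen_base) simp_all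
    finally show ?thesis .
  next
    case True
    then have "- (b * c) = 1" using det by simp
    then have bc: "b * c = - 1" by (metis minus_minus)
    then have c: "c \<noteq> 0" by auto
    have b: "b = - 1 / c" using bc c by (simp only: nonzero_eq_divide_eq[OF c])
    let ?L = "k j (- c) ** f j (- a * c)"
    obtain t' where t': "?L ** e i t = e i t' ** ?L" using lower[of "- c" "- a * c"] c by auto
    have eq: "E j a b c d = s' j ** ?L"
      unfolding matrix_mul_assoc
      by (rule E_mult3_eq[symmetric]) (use True c j b in \<open>simp_all add: field_simps\<close>)
    have inv: "?L ** E j d (- b) (- c) a = s j"
      by (rule E_mult3_eq) (use True c j b in \<open>simp_all add: field_simps\<close>)
    have "E j a b c d ** e i t ** E j d (- b) (- c) a = s' j ** (?L ** e i t) ** E j d (- b) (- c) a"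
      unfolding eq by (simp only: matrix_mul_assoc)
    also have "\<dots> = s' j ** e i t' ** (?L ** E j d (- b) (- c) a)"
      unfolding t' by (simp only: matrix_mul_assoc)
    also have "\<dots> \<in> gen e {i, j}" unfolding inv by (rule e_conj_s[OF i j ij])
    finally show ?thesis .
  qed
qed

lemma gen_conj_E:
  assumes J: "J \<subseteq> I" "j \<in> I" "j \<notin> J" and det: "a * d - b * c = 1" and x: "x \<in> gen e J"
  shows "E j a b c d ** x ** E j d (- b) (- c) a \<in> gen e (insert j J)"
  using x
proof (induction rule: gen.induct)
  case gen_one
  show ?case using E_inverse[OF J(2) det] by (simp add: gen.gen_one)
next
  case (gen_step i g t)
  have inv: "E j d (- b) (- c) a ** E j a b c d = mat 1"
    using E_inverse[OF J(2), of d a "- b" "- c"] det by (simp add: algebra_simps)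
  have "i \<in> I" "i \<noteq> j" using gen_step(1) J by auto
  then have "E j a b c d ** e i t ** E j d (- b) (- c) a \<in> gen e (insert j J)"
    using gen_mono[OF e_conj_E[OF _ J(2) _ det, of i t], of "insert j J"] gen_step(1) by simp
  then show ?case using gen_step(3) unfolding conj_mult[OF inv] by (rule gen_mult)
qed

lemma gen_conj_s:
  assumes "J \<subseteq> I" "j \<in> I" "j \<notin> J" "x \<in> gen e J"
  shows "s' j ** x ** s j \<in> gen e (insert j J)" "s j ** x ** s' j \<in> gen e (insert j J)"
  using gen_conj_E[OF assms(1-3) _ assms(4), of 0 0 1 "- 1"] gen_conj_E[OF assms(1-3) _ assms(4), of 0 0 "- 1" 1]
  by simp_all

text \<open>The first factor lies in the unipotent radical of the \<open>j\<close>-th minimal parabolic subgroup.\<close>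

lemma gen_factor:
  assumes j: "j \<in> I" and x: "x \<in> gen e I"
  shows "\<exists>m y. x = m ** e j y \<and>
    (\<forall>a b c d. a * d - b * c = 1 \<longrightarrow> E j a b c d ** m ** E j d (- b) (- c) a \<in> gen e I)"
  using x
proof (induction rule: gen.induct)
  case gen_one
  show ?case using E_inverse[OF j] E_one[OF j]
    by (intro exI[of _ "mat 1"]) (auto intro!: exI[of _ 0] gen.gen_one)
next
  case (gen_step i g t)
  then obtain m y where my: "g = m ** e j y"
    "\<And>a b c d. a * d - b * c = 1 \<Longrightarrow> E j a b c d ** m ** E j d (- b) (- c) a \<in> gen e I" by blast
  show ?case
  proof (cases "i = j")
    case True
    \<comment> \<open>The new factor moves to the right end at the cost of conjugating m. The
      property of m concerns conjugation by all of SL2, so it survives.\<close>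
    have "e i t ** g = (e j t ** m ** e j (- t)) ** e j (t + y)"
      unfolding e_add[OF j] my(1) True
      by (simp add: matrix_mul_assoc[symmetric] mat_cancel_left[OF e_inverse(2)[OF j]])
    moreover have "E j a b c d ** (e j t ** m ** e j (- t)) ** E j d (- b) (- c) a \<in> gen e I"
      if det: "a * d - b * c = 1" for a b c d
    proof -
      have 1: "E j a b c d ** e j t = E j a (a * t + b) c (c * t + d)"
        by (rule E_mult_eq[OF j det]) simp_all
      have 2: "e j (- t) ** E j d (- b) (- c) a = E j (c * t + d) (- (a * t + b)) (- c) a"
        by (rule E_mult_eq[OF j]) (use det in \<open>simp_all add: algebra_simps\<close>)
      have "E j a b c d ** (e j t ** m ** e j (- t)) ** E j d (- b) (- c) a
          = (E j a b c d ** e j t) ** m ** (e j (- t) ** E j d (- b) (- c) a)"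
        by (simp only: matrix_mul_assoc)
      also have "\<dots> \<in> gen e I"
        unfolding 1 2 by (rule my(2)) (use det in \<open>simp add: algebra_simps\<close>)
      finally show ?thesis .
    qed
    ultimately show ?thesis by blast
  next
    case False
    have "E j a b c d ** (e i t ** m) ** E j d (- b) (- c) a \<in> gen e I"
      if det: "a * d - b * c = 1" for a b c d
    proof -
      have inv: "E j d (- b) (- c) a ** E j a b c d = mat 1"
        using E_inverse[OF j, of d a "- b" "- c"] det by (simp add: algebra_simps)
      have "E j a b c d ** e i t ** E j d (- b) (- c) a \<in> gen e I"
        using gen_mono[OF e_conj_E[OF gen_step(1) j False det]] gen_step(1) j by simp
      then show ?thesis unfolding conj_mult[OF inv] using my(2)[OF det] by (rule gen_mult)
    qed
    then show ?thesis unfolding my(1) matrix_mul_assoc[of "e i t" m "e j y"] by blast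
  qed
qed

text \<open>In the eigenbasis N is unitriangular for the preorder given by the moduli of the
  eigenvalues of h. A degree l term in the entry (r, s) of e_i(t) forces the quotient of the
  eigenvalues at r and s to be \<open>\<alpha> i h ^ l\<close>: degree 0 only contributes the
  identity, and positive degree strictly increases the modulus from s to r.\<close>

lemma gen_diagonal:
  assumes h: "h \<in> T" "\<And>i. i \<in> I \<Longrightarrow> 1 < cmod (\<alpha> i h)" and x: "x \<in> gen e I"
  shows "(P ** x ** P') $ r $ r = 1 \<and> (\<forall>r s. r \<noteq> s \<longrightarrow> (P ** x ** P') $ r $ s \<noteq> 0 \<longrightarrow>
    cmod ((P ** h ** P') $ s $ s) < cmod ((P ** h ** P') $ r $ r))"
  using x
proof (induction arbitrary: r rule: gen.induct)
  case gen_one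
  have "P ** mat 1 ** P' = mat 1" using PP' by simp
  then show ?case by (simp add: mat_def)
next
  case (gen_step i g t)
  let ?d = "\<lambda>r. (P ** h ** P') $ r $ r"
  let ?E = "P ** e i t ** P'" and ?g = "P ** g ** P'"
  have nz: "?d r \<noteq> 0" for r
    using T_inverse[OF h(1)] diagonal_entry_nonzero[OF PP', of h] T_diagonal[OF h(1)] by blast
  have E: "(r = s \<longrightarrow> ?E $ r $ s = 1) \<and> (r \<noteq> s \<longrightarrow> ?E $ r $ s \<noteq> 0 \<longrightarrow> cmod (?d s) < cmod (?d r))" for r s
  proof -
    let ?\<mu> = "\<alpha> i h"
    have \<mu>: "1 < cmod ?\<mu>" using h(2) gen_step(1) by blast
    obtain p where p: "\<And>t. (P ** e i t ** P') $ r $ s = poly p t"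
      and c: "\<And>l. ?d r * coeff p l = ?d s * ?\<mu> ^ l * coeff p l"
      using homogeneous_entry[OF E_poly(1)[OF gen_step(1)] PP'(2) T_diagonal[OF h(1)] T_conj_pos[OF gen_step(1) h(1)], of r s]
      by (metis add_0 mult_1 power_0)
    have p0: "coeff p 0 = mat 1 $ r $ s"
      using p[of 0] E_one[OF gen_step(1)] PP'(1) by (simp add: poly_0_coeff_0)
    have norm_c: "cmod (?d r) = cmod (?d s) * cmod ?\<mu> ^ l" if "coeff p l \<noteq> 0" for l
      using c[of l] that by (metis mult_cancel_right norm_mult norm_power)
    show ?thesis
    proof (intro conjI impI)
      assume rs: "r = s"
      have "coeff p l = 0" if "l \<noteq> 0" for l
      proof (rule ccontr)
        assume "coeff p l \<noteq> 0"
        from norm_c[OF this] have "cmod ?\<mu> ^ l = 1" using nz[of s] rs by simp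
        then show False using \<mu> that one_less_power[of "cmod ?\<mu>" l] by simp
      qed
      then have "p = [:1:]" using p0 rs by (intro poly_eqI) (auto simp: mat_def coeff_pCons split: nat.split)
      then show "?E $ r $ s = 1" using p by simp
    next
      assume rs: "r \<noteq> s" "?E $ r $ s \<noteq> 0"
      then have "p \<noteq> 0" using p by auto
      then obtain l where l: "coeff p l \<noteq> 0" by (auto simp: poly_eq_iff)
      moreover have "l \<noteq> 0" using p0 rs(1) l by (intro notI) (simp add: mat_def)
      ultimately show "cmod (?d s) < cmod (?d r)"
        using norm_c[OF l] \<mu> nz[of s] one_less_power[of "cmod ?\<mu>" l] by simp
    qed
  qed
  have prod: "(P ** (e i t ** g) ** P') $ r $ s = (\<Sum>u\<in>UNIV. ?E $ r $ u * ?g $ u $ s)" for r s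
    unfolding conj_mult[OF PP'(2)] by (simp add: matrix_matrix_mult_def)
  have g: "?g $ r $ r = 1" "r \<noteq> s \<Longrightarrow> ?g $ r $ s \<noteq> 0 \<Longrightarrow> cmod (?d s) < cmod (?d r)" for r s
    using gen_step(3) by blast+
  show ?case
  proof (intro conjI allI impI)
    have "?E $ r $ u * ?g $ u $ r = (if u = r then 1 else 0)" for u
      using E[of r u] g(1)[of r] g(2)[of u r] by (cases "u = r") force+
    then show "(P ** (e i t ** g) ** P') $ r $ r = 1" unfolding prod by simp
  next
    fix r s assume rs: "r \<noteq> s" "(P ** (e i t ** g) ** P') $ r $ s \<noteq> 0"
    then obtain u where "?E $ r $ u \<noteq> 0" "?g $ u $ s \<noteq> 0"
      unfolding prod by (metis (no_types, lifting) mult_eq_0_iff sum.neutral)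
    then show "cmod (?d s) < cmod (?d r)"
      using E[of r u] g(2)[of u s] rs(1) by (cases "r = u"; cases "u = s") auto
  qed
qed

end

lemma diagonal_mult_entry:
  fixes A M :: "'m::finite cmat"
  assumes "\<And>r s. r \<noteq> s \<Longrightarrow> M $ r $ s = 0"
  shows "(A ** M) $ r $ s = A $ r $ s * M $ s $ s" "(M ** A) $ r $ s = M $ r $ r * A $ r $ s"
proof -
  have "(\<Sum>u\<in>UNIV. A $ r $ u * M $ u $ s) = (\<Sum>u\<in>{s}. A $ r $ u * M $ u $ s)"
    by (intro sum.mono_neutral_right) (auto simp: assms)
  then show "(A ** M) $ r $ s = A $ r $ s * M $ s $ s" by (simp add: matrix_matrix_mult_def)
  have "(\<Sum>u\<in>UNIV. M $ r $ u * A $ u $ s) = (\<Sum>u\<in>{r}. M $ r $ u * A $ u $ s)"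
    by (intro sum.mono_neutral_right) (auto simp: assms)
  then show "(M ** A) $ r $ s = M $ r $ r * A $ r $ s" by (simp add: matrix_matrix_mult_def)
qed

context chevalley
begin

section \<open>Bruhat and Gauss decompositions along words with distinct letters\<close>

lemma f_word_commute:
  assumes "set ws \<subseteq> I" "j \<in> I" "j \<notin> set ws"
  shows "mat_prod (map (\<lambda>i. f i (t i)) ws) ** e j x = e j x ** mat_prod (map (\<lambda>i. f i (t i)) ws)"
  using assms
proof (induction ws)
  case (Cons i ws)
  then have IH: "mat_prod (map (\<lambda>i. f i (t i)) ws) ** e j x = e j x ** mat_prod (map (\<lambda>i. f i (t i)) ws)"
    and c: "f i (t i) ** e j x = e j x ** f i (t i)"
    using pos_neg_comm[of j i x "t i"] by auto
  show ?case
    by (simp add: matrix_mul_assoc[symmetric] IH) (simp add: matrix_mul_assoc c)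
qed simp

lemma e_word_T:
  assumes "set ws \<subseteq> I" "h \<in> T"
  shows "mat_prod (map (\<lambda>i. e i (t i)) ws) ** h = h ** mat_prod (map (\<lambda>i. e i (t i / \<alpha> i h)) ws)"
  using assms(1)
proof (induction ws)
  case (Cons i ws)
  then have i: "i \<in> I" by simp
  have "h ** e i (t i / \<alpha> i h) = e i (t i) ** h"
    using T_conj_pos[OF i assms(2), of "t i / \<alpha> i h"] \<alpha>_nz[OF i assms(2)] by simp
  with Cons show ?case
    by (simp add: matrix_mul_assoc[symmetric]) (simp add: matrix_mul_assoc)
qed simp

text \<open>Each s_j meets only factors e_i with i different from j, because the letters are
  distinct and outside J. Such factors stay positive under conjugation, and the new index j does not
  occur among the remaining letters.\<close>

lemma s_word_conj:
  assumes "distinct ws" "set ws \<subseteq> I" "J \<subseteq> I" "J \<inter> set ws = {}" "x \<in> gen e J"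
  shows "\<exists>x'\<in>gen e (J \<union> set ws). x ** mat_prod (map s ws) = mat_prod (map s ws) ** x'"
  using assms
proof (induction ws arbitrary: J x)
  case Nil
  then show ?case by auto
next
  case (Cons j ws)
  then have j: "j \<in> I" "j \<notin> J" by auto
  define x1 where "x1 = s' j ** x ** s j"
  have x1: "x1 \<in> gen e (insert j J)" "s j ** x1 = x ** s j"
    using gen_conj_s(1)[OF Cons.prems(3) j Cons.prems(5)] s_inverse(1)[OF j(1)]
    by (auto simp: x1_def matrix_mul_assoc)
  obtain x' where x': "x' \<in> gen e (insert j J \<union> set ws)"
    "x1 ** mat_prod (map s ws) = mat_prod (map s ws) ** x'"
    using Cons.IH[OF _ _ _ _ x1(1)] Cons.prems by auto
  have "x ** mat_prod (map s (j # ws)) = s j ** (x1 ** mat_prod (map s ws))"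
    by (simp add: matrix_mul_assoc x1(2))
  also have "\<dots> = mat_prod (map s (j # ws)) ** x'" by (simp add: x'(2) matrix_mul_assoc)
  finally show ?case using x'(1) by auto
qed

lemma s_word_stable:
  assumes K: "\<And>i h. i \<in> set ws \<Longrightarrow> h \<in> K \<Longrightarrow> \<exists>h'\<in>K. s i ** h = h' ** s i" and h: "h \<in> K"
  shows "\<exists>h'\<in>K. mat_prod (map s ws) ** h = h' ** mat_prod (map s ws)"
  using assms
proof (induction ws)
  case (Cons i ws)
  then obtain h1 where h1: "h1 \<in> K" "mat_prod (map s ws) ** h = h1 ** mat_prod (map s ws)" by auto
  obtain h2 where h2: "h2 \<in> K" "s i ** h1 = h2 ** s i" using Cons.prems(1)[OF _ h1(1), of i] by auto
  have "mat_prod (map s (i # ws)) ** h = s i ** (mat_prod (map s ws) ** h)"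
    by (simp add: matrix_mul_assoc)
  also have "\<dots> = (s i ** h1) ** mat_prod (map s ws)" unfolding h1(2) by (simp only: matrix_mul_assoc)
  also have "\<dots> = h2 ** mat_prod (map s (i # ws))" unfolding h2(2) by (simp add: matrix_mul_assoc)
  finally show ?case using h2(1) by blast
qed auto

text \<open>The set \<open>K\<close> will be either \<open>T\<close> or the trivial group.\<close>

lemma f_word_double_coset:
  assumes K: "K \<subseteq> T" "mat 1 \<in> K" "\<And>g h. g \<in> K \<Longrightarrow> h \<in> K \<Longrightarrow> g ** h \<in> K"
    "\<And>i h. i \<in> set ws \<Longrightarrow> h \<in> K \<Longrightarrow> \<exists>h'\<in>K. s i ** h = h' ** s i"
    and t: "\<And>i. i \<in> set ws \<Longrightarrow> t i \<noteq> 0" "\<And>i. i \<in> set ws \<Longrightarrow> k i (1 / t i) \<in> K"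
    and ws: "distinct ws" "set ws \<subseteq> I"
  shows "\<exists>X\<in>gen e (set ws). \<exists>h\<in>K. \<exists>Y\<in>gen e (set ws).
    mat_prod (map (\<lambda>i. f i (t i)) ws) = X ** h ** mat_prod (map s ws) ** Y"
  using K(4) t ws
proof (induction ws rule: rev_induct)
  case Nil
  show ?case using K(2) gen_one by (auto intro!: bexI[of _ "mat 1"])
next
  case (snoc j ws)
  have j: "j \<in> I" "j \<notin> set ws" "t j \<noteq> 0" using snoc.prems by auto
  let ?S = "mat_prod (map s ws)" and ?F = "mat_prod (map (\<lambda>i. f i (t i)) ws)"
  let ?k = "k j (1 / t j)" and ?e = "e j (1 / t j)"
  obtain X h Y where X: "X \<in> gen e (set ws)" "h \<in> K" "Y \<in> gen e (set ws)" "?F = X ** h ** ?S ** Y"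
    using snoc by force
  have kK: "?k \<in> K" using snoc.prems(3)[of j] by simp
  have wsI: "set ws \<subseteq> I" using snoc.prems by simp
  obtain Y1 where Y1: "Y1 \<in> gen e (set ws)" "Y ** ?k = ?k ** Y1"
    using gen_T_conj'[OF wsI _ X(3)] kK K(1) by blast
  obtain k2 where k2: "k2 \<in> K" "?S ** ?k = k2 ** ?S"
    using s_word_stable[OF _ kK, of ws] snoc.prems(1) by auto
  define Y2 where "Y2 = s' j ** Y1 ** s j"
  have Y2: "Y2 \<in> gen e (insert j (set ws))" "Y1 ** s j = s j ** Y2"
    using gen_conj_s(1)[OF wsI j(1,2) Y1(1)] s_inverse(1)[OF j(1)] by (simp_all add: Y2_def matrix_mul_assoc)
  \<comment> \<open>The Bruhat decomposition in SL2; its torus part is trivial for t = 1. The left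
    factor e_j(1/t) then commutes with the preceding f_i, where i is different from j.\<close>
  have "?e ** (?k ** s j) ** ?e = f j (t j)"
  proof -
    have "?k ** s j = E j 0 (- 1 / t j) (t j) 0"
      using j by (intro E_mult_eq) simp_all
    then show ?thesis using j by (simp only:) (intro E_mult3_eq, simp_all)
  qed
  then have "?F ** f j (t j) = (?F ** ?e) ** ?k ** s j ** ?e" by (simp only: matrix_mul_assoc flip: \<open>?e ** (?k ** s j) ** ?e = f j (t j)\<close>)
  also have "\<dots> = (?e ** ?F) ** ?k ** s j ** ?e"
    by (simp only: f_word_commute[OF wsI j(1,2)])
  also have "\<dots> = ?e ** X ** h ** ?S ** (Y ** ?k) ** s j ** ?e"
    unfolding X(4) by (simp only: matrix_mul_assoc)
  also have "\<dots> = ?e ** X ** h ** (?S ** ?k) ** (Y1 ** s j) ** ?e"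
    unfolding Y1(2) by (simp only: matrix_mul_assoc)
  also have "\<dots> = (?e ** X) ** (h ** k2) ** mat_prod (map s (ws @ [j])) ** (Y2 ** ?e)"
    unfolding k2(2) Y2(2) by (simp add: matrix_mul_assoc)
  finally have "mat_prod (map (\<lambda>i. f i (t i)) (ws @ [j])) =
      (?e ** X) ** (h ** k2) ** mat_prod (map s (ws @ [j])) ** (Y2 ** ?e)" by simp
  moreover have "?e ** X \<in> gen e (set (ws @ [j]))" "Y2 ** ?e \<in> gen e (set (ws @ [j]))"
    using gen_mono[OF X(1), of "set (ws @ [j])"] Y2(1)
    by (auto intro!: gen_mult gen_base)
  ultimately show ?case using K(3)[OF X(2) k2(1)] by blast
qed

text \<open>At each letter j, the radical part of y' stays negative and only its factor f_j(a)
  becomes positive; the positive factors already present do not involve j and stay positive. The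
  reversed word of lifts inverts the word up to the torus, since s_j s_j = k_j(-1), and h collects
  these factors.\<close>

lemma s_word_conj_neg:
  assumes "distinct ws" "set ws \<subseteq> I" "y \<in> gen f I"
  shows "\<exists>y'\<in>gen f I. \<exists>x\<in>gen e (set ws). \<exists>h\<in>T.
    mat_prod (map s (rev ws)) ** y ** mat_prod (map s ws) = y' ** x ** h"
  using assms(1,2)
proof (induction ws rule: rev_induct)
  case Nil
  have "mat_prod (map s (rev [])) ** y ** mat_prod (map s []) = y ** mat 1 ** mat 1" by simp
  then show ?case using assms(3) T_one gen_one by blast
next
  case (snoc j ws)
  interpret opp: chevalley I "\<lambda>i a b c d. E i d c b a" T "\<lambda>i h. inverse (\<alpha> i h)" P P'
    by (rule opposite)
  let ?R = "mat_prod (map s (rev ws))" and ?S = "mat_prod (map s ws)"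
  have j: "j \<in> I" "j \<notin> set ws" and wsI: "set ws \<subseteq> I" using snoc.prems by auto
  obtain y' x h where IH: "y' \<in> gen f I" "x \<in> gen e (set ws)" "h \<in> T" "?R ** y ** ?S = y' ** x ** h"
    using snoc by auto
  obtain m a where m: "y' = m ** f j a"
    "\<And>a b c d. a * d - b * c = 1 \<Longrightarrow> E j d c b a ** m ** E j a (- c) (- b) d \<in> gen f I"
    using opp.gen_factor[OF j(1) IH(1)] by blast
  have m': "s j ** m ** s' j \<in> gen f I" using m(2)[of 0 0 1 "- 1"] by simp
  obtain h1 where h1: "h1 \<in> T" "h ** s j = s j ** h1"
  proof -
    obtain hi where hi: "hi \<in> T" "h ** hi = mat 1" "hi ** h = mat 1" using T_inverse IH(3) by blast
    obtain g where g: "g \<in> T" "s' j ** h = g ** s' j" using opp.T_s[OF j(1) IH(3)] by auto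
    have "s j ** (s' j ** h) ** s j = s j ** (g ** s' j) ** s j" by (simp only: g(2))
    then have "h ** s j = s j ** g"
      by (simp add: mat_cancel_left s_inverse j matrix_mul_assoc[symmetric])
    then show ?thesis using that g(1) by blast
  qed
  have sf: "s j ** f j a = e j (- a) ** s j"
  proof -
    have "s j ** f j a = E j (- a) (- 1) 1 0" using j by (intro E_mult_eq) simp_all
    also have "\<dots> = e j (- a) ** s j" using j by (intro E_mult_eq[symmetric]) simp_all
    finally show ?thesis .
  qed
  define x1 where "x1 = s j ** x ** s' j"
  have x1: "x1 \<in> gen e (insert j (set ws))" "s j ** x = x1 ** s j"
    using gen_conj_s(2)[OF wsI j IH(2)] s_inverse(2)[OF j(1)]
    by (simp_all add: x1_def matrix_mul_assoc[symmetric])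
  have ss: "s j ** s j = k j (- 1)" using j by (intro E_mult_eq) simp_all
  have "mat_prod (map s (rev (ws @ [j]))) ** y ** mat_prod (map s (ws @ [j])) = s j ** (?R ** y ** ?S) ** s j"
    by (simp add: matrix_mul_assoc)
  also have "\<dots> = s j ** m ** f j a ** x ** (h ** s j)" unfolding IH(4) m(1) by (simp only: matrix_mul_assoc)
  also have "\<dots> = s j ** m ** (s' j ** s j) ** f j a ** x ** s j ** h1"
    unfolding h1(2) by (simp add: s_inverse j matrix_mul_assoc)
  also have "\<dots> = (s j ** m ** s' j) ** (s j ** f j a) ** x ** s j ** h1"
    by (simp only: matrix_mul_assoc)
  also have "\<dots> = (s j ** m ** s' j) ** e j (- a) ** (s j ** x) ** s j ** h1"
    unfolding sf by (simp only: matrix_mul_assoc)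
  also have "\<dots> = (s j ** m ** s' j) ** (e j (- a) ** x1) ** ((s j ** s j) ** h1)"
    unfolding x1(2) by (simp only: matrix_mul_assoc)
  finally have "mat_prod (map s (rev (ws @ [j]))) ** y ** mat_prod (map s (ws @ [j])) =
      (s j ** m ** s' j) ** (e j (- a) ** x1) ** ((s j ** s j) ** h1)" .
  moreover have "(s j ** s j) ** h1 \<in> T"
    unfolding ss using k_in_T[OF j(1), of "- 1"] h1(1) by (intro T_mult) simp_all
  moreover have "e j (- a) ** x1 \<in> gen e (set (ws @ [j]))"
    using x1(1) by (intro gen_mult gen_base) simp_all
  ultimately show ?case using m' by blast
qed

text \<open>The torus part of e_n(t_n) ... e_1(t_1) s_1 ... s_n. Moving k_j(t_j) to the left past
  the remaining e_i divides their parameters by the values of the roots at k_j(t_j).\<close>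

primrec tau :: "nat list \<Rightarrow> (nat \<Rightarrow> complex) \<Rightarrow> 'm cmat" where
  "tau [] t = mat 1"
| "tau (j # ws) t = k j (t j) ** tau ws (\<lambda>i. t i / \<alpha> i (k j (t j)))"

lemma tau_in_T: "set ws \<subseteq> I \<Longrightarrow> (\<And>i. i \<in> set ws \<Longrightarrow> t i \<noteq> 0) \<Longrightarrow> tau ws t \<in> T"
proof (induction ws arbitrary: t)
  case (Cons j ws)
  then have j: "j \<in> I" "t j \<noteq> 0" by auto
  have "tau ws (\<lambda>i. t i / \<alpha> i (k j (t j))) \<in> T"
    using Cons.prems \<alpha>_nz k_in_T[OF j] by (intro Cons.IH) auto
  then show ?case using k_in_T[OF j] T_mult by simp
qed (simp add: T_one)

text \<open>In SL2, e_j(t) s_j = f_j(1/t) k_j(t) e_j(-1/t). The word of the e_i is reversed so that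
  e_j meets s_j first; then f_j commutes to the left past the other e_i, and e_j(-1/t) passes the
  remaining s_i on the right by \<open>s_word_conj\<close>.\<close>

lemma e_word_gauss:
  assumes "distinct ws" "set ws \<subseteq> I" "\<And>i. i \<in> set ws \<Longrightarrow> t i \<noteq> 0"
  shows "\<exists>y\<in>gen f I. \<exists>x\<in>gen e I.
    mat_prod (map (\<lambda>i. e i (t i)) (rev ws)) ** mat_prod (map s ws) = y ** tau ws t ** x"
  using assms
proof (induction ws arbitrary: t)
  case Nil
  show ?case by (auto intro!: bexI[of _ "mat 1"] gen_one)
next
  case (Cons j ws)
  interpret opp: chevalley I "\<lambda>i a b c d. E i d c b a" T "\<lambda>i h. inverse (\<alpha> i h)" P P'
    by (rule opposite)
  have j: "j \<in> I" "j \<notin> set ws" "t j \<noteq> 0" and wsI: "set ws \<subseteq> I" and ws: "distinct ws"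
    using Cons.prems by auto
  let ?k = "k j (t j)" and ?S = "mat_prod (map s ws)"
  define t' where "t' i = t i / \<alpha> i ?k" for i
  let ?ER = "mat_prod (map (\<lambda>i. e i (t i)) (rev ws))" and ?ER' = "mat_prod (map (\<lambda>i. e i (t' i)) (rev ws))"
  have kT: "?k \<in> T" using k_in_T j by blast
  have t': "t' i \<noteq> 0" if "i \<in> set ws" for i
    unfolding t'_def using Cons.prems(3)[of i] \<alpha>_nz[OF _ kT, of i] that wsI by auto
  obtain y x where IH: "y \<in> gen f I" "x \<in> gen e I" "?ER' ** ?S = y ** tau ws t' ** x"
    using Cons.IH[OF ws wsI, of t'] t' by blast
  obtain x1 where x1: "x1 \<in> gen e ({j} \<union> set ws)" "e j (- 1 / t j) ** ?S = ?S ** x1"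
    using s_word_conj[OF ws wsI, of "{j}" "e j (- 1 / t j)"] j
      gen_base[of j "{j}" "\<lambda>i t. e i t" "- 1 / t j"] by auto
  have x1I: "x1 \<in> gen e I" by (rule gen_mono[OF x1(1)]) (use j wsI in auto)
  obtain y1 where y1: "y1 \<in> gen f I" "?k ** y = y1 ** ?k"
    using opp.gen_T_conj[OF order_refl kT IH(1)] by blast
  have es: "e j (t j) ** s j = f j (1 / t j) ** ?k ** e j (- 1 / t j)"
  proof -
    have "e j (t j) ** s j = E j (t j) (- 1) 1 0" using j by (intro E_mult_eq) simp_all
    also have "\<dots> = f j (1 / t j) ** ?k ** e j (- 1 / t j)"
      using j by (intro E_mult3_eq[symmetric]) simp_all
    finally show ?thesis .
  qed
  have comm: "?ER ** f j (1 / t j) = f j (1 / t j) ** ?ER"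
    using opp.f_word_commute[of "rev ws" j t "1 / t j"] wsI j by simp
  have erk: "?ER ** ?k = ?k ** ?ER'"
    using e_word_T[OF _ kT, of "rev ws" t] wsI by (simp add: t'_def)
  have "mat_prod (map (\<lambda>i. e i (t i)) (rev (j # ws))) ** mat_prod (map s (j # ws)) =
      ?ER ** (e j (t j) ** s j) ** ?S" by (simp add: matrix_mul_assoc)
  also have "\<dots> = (?ER ** f j (1 / t j)) ** ?k ** (e j (- 1 / t j) ** ?S)"
    unfolding es by (simp only: matrix_mul_assoc)
  also have "\<dots> = f j (1 / t j) ** (?ER ** ?k) ** ?S ** x1"
    unfolding comm x1(2) by (simp only: matrix_mul_assoc)
  also have "\<dots> = f j (1 / t j) ** ?k ** (?ER' ** ?S) ** x1"
    unfolding erk by (simp only: matrix_mul_assoc)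
  also have "\<dots> = f j (1 / t j) ** (?k ** y) ** tau ws t' ** x ** x1"
    unfolding IH(3) by (simp only: matrix_mul_assoc)
  also have "\<dots> = (f j (1 / t j) ** y1) ** (?k ** tau ws t') ** (x ** x1)"
    unfolding y1(2) by (simp only: matrix_mul_assoc)
  also have "?k ** tau ws t' = tau (j # ws) t" by (simp add: t'_def[abs_def])
  finally have "mat_prod (map (\<lambda>i. e i (t i)) (rev (j # ws))) ** mat_prod (map s (j # ws)) =
    (f j (1 / t j) ** y1) ** tau (j # ws) t ** (x ** x1)" .
  then show ?case
    using gen_mult[OF gen_base[of j I "\<lambda>i t. f i t" "1 / t j", OF j(1)] y1(1)] gen_mult[OF IH(2) x1I] by blast
qed

text \<open>After collecting negative factors on the left and positive ones on the right, both
  unipotent factors have diagonal entries 1 in the eigenbasis. Comparing diagonals gives h = h', as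
  the torus is diagonal there.\<close>

lemma gauss_torus_unique:
  assumes y: "y \<in> gen f I" "y' \<in> gen f I" and x: "x \<in> gen e I" "x' \<in> gen e I"
    and h: "h \<in> T" "h' \<in> T" and eq: "y ** h ** x = y' ** h' ** x'"
  shows "h = h'"
proof -
  interpret opp: chevalley I "\<lambda>i a b c d. E i d c b a" T "\<lambda>i h. inverse (\<alpha> i h)" P P'
    by (rule opposite)
  have big: "1 < cmod (2 powi d)" if "0 < d" for d :: int
    using that by (simp add: norm_power_int one_less_power_int)
  obtain hp where hp: "hp \<in> T" "\<And>i. i \<in> I \<Longrightarrow> 1 < cmod (\<alpha> i hp)"
    using T_scaling[of "\<lambda>_. 1"] big by (metis mult_1_right)
  obtain hn where hn: "hn \<in> T" "\<And>i. i \<in> I \<Longrightarrow> 1 < cmod (inverse (\<alpha> i hn))"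
    using opp.T_scaling[of "\<lambda>_. 1"] big by (metis mult_1_right)
  obtain yi where yi: "yi \<in> gen f I" "y' ** yi = mat 1"
    using gen_inverse[OF f_inverse(1) y(2)] by blast
  obtain xi where xi: "xi \<in> gen e I" "x ** xi = mat 1"
    using gen_inverse[OF e_inverse(1) x(1)] by blast
  have yi': "yi ** y' = mat 1" by (rule matrix_left_right_inverse[THEN iffD1, OF yi(2)])
  have "yi ** (y ** h ** x) ** xi = yi ** (y' ** h' ** x') ** xi" by (simp only: eq)
  then have "(yi ** y) ** h ** (x ** xi) = (yi ** y') ** h' ** (x' ** xi)"
    by (simp only: matrix_mul_assoc)
  then have eq': "(yi ** y) ** h = h' ** (x' ** xi)" by (simp add: xi(2) yi')
  have "(P ** (yi ** y) ** P') $ r $ r = 1" for r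
    using opp.gen_diagonal[OF hn gen_mult[OF yi(1) y(1)]] by blast
  moreover have "(P ** (x' ** xi) ** P') $ r $ r = 1" for r
    using gen_diagonal[OF hp gen_mult[OF x(2) xi(1)]] by blast
  moreover have "(P ** (yi ** y) ** P') ** (P ** h ** P') = (P ** h' ** P') ** (P ** (x' ** xi) ** P')"
    using arg_cong[OF eq', of "\<lambda>z. P ** z ** P'"] unfolding conj_mult[OF PP'(2)] .
  ultimately have "(P ** h ** P') $ r $ r = (P ** h' ** P') $ r $ r" for r
    using diagonal_mult_entry[of "P ** h ** P'" "P ** (yi ** y) ** P'" r r]
      diagonal_mult_entry[of "P ** h' ** P'" "P ** (x' ** xi) ** P'" r r] T_diagonal h by simp
  then have "(P ** h ** P') $ r $ u = (P ** h' ** P') $ r $ u" for r u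
    using T_diagonal h by (cases "r = u") simp_all
  then have "P ** h ** P' = P ** h' ** P'" by (simp add: vec_eq_iff)
  then show ?thesis using mat_conj_eq_iff[OF PP'] by blast
qed

end

section \<open>The pinned group as an instance of the calculus above\<close>

context pinned
begin

text \<open>A fixed choice of a diagonalizing matrix and its inverse, since the parameters of the
  locale instance below have to be terms.\<close>

definition eigenbasis :: "'m cmat \<times> 'm cmat" where
  "eigenbasis = (SOME Q. fst Q ** snd Q = mat 1 \<and> snd Q ** fst Q = mat 1 \<and>
     (\<forall>h\<in>torus D. \<forall>r s. r \<noteq> s \<longrightarrow> (fst Q ** h ** snd Q) $ r $ s = 0))"

lemma eigenbasis: "fst eigenbasis ** snd eigenbasis = mat 1 \<and> snd eigenbasis ** fst eigenbasis = mat 1 \<and>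
     (\<forall>h\<in>torus D. \<forall>r s. r \<noteq> s \<longrightarrow> (fst eigenbasis ** h ** snd eigenbasis) $ r $ s = 0)"
proof -
  obtain P P' :: "'m cmat" where P: "P ** P' = mat 1" "P' ** P = mat 1"
    "\<And>h r s. h \<in> torus D \<Longrightarrow> r \<noteq> s \<Longrightarrow> (P ** h ** P') $ r $ s = 0"
    using torus_diagonal by metis
  show ?thesis unfolding eigenbasis_def by (rule someI[of _ "(P, P')"]) (simp add: P)
qed

sublocale chevalley "index_set D" "\<lambda>i a b c d. emb D i (mat2 a b c d)" "torus D" \<alpha>
  "fst eigenbasis" "snd eigenbasis"
proof
  fix i assume i: "i \<in> index_set D"
  show "emb D i (mat2 a b c d) ** emb D i (mat2 a' b' c' d') =
      emb D i (mat2 (a * a' + b * c') (a * b' + b * d') (c * a' + d * c') (c * b' + d * d'))"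
    if "a * d - b * c = 1" "a' * d' - b' * c' = 1" for a b c d a' b' c' d'
    using emb_facts(1)[OF i, of "mat2 a b c d" "mat2 a' b' c' d'"] that by (simp add: mat2_SL2 mat2_mult)
  show "emb D i (mat2 1 0 0 1) = mat 1"
    using root_subgroupD(3)[OF emb_facts(4)[OF i]] by (simp add: x_pos_def)
  show "poly_curve (\<lambda>t. emb D i (mat2 1 t 0 1))" "poly_curve (\<lambda>t. emb D i (mat2 1 0 t 1))"
    using root_subgroupD(1)[OF emb_facts(4)[OF i]] root_subgroupD(1)[OF emb_facts(5)[OF i]]
    by (simp_all add: x_pos_def[abs_def] x_neg_def[abs_def])
  show "emb D i (mat2 t 0 0 (1 / t)) \<in> torus D" if "t \<noteq> 0" for t
    using emb_facts(3)[OF i that] by (simp add: coroot_def)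
  fix h assume h: "h \<in> torus D"
  show "\<alpha> i h \<noteq> 0" by (rule simple_root_nz[OF i h])
  show "h ** emb D i (mat2 1 t 0 1) = emb D i (mat2 1 (\<alpha> i h * t) 0 1) ** h"
    "h ** emb D i (mat2 1 0 t 1) = emb D i (mat2 1 0 (inverse (\<alpha> i h) * t) 1) ** h" for t
    using root_subgroupD(6)[OF emb_facts(4)[OF i] h, of t] root_subgroupD(6)[OF emb_facts(5)[OF i] h, of t]
    by (simp_all add: x_pos_def x_neg_def)
next
  fix i j x y assume "i \<in> index_set D" "j \<in> index_set D" "i \<noteq> j"
  then show "emb D i (mat2 1 x 0 1) ** emb D j (mat2 1 0 y 1) = emb D j (mat2 1 0 y 1) ** emb D i (mat2 1 x 0 1)"
    using pos_neg_commute[of i j x y] by (simp add: x_pos_def x_neg_def)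
next
  show "\<exists>h'\<in>torus D. h ** h' = mat 1 \<and> h' ** h = mat 1" if "h \<in> torus D" for h
    using matrix_inv[OF torus_invertible[OF that]] torus_inv[OF that] by blast
  show "\<exists>h\<in>torus D. \<exists>d>0. \<forall>j\<in>index_set D. \<alpha> j h = 2 powi (d * p j)" for p
    by (rule torus_scaling)
qed (use eigenbasis torus_one torus_mult in auto)

sublocale opp: chevalley "index_set D" "\<lambda>i a b c d. emb D i (mat2 d c b a)" "torus D"
  "\<lambda>i h. inverse (\<alpha> i h)" "fst eigenbasis" "snd eigenbasis"
  by (rule opposite)

lemma group_grp: "group (matrix_group (grp D))"
proof (rule groupI)
  fix x assume "x \<in> carrier (matrix_group (grp D))"
  then have x: "x \<in> grp D" by (simp add: matrix_group_def)
  show "\<exists>y\<in>carrier (matrix_group (grp D)). y \<otimes>\<^bsub>matrix_group (grp D)\<^esub> x = \<one>\<^bsub>matrix_group (grp D)\<^esub>"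
    using grp_inv[OF x] matrix_inv(2)[OF grp_invertible[OF x]] by (auto simp: matrix_group_def)
qed (auto simp: matrix_group_def grp_one grp_mult matrix_mul_assoc)

lemma generate_eq_gen:
  assumes u: "\<And>i t. i \<in> J \<Longrightarrow> u i t \<in> grp D" "\<And>i t. i \<in> J \<Longrightarrow> u i t ** u i (- t) = mat 1"
  shows "generate (matrix_group (grp D)) {u i t | i t. i \<in> J} = gen u J"
proof (intro equalityI subsetI)
  interpret G: group "matrix_group (grp D)" by (rule group_grp)
  fix x assume "x \<in> generate (matrix_group (grp D)) {u i t | i t. i \<in> J}"
  then show "x \<in> gen u J"
  proof (induction rule: generate.induct)
    case one
    show ?case using gen_one by (simp add: matrix_group_def)
  next
    case (incl h)
    then show ?case using gen_base by auto
  next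
    case (inv h)
    then obtain i t where h: "i \<in> J" "h = u i t" by blast
    have "inv\<^bsub>matrix_group (grp D)\<^esub> h = u i (- t)"
      using u(1)[OF h(1), of t] u(1)[OF h(1), of "- t"] u(2)[OF h(1), of "- t"] h(2)
      by (intro G.inv_equality) (simp_all add: matrix_group_def)
    then show ?case using gen_base[of i J u "- t", OF h(1)] by simp
  next
    case (eng h1 h2)
    then show ?case using gen_mult by (simp add: matrix_group_def)
  qed
next
  fix x assume "x \<in> gen u J"
  then show "x \<in> generate (matrix_group (grp D)) {u i t | i t. i \<in> J}"
  proof (induction rule: gen.induct)
    case gen_one
    show ?case using generate.one[of "matrix_group (grp D)"] by (simp add: matrix_group_def)
  next
    case (gen_step i g t)
    have "u i t \<in> generate (matrix_group (grp D)) {u i t | i t. i \<in> J}"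
      using gen_step(1) by (intro generate.incl) blast
    from generate.eng[OF this gen_step(3)] show ?case by (simp add: matrix_group_def)
  qed
qed

lemma N_pos_eq: "N_pos D = gen (\<lambda>i t. emb D i (mat2 1 t 0 1)) (index_set D)"
  and N_neg_eq: "N_neg D = gen (\<lambda>i t. emb D i (mat2 1 0 t 1)) (index_set D)"
  using generate_eq_gen[of "index_set D" "x_pos D"] generate_eq_gen[of "index_set D" "x_neg D"]
    root_subgroupD(4,5)[OF emb_facts(4)] root_subgroupD(4,5)[OF emb_facts(5)]
  unfolding N_pos_def N_neg_def
  by (simp_all add: x_pos_def[abs_def] x_neg_def[abs_def])

lemma gen_subset_grp: "(\<And>i t. i \<in> J \<Longrightarrow> u i t \<in> grp D) \<Longrightarrow> gen u J \<subseteq> grp D"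
proof
  fix x assume u: "\<And>i t. i \<in> J \<Longrightarrow> u i t \<in> grp D" and "x \<in> gen u J"
  from this(2) show "x \<in> grp D" by induction (auto intro: grp_one grp_mult u)
qed

lemma N_pos_grp: "N_pos D \<subseteq> grp D" and N_neg_grp: "N_neg D \<subseteq> grp D"
  unfolding N_pos_eq N_neg_eq by (intro gen_subset_grp emb_facts(2); simp add: mat2_SL2)+

lemma word_bar_eq: "word_bar D ws = mat_prod (map (\<lambda>i. emb D i (mat2 0 (- 1) 1 0)) ws)"
  by (simp add: word_bar_def s_bar_def[abs_def])

lemma word_bar_grp: "set ws \<subseteq> index_set D \<Longrightarrow> word_bar D ws \<in> grp D"
  unfolding word_bar_eq
  by (induction ws) (auto intro!: grp_one grp_mult emb_facts(2) simp: mat2_SL2)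

lemma gauss_torus_eq:
  assumes "y \<in> N_neg D" "h \<in> torus D" "x \<in> N_pos D"
  shows "gauss_torus D (y ** h ** x) = h" "y ** h ** x \<in> gauss_cell D"
proof -
  show "y ** h ** x \<in> gauss_cell D" using assms unfolding gauss_cell_def by blast
  show "gauss_torus D (y ** h ** x) = h"
    unfolding gauss_torus_def
  proof (rule the_equality)
    show "h \<in> torus D \<and> (\<exists>y'\<in>N_neg D. \<exists>x'\<in>N_pos D. y ** h ** x = y' ** h ** x')"
      using assms by blast
    fix h' assume "h' \<in> torus D \<and> (\<exists>y'\<in>N_neg D. \<exists>x'\<in>N_pos D. y ** h ** x = y' ** h' ** x')"
    then obtain y' x' where "h' \<in> torus D" "y' \<in> N_neg D" "x' \<in> N_pos D" "y ** h ** x = y' ** h' ** x'"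
      by blast
    then show "h' = h"
      using gauss_torus_unique[of y y' x x' h h'] assms unfolding N_pos_eq N_neg_eq by simp
  qed
qed

section \<open>Weights and the Weyl group\<close>

lemma weight_char:
  shows weight_char_character: "weight_char D \<gamma> \<in> characters (torus D)"
    and weight_char_coroot: "i \<in> index_set D \<Longrightarrow> t \<noteq> 0 \<Longrightarrow> weight_char D \<gamma> (coroot D i t) = t powi \<gamma> i"
  using theI'[OF character_unique[of \<gamma>]] unfolding weight_char_def by blast+

lemma weight_char_nz: "h \<in> torus D \<Longrightarrow> weight_char D \<gamma> h \<noteq> 0"
  and weight_char_mult: "g \<in> torus D \<Longrightarrow> h \<in> torus D \<Longrightarrow>
    weight_char D \<gamma> (g ** h) = weight_char D \<gamma> g * weight_char D \<gamma> h"
  using weight_char_character[of \<gamma>] by (simp_all add: characters_def)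

lemma weight_char_one: "weight_char D \<gamma> (mat 1) = 1"
  using weight_char_mult[of "mat 1" "mat 1" \<gamma>] weight_char_nz[of "mat 1" \<gamma>] torus_one by simp

lemma word_act_simps [simp]: "word_act D [] \<gamma> = \<gamma>" "word_act D (i # ws) \<gamma> = reflection D i (word_act D ws \<gamma>)"
  "word_act D (us @ ws) \<gamma> = word_act D us (word_act D ws \<gamma>)"
  by (simp_all add: word_act_def)

text \<open>The relation between the coroot and the root subgroup inside SL2 gives x_i(4) as the
  conjugate of x_i(1) by the coroot at 2. Injectivity of x_i turns this into 2^a = 4 for the
  diagonal entry a.\<close>

lemma cartan_diagonal:
  assumes i: "i \<in> index_set D"
  shows "cartan D i i = 2"
proof -
  have k: "coroot D i 2 \<in> torus D" using emb_facts(3)[OF i] by simp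
  have "coroot D i 2 ** x_pos D i 1 = x_pos D i (\<alpha> i (coroot D i 2)) ** coroot D i 2"
    using root_subgroupD(6)[OF emb_facts(4)[OF i] k, of 1] by simp
  moreover have "coroot D i 2 ** x_pos D i 1 = x_pos D i 4 ** coroot D i 2"
  proof -
    have "coroot D i 2 ** x_pos D i 1 = emb D i (mat2 2 2 0 (1 / 2))"
      unfolding coroot_def x_pos_def using i by (intro E_mult_eq) simp_all
    also have "\<dots> = x_pos D i 4 ** coroot D i 2"
      unfolding coroot_def x_pos_def using i by (intro E_mult_eq[symmetric]) simp_all
    finally show ?thesis .
  qed
  ultimately have "x_pos D i (\<alpha> i (coroot D i 2)) ** (coroot D i 2 ** matrix_inv (coroot D i 2))
      = x_pos D i 4 ** (coroot D i 2 ** matrix_inv (coroot D i 2))"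
    by (simp add: matrix_mul_assoc)
  then have "x_pos D i (\<alpha> i (coroot D i 2)) = x_pos D i 4"
    by (simp add: matrix_inv(1)[OF torus_invertible[OF k]])
  moreover have "inj (x_pos D i)" using emb_facts(4)[OF i] by (simp add: root_subgroup_def)
  ultimately have "\<alpha> i (coroot D i 2) = 4" by (simp add: inj_eq)
  then have "(2::complex) powi cartan D i i = 2 powi 2" using root_coroot[OF i i, of 2] by simp
  then have "cmod (2 powi cartan D i i) = cmod (2 powi 2)" by (simp only:)
  then have "(2::real) powi cartan D i i = 2 powi 2" by (simp add: norm_power_int)
  then show ?thesis
    using power_int_strict_increasing[of "cartan D i i" 2 "2::real"]
      power_int_strict_increasing[of 2 "cartan D i i" "2::real"] by (cases "cartan D i i" "2::int" rule: linorder_cases) auto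
qed

lemma reflection_involution:
  assumes i: "i \<in> index_set D"
  shows "reflection D i (reflection D i \<gamma>) = \<gamma>"
  using i by (simp add: reflection_def root_weight_def cartan_diagonal fun_eq_iff algebra_simps)

lemma word_act_inj:
  "set ws \<subseteq> index_set D \<Longrightarrow> word_act D ws \<gamma> = word_act D ws \<delta> \<Longrightarrow> \<gamma> = \<delta>"
proof (induction ws)
  case (Cons i ws)
  then have i: "i \<in> index_set D" and "reflection D i (word_act D ws \<gamma>) = reflection D i (word_act D ws \<delta>)"
    by simp_all
  from arg_cong[OF this(2), of "reflection D i"] have "word_act D ws \<gamma> = word_act D ws \<delta>"
    unfolding reflection_involution[OF i] .
  then show ?case using Cons by simp
qed simp

lemma word_act_fixes: "l \<notin> set ws \<Longrightarrow> word_act D ws (fund_weight l) = fund_weight l"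
  by (induction ws) (auto simp: reflection_def fund_weight_def fun_eq_iff)

text \<open>The letter l occurs once, the other letters fix the weight l, and the prefix before l
  acts injectively. So only s_l could make a difference, and it does, because the diagonal Cartan
  entry is nonzero.\<close>

lemma cox_word_moves:
  assumes l: "l \<in> index_set D"
  shows "word_act D (cox_word D) (fund_weight l) \<noteq> fund_weight l"
proof
  assume eq: "word_act D (cox_word D) (fund_weight l) = fund_weight l"
  have split: "cox_word D = [1..<l] @ l # [Suc l..<Suc (rk D)]"
  proof -
    have "[1..<l + (Suc (rk D) - l)] = [1..<l] @ [l..<l + (Suc (rk D) - l)]"
      using l by (intro upt_add_eq_append) simp
    moreover have "[l..<Suc (rk D)] = l # [Suc l..<Suc (rk D)]"
      using l by (intro upt_conv_Cons) simp
    moreover have "l + (Suc (rk D) - l) = Suc (rk D)" using l by simp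
    ultimately show ?thesis by (simp only: cox_word_def)
  qed
  have "word_act D [1..<l] (reflection D l (fund_weight l)) = word_act D [1..<l] (fund_weight l)"
    using eq word_act_fixes[of l "[1..<l]"] word_act_fixes[of l "[Suc l..<Suc (rk D)]"]
    unfolding split by simp
  from word_act_inj[OF _ this] have "reflection D l (fund_weight l) = fund_weight l"
    using l by force
  then have "reflection D l (fund_weight l) l = fund_weight l l" by simp
  then show False using l by (simp add: reflection_def fund_weight_def root_weight_def cartan_diagonal)
qed

lemma set_cox_word: "set (cox_word D) = index_set D" "distinct (cox_word D)"
  by (auto simp: cox_word_def)

text \<open>A word that omits l fixes the weight l, whereas c moves it. Hence every word for c
  contains all indices and has at least n letters.\<close>

lemma reduced_cox_word: "reduced_word D (cox_word D)"
  unfolding reduced_word_def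
proof (intro conjI allI impI)
  show "set (cox_word D) \<subseteq> index_set D" by (simp add: set_cox_word)
  fix vs assume vs: "set vs \<subseteq> index_set D \<and> word_act D vs = word_act D (cox_word D)"
  have "index_set D \<subseteq> set vs"
    using cox_word_moves word_act_fixes vs by (metis subsetI)
  then have "card (index_set D) \<le> card (set vs)" by (intro card_mono) auto
  also have "\<dots> \<le> length vs" by (rule card_length)
  finally show "length (cox_word D) \<le> length vs" by (simp add: cox_word_def)
qed

lemma reduced_Nil: "reduced_word D []"
  by (simp add: reduced_word_def)

lemma reduced_word_exists:
  assumes "set ws \<subseteq> index_set D"
  obtains us where "reduced_word D us" "word_act D us = word_act D ws"
proof -
  define Q where "Q us \<longleftrightarrow> set us \<subseteq> index_set D \<and> word_act D us = word_act D ws" for us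
  have "Q ws" using assms by (simp add: Q_def)
  then obtain us where "Q us" "\<And>vs. Q vs \<Longrightarrow> length us \<le> length vs"
    using ex_has_least_nat[of Q ws length] by blast
  then show ?thesis using that[of us] unfolding Q_def reduced_word_def by simp
qed

text \<open>Generalized minors are specified along reduced words only, whereas the concatenated word
  for a power of c need not be reduced.\<close>

lemma Pi_setE:
  assumes "\<gamma> \<in> Pi_set D"
  obtains us i where "reduced_word D us" "i \<in> index_set D" "\<gamma> = word_act D us (fund_weight i)"
proof -
  obtain i m where i: "i \<in> index_set D" "\<gamma> = cox_pow D m (fund_weight i)"
    using assms unfolding Pi_set_def by blast
  have "\<exists>ws. set ws \<subseteq> index_set D \<and> cox_pow D m = word_act D ws"
  proof (induction m)
    case 0
    show ?case by (intro exI[of _ "[]"]) (simp add: cox_pow_def fun_eq_iff)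
  next
    case (Suc m)
    then obtain ws where "set ws \<subseteq> index_set D" "cox_pow D m = word_act D ws" by blast
    then have "cox_pow D (Suc m) \<delta> = word_act D (cox_word D @ ws) \<delta>" for \<delta>
      by (simp add: cox_pow_def)
    with \<open>set ws \<subseteq> index_set D\<close> show ?case
      by (intro exI[of _ "cox_word D @ ws"]) (simp add: set_cox_word fun_eq_iff)
  qed
  then obtain ws where "set ws \<subseteq> index_set D" "cox_pow D m = word_act D ws" by blast
  then obtain us where "reduced_word D us" "word_act D us = cox_pow D m"
    using reduced_word_exists[of ws] by metis
  then show ?thesis using that[of us i] i by simp
qed

end

context pinned
begin

section \<open>Generalized minors on the double cell\<close>

lemma L_cell_grp: "L_cell D \<subseteq> grp D"
proof
  fix g assume "g \<in> L_cell D"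
  then obtain a b where "g = a ** word_bar D (cox_word D) ** b" "a \<in> N_pos D" "b \<in> N_pos D"
    unfolding L_cell_def by blast
  then show "g \<in> grp D"
    using N_pos_grp word_bar_grp[of "cox_word D"] by (auto intro!: grp_mult simp: set_cox_word)
qed

text \<open>Consequently \<open>\<Delta>\<close> with indices \<open>\<omega>\<^sub>i\<close> and \<open>c \<omega>\<^sub>i\<close> vanishes nowhere on the cell, which makes
  \<open>y\<^bsub>j;c\<^esub>\<close> regular there.\<close>

lemma L_cell_gauss:
  assumes "g \<in> L_cell D"
  shows "\<exists>y\<in>N_neg D. \<exists>h\<in>torus D. \<exists>x\<in>N_pos D. g ** word_bar D (cox_word D) = y ** h ** x"
proof -
  let ?c = "cox_word D"
  obtain h1 y1 h2 y2 where g: "g = (h1 ** y1) ** word_bar D (rev ?c) ** (h2 ** y2)"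
    and h: "h1 \<in> torus D" "h2 \<in> torus D" and y: "y1 \<in> N_neg D" "y2 \<in> N_neg D"
    using assms unfolding L_cell_def B_neg_def by blast
  let ?S = "word_bar D ?c" and ?R = "word_bar D (rev ?c)"
  obtain h3 where h3: "h3 \<in> torus D" "?R ** h2 = h3 ** ?R"
    using s_word_stable[of "rev ?c" "torus D", OF T_s h(2)] by (auto simp: word_bar_eq set_cox_word)
  obtain y3 x3 h4 where 3: "y3 \<in> N_neg D" "x3 \<in> N_pos D" "h4 \<in> torus D" "?R ** y2 ** ?S = y3 ** x3 ** h4"
    using s_word_conj_neg[of ?c y2] y(2) set_cox_word unfolding word_bar_eq N_neg_eq N_pos_eq by auto
  obtain x4 where x4: "x4 \<in> N_pos D" "x3 ** h4 = h4 ** x4"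
    using gen_T_conj'[OF order_refl 3(3)] 3(2) unfolding N_pos_eq by blast
  obtain y5 where y5: "y5 \<in> N_neg D" "(h1 ** y1 ** h3) ** y3 = y5 ** (h1 ** h3)"
  proof -
    obtain a where a: "a \<in> N_neg D" "h3 ** y3 = a ** h3"
      using opp.gen_T_conj[OF order_refl h3(1)] 3(1) unfolding N_neg_eq by blast
    obtain b where b: "b \<in> N_neg D" "h1 ** (y1 ** a) = b ** h1"
      using opp.gen_T_conj[OF order_refl h(1)] gen_mult y(1) a(1) unfolding N_neg_eq by blast
    have "(h1 ** y1 ** h3) ** y3 = h1 ** y1 ** (h3 ** y3)" by (simp only: matrix_mul_assoc)
    also have "\<dots> = (h1 ** (y1 ** a)) ** h3" unfolding a(2) by (simp only: matrix_mul_assoc)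
    also have "\<dots> = b ** (h1 ** h3)" unfolding b(2) by (simp only: matrix_mul_assoc)
    finally show ?thesis using that b(1) by blast
  qed
  have "g ** ?S = h1 ** y1 ** (?R ** h2) ** y2 ** ?S" unfolding g by (simp only: matrix_mul_assoc)
  also have "\<dots> = h1 ** y1 ** h3 ** (?R ** y2 ** ?S)" unfolding h3(2) by (simp only: matrix_mul_assoc)
  also have "\<dots> = (h1 ** y1 ** h3 ** y3) ** (x3 ** h4)" unfolding 3(4) by (simp only: matrix_mul_assoc)
  also have "\<dots> = y5 ** (h1 ** h3 ** h4) ** x4" unfolding y5(2) x4(2) by (simp only: matrix_mul_assoc)
  finally show ?thesis using y5(1) x4(1) torus_mult h(1) h3(1) 3(3) by blast
qed

definition cell_point :: "(nat \<Rightarrow> complex) \<Rightarrow> 'm cmat" where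
  "cell_point t = mat_prod (map (\<lambda>i. x_neg D i 1) [1..<Suc (rk D)] @
                     map (\<lambda>i. x_pos D i (t i)) (rev [1..<Suc (rk D)]))"

lemma mat_prod_gen: "set ws \<subseteq> J \<Longrightarrow> mat_prod (map (\<lambda>i. u i (t i)) ws) \<in> gen u J"
  by (induction ws) (auto intro: gen_one gen_step)

lemma cell_point_factors:
  obtains y x where "y \<in> N_neg D" "x \<in> N_pos D" "cell_point t = y ** x"
    "y = mat_prod (map (\<lambda>i. emb D i (mat2 1 0 1 1)) (cox_word D))"
    "x = mat_prod (map (\<lambda>i. emb D i (mat2 1 (t i) 0 1)) (rev (cox_word D)))"
proof
  show "mat_prod (map (\<lambda>i. emb D i (mat2 1 0 1 1)) (cox_word D)) \<in> N_neg D"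
    unfolding N_neg_eq
    by (rule mat_prod_gen[of _ _ "\<lambda>i t. emb D i (mat2 1 0 t 1)" "\<lambda>_. 1"]) (simp add: set_cox_word)
  show "mat_prod (map (\<lambda>i. emb D i (mat2 1 (t i) 0 1)) (rev (cox_word D))) \<in> N_pos D"
    unfolding N_pos_eq
    by (rule mat_prod_gen[of _ _ "\<lambda>i t. emb D i (mat2 1 t 0 1)" t]) (simp add: set_cox_word)
qed (simp_all add: cell_point_def cox_word_def x_neg_def x_pos_def)

lemma cell_point_grp: "cell_point t \<in> grp D"
proof -
  obtain y x where "y \<in> N_neg D" "x \<in> N_pos D" "cell_point t = y ** x"
    using cell_point_factors .
  then show ?thesis using N_neg_grp N_pos_grp grp_mult by auto
qed

text \<open>The decomposition for the opposite group produces the lifts s', while the double cell is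
  defined with the lifts s. They differ by k_i(-1).\<close>

lemma s'_word:
  assumes "set ws \<subseteq> index_set D"
  shows "\<exists>h\<in>torus D. mat_prod (map (\<lambda>i. emb D i (mat2 0 1 (- 1) 0)) ws) = h ** word_bar D ws"
  using assms
proof (induction ws)
  case Nil
  show ?case using torus_one by (auto simp: word_bar_eq)
next
  case (Cons i ws)
  then obtain h where h: "h \<in> torus D"
    "mat_prod (map (\<lambda>i. emb D i (mat2 0 1 (- 1) 0)) ws) = h ** word_bar D ws" by auto
  have i: "i \<in> index_set D" using Cons.prems by simp
  let ?s' = "emb D i (mat2 0 1 (- 1) 0)" and ?s = "emb D i (mat2 0 (- 1) 1 0)"
    and ?k = "emb D i (mat2 (- 1) 0 0 (1 / (- 1)))"
  obtain h' where h': "h' \<in> torus D" "?s ** h = h' ** ?s" using T_s[OF i h(1)] by blast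
  have s': "?s' = ?k ** ?s" using i by (intro E_mult_eq[symmetric]) simp_all
  have "mat_prod (map (\<lambda>i. emb D i (mat2 0 1 (- 1) 0)) (i # ws)) = ?k ** (?s ** h) ** word_bar D ws"
    by (simp add: h(2) s' matrix_mul_assoc)
  also have "\<dots> = (?k ** h') ** word_bar D (i # ws)"
    unfolding h'(2) by (simp add: word_bar_eq matrix_mul_assoc)
  finally show ?case using torus_mult k_in_T[OF i, of "- 1"] h'(1) by auto
qed

lemma cell_point_in_L_cell:
  assumes t: "\<And>i. i \<in> index_set D \<Longrightarrow> t i \<noteq> 0"
  shows "cell_point t \<in> L_cell D"
proof -
  let ?c = "cox_word D"
  have cI: "set ?c \<subseteq> index_set D" "distinct ?c" "set (rev ?c) \<subseteq> index_set D" "distinct (rev ?c)"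
    by (simp_all add: set_cox_word)
  obtain y x where yx: "y \<in> N_neg D" "x \<in> N_pos D" "cell_point t = y ** x"
    and y: "y = mat_prod (map (\<lambda>i. emb D i (mat2 1 0 1 1)) ?c)"
    and x: "x = mat_prod (map (\<lambda>i. emb D i (mat2 1 (t i) 0 1)) (rev ?c))"
    using cell_point_factors .
  \<comment> \<open>All parameters of the negative factor are 1, so the torus part is trivial and
    this factor lies in N c N itself; the positive factor is absorbed on the right.\<close>
  obtain X h Y where 1: "X \<in> N_pos D" "h \<in> {mat 1}" "Y \<in> N_pos D" "y = X ** h ** word_bar D ?c ** Y"
    using f_word_double_coset[of "{mat 1}" ?c "\<lambda>_. 1"] cI torus_one E_one
      gen_mono[of _ _ "set ?c" "index_set D"]
    unfolding y word_bar_eq N_pos_eq by (auto simp: set_cox_word)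
  have "cell_point t = X ** word_bar D ?c ** (Y ** x)"
    unfolding yx(3) using 1(2,4) by (simp add: matrix_mul_assoc)
  moreover have "Y ** x \<in> N_pos D" using 1(3) yx(2) gen_mult unfolding N_pos_eq by blast
  ultimately have A: "cell_point t \<in> {a ** word_bar D ?c ** b | a b. a \<in> N_pos D \<and> b \<in> N_pos D}"
    using 1(1) by blast
  have nz: "t i \<noteq> 0" if "i \<in> set (rev ?c)" for i using t that by (simp add: set_cox_word)
  have kT: "emb D i (mat2 (1 / (1 / t i)) 0 0 (1 / t i)) \<in> torus D" if "i \<in> set (rev ?c)" for i
    using k_in_T[of i "t i"] t[of i] that by (simp add: set_cox_word)
  \<comment> \<open>The opposite statement applied to the positive factor with the reversed word.
    The parameters t_i enter the torus part and must be nonzero.\<close>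
  obtain X' h' Y' where 2: "X' \<in> N_neg D" "h' \<in> torus D" "Y' \<in> N_neg D"
    "x = X' ** h' ** mat_prod (map (\<lambda>i. emb D i (mat2 0 1 (- 1) 0)) (rev ?c)) ** Y'"
    using opp.f_word_double_coset[of "torus D" "rev ?c" t, OF order_refl torus_one torus_mult opp.T_s nz _ cI(4,3)]
      kT gen_mono[of _ _ "set (rev ?c)" "index_set D"]
    unfolding x N_neg_eq by (auto simp: set_cox_word)
  obtain h3 where h3: "h3 \<in> torus D"
    "mat_prod (map (\<lambda>i. emb D i (mat2 0 1 (- 1) 0)) (rev ?c)) = h3 ** word_bar D (rev ?c)"
    using s'_word[OF cI(3)] by blast
  obtain y2 where y2: "y2 \<in> N_neg D" "(y ** X') ** (h' ** h3) = (h' ** h3) ** y2"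
    using opp.gen_T_conj'[OF order_refl torus_mult[OF 2(2) h3(1)], of "y ** X'"] gen_mult yx(1) 2(1)
    unfolding N_neg_eq by blast
  have "cell_point t = ((y ** X') ** (h' ** h3)) ** word_bar D (rev ?c) ** Y'"
    unfolding yx(3) 2(4) h3(2) by (simp only: matrix_mul_assoc)
  also have "\<dots> = ((h' ** h3) ** y2) ** word_bar D (rev ?c) ** (mat 1 ** Y')"
    unfolding y2(2) by simp
  finally have "cell_point t \<in> {a ** word_bar D (rev ?c) ** b | a b. a \<in> B_neg D \<and> b \<in> B_neg D}"
    unfolding B_neg_def using torus_mult[OF 2(2) h3(1)] y2(1) 2(3) torus_one by blast
  with A show ?thesis unfolding L_cell_def by blast
qed

section \<open>Fundamental weights on the torus part of the Gauss decomposition\<close>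

lemma tau_cong:
  "(\<And>l. l \<in> set ws \<Longrightarrow> u l = v l) \<Longrightarrow> tau ws u = tau ws v"
proof (induction ws arbitrary: u v)
  case (Cons j ws)
  have j: "u j = v j" using Cons.prems by simp
  have "tau ws (\<lambda>i. u i / h i) = tau ws (\<lambda>i. v i / h i)" for h
    by (rule Cons.IH) (simp add: Cons.prems)
  then show ?case by (simp add: j)
qed simp

lemma weight_char_tau:
  assumes "distinct (j # ws)" "set (j # ws) \<subseteq> index_set D" "\<And>l. l \<in> set (j # ws) \<Longrightarrow> t l \<noteq> 0"
  shows "weight_char D (fund_weight i) (tau (j # ws) t) =
    (if i = j then t j else 1) * weight_char D (fund_weight i) (tau ws (\<lambda>l. t l / t j powi cartan D j l))"
proof -
  have j: "j \<in> index_set D" "t j \<noteq> 0" using assms by auto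
  let ?t = "\<lambda>l. t l / \<alpha> l (coroot D j (t j))"
  have eq: "tau ws ?t = tau ws (\<lambda>l. t l / t j powi cartan D j l)"
    using assms(2) by (intro tau_cong) (auto simp: root_coroot[OF j(1) _ j(2)])
  have T: "tau ws ?t \<in> torus D"
    using assms emb_facts(3)[OF j] simple_root_nz by (intro tau_in_T) auto
  have "tau (j # ws) t = coroot D j (t j) ** tau ws ?t" by (simp add: coroot_def)
  then show ?thesis
    using weight_char_mult[OF emb_facts(3)[OF j] T] weight_char_coroot[OF j] eq
    by (simp add: fund_weight_def)
qed

lemma weight_char_tau_other:
  assumes "distinct ws" "set ws \<subseteq> index_set D" "\<And>l. l \<in> set ws \<Longrightarrow> t l \<noteq> 0" "i \<notin> set ws"
  shows "weight_char D (fund_weight i) (tau ws t) = 1"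
  using assms
proof (induction ws arbitrary: t)
  case (Cons j ws)
  then show ?case using weight_char_tau[OF Cons.prems(1-3), where i=i]
    by (auto simp: power_int_not_zero intro!: Cons.IH)
qed (simp add: weight_char_one)

text \<open>Splitting off the smallest letter k divides t_j by t_k to the Cartan exponent a_kj. The
  weight k takes the value t_k on the whole torus element, since the remaining coroots do not see
  it, so the factor for i = k in the product restores t_j.\<close>

lemma weight_char_tau_prod:
  assumes "distinct ws" "set ws \<subseteq> index_set D" "\<And>l. l \<in> set ws \<Longrightarrow> t l \<noteq> 0" "sorted ws" "j \<in> set ws"
  shows "weight_char D (fund_weight j) (tau ws t) *
    (\<Prod>i\<in>{i \<in> set ws. i < j}. weight_char D (fund_weight i) (tau ws t) powi cartan D i j) = t j"
  using assms
proof (induction ws arbitrary: t)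
  case (Cons k ws)
  let ?t = "\<lambda>l. t l / t k powi cartan D k l"
  let ?w = "\<lambda>i. weight_char D (fund_weight i)"
  have rec: "?w i (tau (k # ws) t) = (if i = k then t k else 1) * ?w i (tau ws ?t)" for i
    by (rule weight_char_tau[OF Cons.prems(1,2)]) (rule Cons.prems(3))
  have k: "k \<in> index_set D" "t k \<noteq> 0" "k \<notin> set ws" "distinct ws" "set ws \<subseteq> index_set D"
    using Cons.prems by auto
  have t': "?t l \<noteq> 0" if "l \<in> set ws" for l using Cons.prems(3)[of l] that k(2) by (simp add: power_int_not_zero)
  have wk: "?w k (tau ws ?t) = 1" by (rule weight_char_tau_other[OF k(4,5) t' k(3)])
  show ?case
  proof (cases "j = k")
    case True
    have empty: "{i \<in> set (k # ws). i < k} = {}" using Cons.prems(4) by auto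
    show ?thesis unfolding empty True rec[of k] wk by simp
  next
    case False
    then have j: "j \<in> set ws" "k < j" using Cons.prems k(3) by auto
    have split: "{i \<in> set (k # ws). i < j} = insert k {i \<in> set ws. i < j}" using j(2) by auto
    have "(\<Prod>i\<in>{i \<in> set ws. i < j}. ?w i (tau (k # ws) t) powi cartan D i j) =
        (\<Prod>i\<in>{i \<in> set ws. i < j}. ?w i (tau ws ?t) powi cartan D i j)"
      using k(3) by (intro prod.cong refl) (auto simp: rec simp del: tau.simps)
    then have "?w j (tau (k # ws) t) * (\<Prod>i\<in>{i \<in> set (k # ws). i < j}. ?w i (tau (k # ws) t) powi cartan D i j)
        = t k powi cartan D k j * (?w j (tau ws ?t) * (\<Prod>i\<in>{i \<in> set ws. i < j}. ?w i (tau ws ?t) powi cartan D i j))"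
      unfolding split using k(3) False by (simp add: rec wk del: tau.simps)
    also have "\<dots> = t k powi cartan D k j * ?t j"
      using Cons.IH[OF k(4,5) t' _ j(1)] Cons.prems(4) by simp
    also have "\<dots> = t j" using k(2) by (simp add: power_int_not_zero)
    finally show ?thesis .
  qed
qed simp

end

section \<open>Minors as functions on the cell, and their values at the chosen point\<close>

locale pinned_minors = pinned D for D :: "('m::finite) pinned_group" +
  fixes \<Delta> :: "weight \<Rightarrow> weight \<Rightarrow> 'm cmat \<Rightarrow> complex"
  assumes minors: "generalized_minors D \<Delta>"
begin

lemma minor_regular:
  assumes "reduced_word D us" "reduced_word D vs" "i \<in> index_set D"
  shows "regular_on (grp D) (\<Delta> (word_act D us (fund_weight i)) (word_act D vs (fund_weight i)))"
  using minors assms unfolding generalized_minors_def by simp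

lemma minor_gauss:
  assumes vs: "reduced_word D vs" and i: "i \<in> index_set D" and g: "g \<in> grp D"
    and dec: "y \<in> N_neg D" "h \<in> torus D" "x \<in> N_pos D" "g ** word_bar D vs = y ** h ** x"
  shows "\<Delta> (fund_weight i) (word_act D vs (fund_weight i)) g = weight_char D (fund_weight i) h"
proof -
  have one: "matrix_inv (word_bar D []) = mat 1"
    by (rule matrix_invI) (simp add: word_bar_eq)
  have "matrix_inv (word_bar D []) ** g ** word_bar D vs = y ** h ** x" by (simp add: one dec(4))
  then show ?thesis
    using minors reduced_Nil vs i g gauss_torus_eq[OF dec(1-3)] unfolding generalized_minors_def
    by (metis word_act_simps(1))
qed

lemma x_fun_in_ring:
  assumes "\<gamma> = word_act D us (fund_weight i)" "reduced_word D us" "i \<in> index_set D"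
  shows "x_fun D \<Delta> \<gamma> \<in> coordinate_ring (L_cell D)"
  unfolding x_fun_def
  using regular_on_subset[OF minor_regular[OF assms(2,2,3)] L_cell_grp] assms(1)
  by (simp add: coordinate_ringI)

lemma cox_minor_nz:
  assumes "i \<in> index_set D" "g \<in> L_cell D"
  shows "\<Delta> (fund_weight i) (cox_pow D 1 (fund_weight i)) g \<noteq> 0"
proof -
  obtain y h x where "y \<in> N_neg D" "h \<in> torus D" "x \<in> N_pos D" "g ** word_bar D (cox_word D) = y ** h ** x"
    using L_cell_gauss[OF assms(2)] by blast
  with minor_gauss[OF reduced_cox_word assms(1)] assms(2) L_cell_grp weight_char_nz show ?thesis
    by (auto simp: cox_pow_def)
qed

lemma y_fun_in_ring:
  assumes "j \<in> index_set D"
  shows "y_fun D \<Delta> j \<in> coordinate_ring (L_cell D)"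
proof -
  have "regular_on (L_cell D) (\<Delta> (fund_weight i) (cox_pow D 1 (fund_weight i)))" if "i \<in> index_set D" for i
    using regular_on_subset[OF minor_regular[OF reduced_Nil reduced_cox_word that] L_cell_grp]
    by (simp add: cox_pow_def)
  then show ?thesis
    unfolding y_fun_def using assms cox_minor_nz
    by (intro coordinate_ringI regular_on_mult regular_on_prod regular_on_powi) auto
qed

lemma x_fun_cell_point:
  assumes t: "\<And>i. i \<in> index_set D \<Longrightarrow> t i \<noteq> 0" and i: "i \<in> index_set D"
  shows "x_fun D \<Delta> (fund_weight i) (cell_point t) = 1"
proof -
  obtain y x where yx: "y \<in> N_neg D" "x \<in> N_pos D" "cell_point t = y ** x"
    using cell_point_factors .
  have "\<Delta> (fund_weight i) (word_act D [] (fund_weight i)) (cell_point t) = weight_char D (fund_weight i) (mat 1)"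
    by (rule minor_gauss[OF reduced_Nil i cell_point_grp yx(1) torus_one yx(2)])
       (simp add: yx(3) word_bar_eq)
  then show ?thesis using cell_point_in_L_cell[OF t] by (simp add: x_fun_def weight_char_one)
qed

lemma y_fun_cell_point:
  assumes t: "\<And>i. i \<in> index_set D \<Longrightarrow> t i \<noteq> 0" and j: "j \<in> index_set D"
  shows "y_fun D \<Delta> j (cell_point t) = t j"
proof -
  let ?c = "cox_word D" and ?w = "\<lambda>i. weight_char D (fund_weight i) (tau (cox_word D) t)"
  obtain y x where yx: "y \<in> N_neg D" "x \<in> N_pos D" "cell_point t = y ** x"
    "x = mat_prod (map (\<lambda>i. emb D i (mat2 1 (t i) 0 1)) (rev ?c))"
    using cell_point_factors .
  obtain y1 x1 where 1: "y1 \<in> N_neg D" "x1 \<in> N_pos D" "x ** word_bar D ?c = y1 ** tau ?c t ** x1"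
    using e_word_gauss[of ?c t] t set_cox_word unfolding yx(4) word_bar_eq N_neg_eq N_pos_eq by auto
  have T: "tau ?c t \<in> torus D" using t by (intro tau_in_T) (auto simp: set_cox_word)
  have dec: "cell_point t ** word_bar D ?c = (y ** y1) ** tau ?c t ** x1"
    unfolding yx(3) matrix_mul_assoc[of y x, symmetric] 1(3) by (simp only: matrix_mul_assoc)
  have yy: "y ** y1 \<in> N_neg D" using gen_mult yx(1) 1(1) unfolding N_neg_eq by blast
  have minor: "\<Delta> (fund_weight i) (cox_pow D 1 (fund_weight i)) (cell_point t) = ?w i" if "i \<in> index_set D" for i
    using minor_gauss[OF reduced_cox_word that cell_point_grp yy T 1(2) dec] by (simp add: cox_pow_def)
  have "y_fun D \<Delta> j (cell_point t) = \<Delta> (fund_weight j) (cox_pow D 1 (fund_weight j)) (cell_point t) *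
      (\<Prod>i\<in>{i \<in> index_set D. prec D i j}.
        \<Delta> (fund_weight i) (cox_pow D 1 (fund_weight i)) (cell_point t) powi cartan D i j)"
    unfolding y_fun_def by (rule restrict_apply') (rule cell_point_in_L_cell[OF t])
  also have "\<dots> = ?w j * (\<Prod>i\<in>{i \<in> index_set D. prec D i j}. ?w i powi cartan D i j)"
    unfolding minor[OF j] by (intro arg_cong2[where f="(*)"] prod.cong refl) (simp only: minor mem_Collect_eq)
  \<comment> \<open>Indices i < j with Cartan entry 0 may be added, as they contribute the exponent
    0.\<close>
  also have "(\<Prod>i\<in>{i \<in> index_set D. prec D i j}. ?w i powi cartan D i j) =
      (\<Prod>i\<in>{i \<in> index_set D. i < j}. ?w i powi cartan D i j)"
    by (intro prod.mono_neutral_left) (auto simp: prec_def)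
  also have "?w j * \<dots> = t j"
  proof -
    have "sorted ?c" by (simp add: cox_word_def del: upt_Suc)
    from weight_char_tau_prod[of ?c t j, OF set_cox_word(2) _ _ this] t j show ?thesis
      unfolding set_cox_word(1) by blast
  qed
  finally show ?thesis .
qed

end

section \<open>Evaluation of rational functions at a point\<close>

locale function_field =
  fixes S :: "'m::finite cmat set" and \<iota> :: "('m cmat \<Rightarrow> complex) \<Rightarrow> 'k::field" and p :: "'m cmat"
  assumes frac: "fraction_field S \<iota>" and p: "p \<in> S"
begin

abbreviation "R \<equiv> coordinate_ring S"

text \<open>Says that z lies in the local ring at p and has the value v there. A relation fits
  because elements of the field need not be regular at p; the fraction is written without division
  in the field.\<close>

definition value_at :: "'k \<Rightarrow> complex \<Rightarrow> bool" where
  "value_at z v \<longleftrightarrow> (\<exists>f\<in>R. \<exists>q\<in>R. q p \<noteq> 0 \<and> z * \<iota> q = \<iota> f \<and> v = f p / q p)"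

lemma ring_closed:
  assumes "f \<in> R" "g \<in> R"
  shows "(\<lambda>x\<in>S. f x + g x) \<in> R" "(\<lambda>x\<in>S. f x * g x) \<in> R"
proof -
  have "regular_on S f" "regular_on S g" using assms unfolding coordinate_ring_def by blast+
  then show "(\<lambda>x\<in>S. f x + g x) \<in> R" "(\<lambda>x\<in>S. f x * g x) \<in> R"
    using coordinate_ringI regular_on_add regular_on_mult by blast+
qed

lemma const_closed: "(\<lambda>x\<in>S. c) \<in> R"
  by (intro coordinate_ringI regular_on_const)

lemma
  assumes "f \<in> R" "g \<in> R"
  shows \<iota>_add: "\<iota> (\<lambda>x\<in>S. f x + g x) = \<iota> f + \<iota> g"
    and \<iota>_mult: "\<iota> (\<lambda>x\<in>S. f x * g x) = \<iota> f * \<iota> g"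
    and \<iota>_inj: "\<iota> f = \<iota> g \<Longrightarrow> f = g"
proof -
  show "\<iota> (\<lambda>x\<in>S. f x + g x) = \<iota> f + \<iota> g" "\<iota> (\<lambda>x\<in>S. f x * g x) = \<iota> f * \<iota> g"
    using frac assms unfolding fraction_field_def by simp_all
  have "inj_on \<iota> (R)" using frac unfolding fraction_field_def by simp
  then show "f = g" if "\<iota> f = \<iota> g" using inj_onD that assms by metis
qed

lemma \<iota>_one: "\<iota> (\<lambda>x\<in>S. 1) = 1"
  using frac unfolding fraction_field_def by blast

lemma \<iota>_zero: "\<iota> (\<lambda>x\<in>S. 0) = 0"
proof -
  have "(\<lambda>x\<in>S. (\<lambda>x\<in>S. 0::complex) x + (\<lambda>x\<in>S. 0) x) = (\<lambda>x\<in>S. 0)" by (simp add: fun_eq_iff restrict_def)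
  then have "\<iota> (\<lambda>x\<in>S. 0) = \<iota> (\<lambda>x\<in>S. 0) + \<iota> (\<lambda>x\<in>S. 0)"
    using \<iota>_add[OF const_closed const_closed, of 0 0] by simp
  then show ?thesis by (simp only: add_cancel_right_right)
qed

lemma \<iota>_nz:
  assumes "q \<in> R" "q p \<noteq> 0"
  shows "\<iota> q \<noteq> 0"
proof
  assume "\<iota> q = 0"
  then have "q = (\<lambda>x\<in>S. 0)" using \<iota>_inj[OF assms(1) const_closed] \<iota>_zero by simp
  then show False using assms(2) p by simp
qed

text \<open>Two presentations of z give the same element after cross-multiplication; injectivity of
  \<open>\<iota>\<close> makes this an equality of functions on S, which can be evaluated at
  p.\<close>

lemma value_at_unique:
  assumes "value_at z v" "value_at z v'"
  shows "v = v'"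
proof -
  obtain f q where f: "f \<in> R" "q \<in> R" "q p \<noteq> 0" "z * \<iota> q = \<iota> f" "v = f p / q p"
    using assms(1) unfolding value_at_def by blast
  obtain f' q' where f': "f' \<in> R" "q' \<in> R" "q' p \<noteq> 0" "z * \<iota> q' = \<iota> f'" "v' = f' p / q' p"
    using assms(2) unfolding value_at_def by blast
  have "\<iota> f * \<iota> q' = \<iota> f' * \<iota> q" unfolding f(4)[symmetric] f'(4)[symmetric] by (simp add: mult_ac)
  then have "\<iota> (\<lambda>x\<in>S. f x * q' x) = \<iota> (\<lambda>x\<in>S. f' x * q x)" using f f' by (simp add: \<iota>_mult)
  then have "(\<lambda>x\<in>S. f x * q' x) = (\<lambda>x\<in>S. f' x * q x)" using f f' by (intro \<iota>_inj ring_closed)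
  from fun_cong[OF this, of p] have "f p * q' p = f' p * q p" using p by simp
  then show ?thesis using f(3,5) f'(3,5) by (simp add: frac_eq_eq)
qed

lemma value_at_ring: "f \<in> R \<Longrightarrow> value_at (\<iota> f) (f p)"
  unfolding value_at_def
  by (rule bexI[of _ f], rule bexI[of _ "\<lambda>x\<in>S. 1"]) (simp_all add: p const_closed \<iota>_one)

lemma value_at_one: "value_at 1 1"
  using value_at_ring[OF const_closed, of 1] p by (simp add: \<iota>_one)

lemma value_at_zero: "value_at 0 0"
  using value_at_ring[OF const_closed, of 0] p by (simp add: \<iota>_zero)

lemma value_at_mult:
  assumes "value_at z v" "value_at z' v'"
  shows "value_at (z * z') (v * v')"
proof -
  obtain f q where f: "f \<in> R" "q \<in> R" "q p \<noteq> 0" "z * \<iota> q = \<iota> f" "v = f p / q p"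
    using assms(1) unfolding value_at_def by blast
  obtain f' q' where f': "f' \<in> R" "q' \<in> R" "q' p \<noteq> 0" "z' * \<iota> q' = \<iota> f'" "v' = f' p / q' p"
    using assms(2) unfolding value_at_def by blast
  have "z * z' * \<iota> (\<lambda>x\<in>S. q x * q' x) = \<iota> (\<lambda>x\<in>S. f x * f' x)"
    using f f' by (simp add: \<iota>_mult mult_ac flip: f(4) f'(4))
  then show ?thesis unfolding value_at_def using f f' p
    by (rule_tac bexI[OF _ ring_closed(2)[OF f(1) f'(1)]], rule_tac bexI[OF _ ring_closed(2)[OF f(2) f'(2)]]) simp
qed

lemma value_at_add:
  assumes "value_at z v" "value_at z' v'"
  shows "value_at (z + z') (v + v')"
proof -
  obtain f q where f: "f \<in> R" "q \<in> R" "q p \<noteq> 0" "z * \<iota> q = \<iota> f" "v = f p / q p"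
    using assms(1) unfolding value_at_def by blast
  obtain f' q' where f': "f' \<in> R" "q' \<in> R" "q' p \<noteq> 0" "z' * \<iota> q' = \<iota> f'" "v' = f' p / q' p"
    using assms(2) unfolding value_at_def by blast
  let ?a = "\<lambda>x\<in>S. f x * q' x" and ?b = "\<lambda>x\<in>S. f' x * q x"
  have r: "?a \<in> R" "?b \<in> R" using ring_closed f f' by blast+
  have "(z + z') * \<iota> (\<lambda>x\<in>S. q x * q' x) = \<iota> (\<lambda>x\<in>S. ?a x + ?b x)"
    unfolding \<iota>_add[OF r] using f f'
    by (simp add: \<iota>_mult ring_distribs mult_ac flip: f(4) f'(4))
  then show ?thesis unfolding value_at_def using f f' p
    by (rule_tac bexI[OF _ ring_closed(1)[OF r]], rule_tac bexI[OF _ ring_closed(2)[OF f(2) f'(2)]])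
       (simp add: field_simps)
qed

lemma value_at_inverse:
  assumes "value_at z v" "v \<noteq> 0"
  shows "value_at (inverse z) (inverse v)"
proof -
  obtain f q where f: "f \<in> R" "q \<in> R" "q p \<noteq> 0" "z * \<iota> q = \<iota> f" "v = f p / q p"
    using assms(1) unfolding value_at_def by blast
  have fp: "f p \<noteq> 0" using assms(2) f(5) by auto
  have "z \<noteq> 0" using \<iota>_nz[OF f(1) fp] f(4) by auto
  then have "inverse z * \<iota> f = \<iota> q" by (simp flip: f(4))
  then show ?thesis unfolding value_at_def using f fp
    by (rule_tac bexI[OF _ f(2)], rule_tac bexI[OF _ f(1)]) simp
qed

lemma value_at_power: "value_at z v \<Longrightarrow> value_at (z ^ l) (v ^ l)"
  by (induction l) (auto intro: value_at_one value_at_mult)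

lemma value_at_powi: "value_at z v \<Longrightarrow> v \<noteq> 0 \<Longrightarrow> value_at (z powi l) (v powi l)"
  by (auto simp: power_int_def intro: value_at_power value_at_inverse)

lemma value_at_prod: "(\<And>i. i \<in> A \<Longrightarrow> value_at (z i) (v i)) \<Longrightarrow> value_at (\<Prod>i\<in>A. z i) (\<Prod>i\<in>A. v i)"
  by (induction A rule: infinite_finite_induct) (auto intro: value_at_one value_at_mult)

lemma value_at_sum: "(\<And>i. i \<in> A \<Longrightarrow> value_at (z i) (v i)) \<Longrightarrow> value_at (\<Sum>i\<in>A. z i) (\<Sum>i\<in>A. v i)"
  by (induction A rule: infinite_finite_induct) (auto intro: value_at_zero value_at_add)

lemma value_at_of_int: "value_at (of_int l) (of_int l)"
proof -
  have nat: "value_at (of_nat l) (of_nat l)" for l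
    by (induction l) (auto intro: value_at_zero value_at_one value_at_add)
  have "value_at (\<iota> (\<lambda>x\<in>S. - 1)) (- 1)" using value_at_ring[OF const_closed, of "- 1"] p by simp
  moreover have "\<iota> (\<lambda>x\<in>S. - 1) = - 1"
  proof -
    have "(\<lambda>x\<in>S. (\<lambda>x\<in>S. 1::complex) x + (\<lambda>x\<in>S. - 1) x) = (\<lambda>x\<in>S. 0)" by (simp add: fun_eq_iff restrict_def)
    then have "1 + \<iota> (\<lambda>x\<in>S. - 1) = 0"
      using \<iota>_add[OF const_closed const_closed, of 1 "- 1"] by (simp add: \<iota>_one \<iota>_zero)
    then show ?thesis by (metis add.commute add_eq_0_iff)
  qed
  ultimately have neg: "value_at (- 1) (- 1)" by simp
  show ?thesis
  proof (cases l rule: int_cases)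
    case (nonneg m)
    then show ?thesis using nat by simp
  next
    case (neg m)
    then show ?thesis using value_at_mult[OF \<open>value_at (- 1) (- 1)\<close> nat[of "Suc m"]] by simp
  qed
qed

lemma value_at_mpoly_eval:
  assumes "\<And>i. i \<in> mpoly_vars F \<Longrightarrow> value_at (z i) (v i)"
  shows "value_at (mpoly_eval F z) (mpoly_eval F v)"
  unfolding mpoly_eval_def
  by (intro value_at_sum value_at_mult value_at_of_int value_at_prod value_at_power assms)
     (auto simp: mpoly_vars_def)

end

section \<open>The \<open>F\<close>-polynomials\<close>

context pinned_minors
begin

lemma F_polynomial_nonzero_point:
  fixes \<iota> :: "('m cmat \<Rightarrow> complex) \<Rightarrow> 'k::field"
  assumes frac: "fraction_field (L_cell D) \<iota>" and \<gamma>: "\<gamma> \<in> Pi_set D"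
    and F: "F_polynomial (rk D) (\<lambda>i. \<iota> (y_fun D \<Delta> i))
           (principal_seed (\<lambda>i. \<iota> (x_fun D \<Delta> (fund_weight i))) (B_cox D)) (\<iota> (x_fun D \<Delta> \<gamma>)) F"
    and t: "\<And>i. i \<in> index_set D \<Longrightarrow> t i \<noteq> 0"
  shows "mpoly_eval F t = \<Delta> \<gamma> \<gamma> (cell_point t)"
proof -
  interpret function_field "L_cell D" \<iota> "cell_point t"
    using frac cell_point_in_L_cell[OF t] by unfold_locales
  let ?seed = "principal_seed (\<lambda>i. \<iota> (x_fun D \<Delta> (fund_weight i))) (B_cox D)"
  let ?yh = "y_hat (rk D) (\<lambda>i. \<iota> (y_fun D \<Delta> i)) ?seed"
  obtain us i where us: "reduced_word D us" "i \<in> index_set D" "\<gamma> = word_act D us (fund_weight i)"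
    using Pi_setE[OF \<gamma>] .
  have x: "value_at (\<iota> (x_fun D \<Delta> (fund_weight i))) 1" if "i \<in> index_set D" for i
    using value_at_ring[OF x_fun_in_ring[of "fund_weight i" "[]" i]] x_fun_cell_point[OF t that] that
    by (simp add: reduced_Nil)
  have y: "value_at (\<iota> (y_fun D \<Delta> j)) (t j)" if "j \<in> index_set D" for j
    using value_at_ring[OF y_fun_in_ring[OF that]] y_fun_cell_point[OF t that] by simp
  \<comment> \<open>All Laurent monomials in the initial cluster take the value 1, so the unknown
    exponent vector g leaves no trace, and y-hat has the same value as y.\<close>
  have mono: "value_at (\<Prod>i\<in>index_set D. \<iota> (x_fun D \<Delta> (fund_weight i)) powi e i) 1" for e
    using value_at_prod[of "index_set D" _ "\<lambda>i. 1 powi e i", OF value_at_powi[OF x]] by simp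
  have yh: "value_at (?yh j) (t j)" if j: "j \<in> index_set D" for j
  proof -
    have "value_at (\<Prod>i\<in>index_set D. \<iota> (y_fun D \<Delta> i) powi trop_gen j i) (\<Prod>i\<in>index_set D. t i powi trop_gen j i)"
      by (intro value_at_prod value_at_powi y t)
    moreover have "(\<Prod>i\<in>index_set D. t i powi trop_gen j i) = t j"
    proof -
      have "(\<Prod>i\<in>index_set D. t i powi trop_gen j i) = (\<Prod>i\<in>{j}. t i powi trop_gen j i)"
        using j by (intro prod.mono_neutral_right) (auto simp: trop_gen_def)
      then show ?thesis by (simp add: trop_gen_def)
    qed
    ultimately show ?thesis
      using value_at_mult[OF _ mono[of "\<lambda>i. B_cox D i j"]]
      by (fastforce simp: y_hat_def principal_seed_def trop_val_def)
  qed
  obtain g where g: "\<iota> (x_fun D \<Delta> \<gamma>) =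
      (\<Prod>i\<in>index_set D. \<iota> (x_fun D \<Delta> (fund_weight i)) powi g i) * mpoly_eval F ?yh"
    and vars: "mpoly_vars F \<subseteq> index_set D"
    using F unfolding F_polynomial_def by (auto simp: principal_seed_def)
  have "value_at (\<iota> (x_fun D \<Delta> \<gamma>)) (1 * mpoly_eval F t)"
    unfolding g using vars yh by (intro value_at_mult mono value_at_mpoly_eval) auto
  moreover have "value_at (\<iota> (x_fun D \<Delta> \<gamma>)) (x_fun D \<Delta> \<gamma> (cell_point t))"
    by (rule value_at_ring[OF x_fun_in_ring[OF us(3,1,2)]])
  ultimately have "mpoly_eval F t = x_fun D \<Delta> \<gamma> (cell_point t)" using value_at_unique by fastforce
  then show ?thesis using cell_point_in_L_cell[OF t] by (simp add: x_fun_def)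
qed

end

section \<open>Passage to parameters that may vanish\<close>

lemma tendsto_matrix_mult:
  fixes A B :: "'m::finite cmat"
  assumes "X \<longlonglongrightarrow> A" "Y \<longlonglongrightarrow> B"
  shows "(\<lambda>n. X n ** Y n) \<longlonglongrightarrow> A ** B"
  unfolding matrix_matrix_mult_def
  by (intro tendsto_vec_lambda tendsto_sum tendsto_mult tendsto_vec_nth assms)

lemma (in pinned) cell_point_tendsto:
  assumes "\<And>i. (\<lambda>n. T n i) \<longlonglongrightarrow> t i"
  shows "(\<lambda>n. cell_point (T n)) \<longlonglongrightarrow> cell_point t"
proof -
  have "(\<lambda>n. mat_prod (map (\<lambda>i. x_pos D i (T n i)) ws)) \<longlonglongrightarrow> mat_prod (map (\<lambda>i. x_pos D i (t i)) ws)"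
    if "set ws \<subseteq> index_set D" for ws
    using that
  proof (induction ws)
    case (Cons i ws)
    then have "poly_curve (x_pos D i)" using root_subgroupD(1)[OF emb_facts(4)] by simp
    then have "(\<lambda>n. x_pos D i (T n i)) \<longlonglongrightarrow> x_pos D i (t i)"
      using isCont_tendsto_compose[OF continuous_poly_curve assms] by blast
    then show ?case using Cons by (auto intro: tendsto_matrix_mult)
  qed simp
  from this[of "rev [1..<Suc (rk D)]"] have "(\<lambda>n. mat_prod (map (\<lambda>i. x_pos D i (T n i)) (rev [1..<Suc (rk D)])))
      \<longlonglongrightarrow> mat_prod (map (\<lambda>i. x_pos D i (t i)) (rev [1..<Suc (rk D)]))"
    by (simp del: upt_Suc add: atLeastLessThanSuc_atLeastAtMost)
  then show ?thesis
    unfolding cell_point_def mat_prod_simps(3) by (intro tendsto_matrix_mult tendsto_const)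
qed

theorem theorem1p12:
  fixes D :: "('m::finite) pinned_group"
    and \<Delta> :: "weight \<Rightarrow> weight \<Rightarrow> 'm cmat \<Rightarrow> complex"
    and \<iota> :: "('m cmat \<Rightarrow> complex) \<Rightarrow> 'k::field"
    and \<gamma> :: weight
    and F :: int_mpoly
    and t :: "nat \<Rightarrow> complex"
  assumes "simply_connected_semisimple D"
    and "generalized_minors D \<Delta>"
    and "fraction_field (L_cell D) \<iota>"
    and "\<gamma> \<in> Pi_set D"
    and "F_polynomial (rk D) (\<lambda>i. \<iota> (y_fun D \<Delta> i))
           (principal_seed (\<lambda>i. \<iota> (x_fun D \<Delta> (fund_weight i))) (B_cox D))
           (\<iota> (x_fun D \<Delta> \<gamma>)) F"
  shows "mpoly_eval F t =
    \<Delta> \<gamma> \<gamma> (mat_prod (map (\<lambda>i. x_neg D i 1) [1..<Suc (rk D)] @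
                     map (\<lambda>i. x_pos D i (t i)) (rev [1..<Suc (rk D)])))"
proof -
  interpret pinned_minors D \<Delta>
    using assms(1,2) by unfold_locales
  \<comment> \<open>Only the vanishing coordinates are perturbed, so every T n is nonzero in all
    coordinates and lies in the range of the previous result.\<close>
  define T where "T n i = (if t i = 0 then 1 / of_nat (Suc n) else t i)" for n :: nat and i
  have T: "(\<lambda>n. T n i) \<longlonglongrightarrow> t i" for i
    using LIMSEQ_inverse_real_of_nat[THEN tendsto_of_real, where 'a=complex]
    by (cases "t i = 0") (simp_all add: T_def inverse_eq_divide)
  have nz: "T n i \<noteq> 0" for n i by (simp add: T_def del: of_nat_Suc)
  obtain us i where us: "reduced_word D us" "i \<in> index_set D" "\<gamma> = word_act D us (fund_weight i)"
    using Pi_setE[OF assms(4)] .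
  \<comment> \<open>The limit point may lie outside the cell, so continuity of the minor is taken on
    the whole group.\<close>
  have "(\<lambda>n. \<Delta> \<gamma> \<gamma> (cell_point (T n))) \<longlonglongrightarrow> \<Delta> \<gamma> \<gamma> (cell_point t)"
    unfolding us(3) by (intro regular_on_tendsto[OF minor_regular[OF us(1,1,2)]] cell_point_grp cell_point_tendsto T)
  moreover have "(\<lambda>n. mpoly_eval F (T n)) \<longlonglongrightarrow> mpoly_eval F t"
    unfolding mpoly_eval_def by (intro tendsto_intros T)
  moreover have "mpoly_eval F (T n) = \<Delta> \<gamma> \<gamma> (cell_point (T n))" for n
    by (rule F_polynomial_nonzero_point[OF assms(3-5) nz])
  ultimately have "mpoly_eval F t = \<Delta> \<gamma> \<gamma> (cell_point t)"
    by (simp add: LIMSEQ_unique)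
  then show ?thesis by (simp only: cell_point_def)
qed

end
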